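(* Let $\mathfrak g$ be the simple Lie algebra of type $D_r$ ($r\ge3$), with the ordering of the positive roots and the root vectors $F_\beta$ fixed in the context. Then: (a) for $1\le i<j\le r$, $$\eta_{\epsilon_j-\epsilon_i}=\frac1{t_1^{(i+1)}\prod_{u=i+2}^{j}(t_1^{(u)}-t_1^{(u-1)})};$$ (b) for $2\le j\le r$, $$\eta_{\epsilon_j+\epsilon_1}=\frac1{t_1^{(1)}\,(t_1^{(3)}-t_1^{(1)})\prod_{u=4}^{j}(t_1^{(u)}-t_1^{(u-1)})}\quad(j\ge3),\qquad \eta_{\epsilon_2+\epsilon_1}=\frac1{t_1^{(1)}};$$ (c) for $3\le i<j\le r$, $$\eta_{\epsilon_j+\epsilon_i}=\operatorname{Sym}_{(1^22^{i-2}1^{j-i}0^{r-j})}\Big(\frac{t_1^{(3)}-t_2^{(3)}}{t_2^{(i)}(t_1^{(1)}-t_2^{(3)})(t_1^{(2)}-t_2^{(3)})(t_1^{(3)}-t_1^{(1)})(t_1^{(3)}-t_1^{(2)})\prod_{u=3}^{i-1}(t_2^{(u)}-t_2^{(u+1)})\prod_{u=4}^{j}(t_1^{(u)}-t_1^{(u-1)})}\Big),$$ and for $i=2<j\le r$ the same formula holds with $t_2^{(3)}$ replaced by $0$ and the factor $t_2^{(i)}$ omitted, i.e. $$\eta_{\epsilon_j+\epsilon_2}=\frac{t_1^{(3)}}{t_1^{(1)}\,t_1^{(2)}\,(t_1^{(3)}-t_1^{(1)})(t_1^{(3)}-t_1^{(2)})\prod_{u=4}^{j}(t_1^{(u)}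-t_1^{(u-1)})}.$$
   Context: $\mathbb N=\{0,1,2,\dots\}$. For $k\in\mathbb N^r$ put $|k|=\sum_i k_i$ and consider variables $t^{(i)}_j$ ($1\le i\le r$, $1\le j\le k_i$). $G_k=\prod_i\Sigma_{k_i}$ permutes the variables with the same upper index, $\operatorname{Sym}_k x=\sum_{\pi\in G_k}\pi\cdot x$, and $dV_k=dt^{(1)}_1\wedge\dots\wedge dt^{(1)}_{k_1}\wedge\dots\wedge dt^{(r)}_1\wedge\dots\wedge dt^{(r)}_{k_r}$. $(1^22^{u}1^{v}0^{w})$ denotes the vector with two ones, then $u$ twos, then $v$ ones, then $w$ zeros. Empty products are $1$. $U_r$ is the free associative $\mathbb C$-algebra on $\tilde f_1,\dots,\tilde f_r$, and $U_r[k]$ is its part of multidegree $k$. For $J:\{1,\dots,|k|\}\to\{1,\dots,r\}$ with $\#J^{-1}(i)=k_i$ put $\tilde f_J=\tilde f_{J(|k|)}\cdots\tilde f_{J(1)}$, and identify variables $t_1,\dots,t_{|k|}$ with the $t^{(i)}_j$ by $t_u=t^{(J(u))}_{c(u)}$, where $c$ restricted to $J^{-1}(i)$ is the increasing bijection onto $\{1,\dots,k_i\}$. The canonical differential form is $\Omega_k=\sum_J\operatorname{Sym}_k\big(\prod_{u=1}^{|k|}\frac1{t_u-t_{u-1}}\big)dV_k\otimes\tilde f_J$ ($t_0=0$; in each summand the identification is given by $J$). $U(\mathfrak n_-)$ is generated by the Chevalley generators $f_1,\dots,f_r$ ($f_i$ corresponding to $\alpha_i$) subject to the Serre relations. $q:U_r\to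 U(\mathfrak n_-)$, $\tilde f_i\mapsto f_i$, is the quotient map, and $\Omega^{\mathfrak g}_k=(\mathrm{id}\otimes q)\Omega_k$. An element has content $k$ if it lies in $q(U_r[k])$. For a linear ordering $\beta_1<\dots<\beta_m$ of the positive roots and generators $F_\beta$ of the one-dimensional root spaces of $\mathfrak n_-$, let $F^p=F_{\beta_1}^{p_1}\cdots F_{\beta_m}^{p_m}$ ($p\in\mathbb N^m$) be the PBW basis. Define rational functions $\omega_p$ by $\Omega^{\mathfrak g}_k=\sum_p\omega_p\,dV_k\otimes F^p$, the sum being over $p$ with $F^p$ of content $k$. For a positive root $\beta$, $\eta_\beta$ denotes the coefficient $\omega_p$ for the $p$ with $F^p=F_\beta$. Type $D_r$ data: positive roots $\epsilon_j\pm\epsilon_i$ ($1\le i<j\le r$); simple roots $\alpha_1=\epsilon_1+\epsilon_2$ and $\alpha_i=\epsilon_i-\epsilon_{i-1}$ ($1<i\le r$). Thus $\epsilon_j-\epsilon_i=\sum_{u=i+1}^j\alpha_u$, $\epsilon_1+\epsilon_j=\alpha_1+\sum_{u=3}^j\alpha_u$, and $\epsilon_i+\epsilon_j=\alpha_1+\alpha_2+2\sum_{u=3}^i\alpha_u+\sum_{u=i+1}^j\alpha_u$ for $1<i<j$. Ordering: if $\beta=\epsilon_j\pm\epsilon_i$ and $\beta'=\epsilon_{j'}\pm\epsilon_{i'}$ (with $i<j$, $i'<j'$), then $\beta<\beta'$ if $j<j'$; and for $i'<i<j$, $\epsilon_j+\epsilon_i<\epsilon_j+\epsilon_{i'}<\epsilon_j-\epsilon_{i'}<\epsilon_j-\epsilon_i$.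 With the left-normed bracket $[f_{(a_1,\dots,a_n)}]=[\dots[[f_{a_1},f_{a_2}],f_{a_3}],\dots,f_{a_n}]$, the root vectors are $F_{\epsilon_j-\epsilon_i}=[f_{(j,j-1,\dots,i+1)}]$, $F_{\epsilon_1+\epsilon_j}=[f_{(j,j-1,\dots,3,1)}]$ (equal to $f_1$ for $j=2$), and for $1<i<j$, $F_{\epsilon_i+\epsilon_j}=[f_{(j,j-1,\dots,2,1,3,4,\dots,i-1,i)}]$ (equal to $[f_{(j,j-1,\dots,2,1)}]$ for $i=2$). *)

theory Defs
  imports
    Complex_Main
    "HOL-Library.Poly_Mapping"
    "HOL-Library.FuncSet"
    "HOL-Library.Product_Lexorder"
    "HOL-Computational_Algebra.Fraction_Field"
    "HOL-Combinatorics.Permutations"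
    "HOL-Algebra.QuotRing"
begin

section \<open>Rational functions in the variables \<open>t\<^sup>(\<^sup>i\<^sup>)\<^sub>j\<close>\<close>

text \<open>The variable with upper index \<open>i\<close> and lower index \<open>j\<close> is the pair \<open>(i, j)\<close>.
  The lexicographic order on pairs only serves to make the polynomials an integral domain.\<close>

type_synonym mpoly = "(nat \<times> nat \<Rightarrow>\<^sub>0 nat) \<Rightarrow>\<^sub>0 complex"
type_synonym ratfun = "mpoly fract"

definition scalar :: "complex \<Rightarrow> ratfun" where
  "scalar c = Fract (Poly_Mapping.single 0 c) 1"

definition tvar :: "nat \<Rightarrow> nat \<Rightarrow> ratfun" where
  "tvar i j = Fract (Poly_Mapping.single (Poly_Mapping.single (i, j) 1) 1) 1"

text \<open>Substitution of the variable \<open>\<sigma> v\<close> for \<open>v\<close>. On fractions it is meaningful for injective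
  \<open>\<sigma>\<close> only, where it does not depend on the chosen numerator and denominator
  (\<open>rename_Fract\<close> below).\<close>

definition rename_mono :: "(nat \<times> nat \<Rightarrow> nat \<times> nat) \<Rightarrow> (nat \<times> nat \<Rightarrow>\<^sub>0 nat) \<Rightarrow> (nat \<times> nat \<Rightarrow>\<^sub>0 nat)" where
  "rename_mono \<sigma> m = (\<Sum>v\<in>Poly_Mapping.keys m. Poly_Mapping.single (\<sigma> v) (Poly_Mapping.lookup m v))"

definition rename_poly :: "(nat \<times> nat \<Rightarrow> nat \<times> nat) \<Rightarrow> mpoly \<Rightarrow> mpoly" where
  "rename_poly \<sigma> P =
     (\<Sum>m\<in>Poly_Mapping.keys P. Poly_Mapping.single (rename_mono \<sigma> m) (Poly_Mapping.lookup P m))"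

definition rename :: "(nat \<times> nat \<Rightarrow> nat \<times> nat) \<Rightarrow> ratfun \<Rightarrow> ratfun" where
  "rename \<sigma> x =
     (let (P, Q) = (SOME (P, Q). Q \<noteq> 0 \<and> x = Fract P Q)
      in Fract (rename_poly \<sigma> P) (rename_poly \<sigma> Q))"

text \<open>\<open>perm_group r k\<close> is \<open>G\<^sub>k\<close>, realised as the permutations of the set of variables that
  preserve the upper index. As everywhere below, only \<open>k 1, \<dots>, k r\<close> matter.\<close>

definition variables :: "nat \<Rightarrow> (nat \<Rightarrow> nat) \<Rightarrow> (nat \<times> nat) set" where
  "variables r k = (SIGMA i:{1..r}. {1..k i})"

definition perm_group :: "nat \<Rightarrow> (nat \<Rightarrow> nat) \<Rightarrow> (nat \<times> nat \<Rightarrow> nat \<times> nat) set" where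
  "perm_group r k = {\<sigma>. \<sigma> permutes variables r k \<and> (\<forall>v. fst (\<sigma> v) = fst v)}"

definition Sym :: "nat \<Rightarrow> (nat \<Rightarrow> nat) \<Rightarrow> ratfun \<Rightarrow> ratfun" where
  "Sym r k x = (\<Sum>\<sigma>\<in>perm_group r k. rename \<sigma> x)"

subsection \<open>Renaming is a field homomorphism\<close>

lemma rename_mono_superset:
  assumes "finite A" "Poly_Mapping.keys m \<subseteq> A"
  shows "rename_mono \<sigma> m = (\<Sum>v\<in>A. Poly_Mapping.single (\<sigma> v) (Poly_Mapping.lookup m v))"
  unfolding rename_mono_def using assms
  by (intro sum.mono_neutral_left) (auto simp: in_keys_iff)

lemma rename_mono_add: "rename_mono \<sigma> (m + n) = rename_mono \<sigma> m + rename_mono \<sigma> n"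
proof -
  let ?A = "Poly_Mapping.keys m \<union> Poly_Mapping.keys n"
  have "Poly_Mapping.keys (m + n) \<subseteq> ?A" by (rule keys_add)
  then show ?thesis
    by (simp add: rename_mono_superset[of ?A] lookup_add single_add sum.distrib)
qed

lemma rename_mono_zero [simp]: "rename_mono \<sigma> 0 = 0"
  by (simp add: rename_mono_def)

lemma rename_mono_single [simp]:
  "rename_mono \<sigma> (Poly_Mapping.single v n) = Poly_Mapping.single (\<sigma> v) n"
  by (simp add: rename_mono_def)

lemma inj_rename_mono:
  assumes "inj \<sigma>"
  shows "inj (rename_mono \<sigma>)"
proof (rule injI, rule poly_mapping_eqI)
  have *: "Poly_Mapping.lookup (rename_mono \<sigma> m) (\<sigma> v) = Poly_Mapping.lookup m v" for m v
  proof -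
    have "Poly_Mapping.lookup (rename_mono \<sigma> m) (\<sigma> v)
        = (\<Sum>u\<in>insert v (Poly_Mapping.keys m). if u = v then Poly_Mapping.lookup m u else 0)"
      using assms
      by (subst rename_mono_superset[of "insert v (Poly_Mapping.keys m)"])
        (auto simp: lookup_sum lookup_single when_def inj_eq intro!: sum.cong)
    then show ?thesis by (simp add: sum.delta)
  qed
  fix m n v assume "rename_mono \<sigma> m = rename_mono \<sigma> n"
  then show "Poly_Mapping.lookup m v = Poly_Mapping.lookup n v" by (metis *)
qed

lemma rename_poly_superset:
  assumes "finite A" "Poly_Mapping.keys P \<subseteq> A"
  shows "rename_poly \<sigma> P
    = (\<Sum>m\<in>A. Poly_Mapping.single (rename_mono \<sigma> m) (Poly_Mapping.lookup P m))"
  unfolding rename_poly_def using assms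
  by (intro sum.mono_neutral_left) (auto simp: in_keys_iff)

lemma rename_poly_add: "rename_poly \<sigma> (P + Q) = rename_poly \<sigma> P + rename_poly \<sigma> Q"
proof -
  let ?A = "Poly_Mapping.keys P \<union> Poly_Mapping.keys Q"
  have "Poly_Mapping.keys (P + Q) \<subseteq> ?A" by (rule keys_add)
  then show ?thesis
    by (simp add: rename_poly_superset[of ?A] lookup_add single_add sum.distrib)
qed

lemma rename_poly_zero [simp]: "rename_poly \<sigma> 0 = 0"
  by (simp add: rename_poly_def)

lemma rename_poly_single [simp]:
  "rename_poly \<sigma> (Poly_Mapping.single m c) = Poly_Mapping.single (rename_mono \<sigma> m) c"
  by (simp add: rename_poly_def)

lemma rename_poly_one [simp]: "rename_poly \<sigma> 1 = 1"
  by (metis rename_mono_zero rename_poly_single single_one)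

lemma rename_poly_sum: "rename_poly \<sigma> (sum f A) = (\<Sum>a\<in>A. rename_poly \<sigma> (f a))"
  by (induction A rule: infinite_finite_induct) (auto simp: rename_poly_add)

lemma poly_mapping_monomials:
  fixes P :: "'a \<Rightarrow>\<^sub>0 'b::comm_monoid_add"
  shows "P = (\<Sum>m\<in>Poly_Mapping.keys P. Poly_Mapping.single m (Poly_Mapping.lookup P m))"
proof (rule poly_mapping_eqI)
  fix k
  have "(\<Sum>m\<in>Poly_Mapping.keys P. if m = k then Poly_Mapping.lookup P m else 0)
      = Poly_Mapping.lookup P k"
    by (simp add: sum.delta in_keys_iff)
  then show "Poly_Mapping.lookup P k = Poly_Mapping.lookup
      (\<Sum>m\<in>Poly_Mapping.keys P. Poly_Mapping.single m (Poly_Mapping.lookup P m)) k"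
    by (simp add: lookup_sum lookup_single when_def)
qed

lemma rename_poly_mult: "rename_poly \<sigma> (P * Q) = rename_poly \<sigma> P * rename_poly \<sigma> Q"
proof -
  let ?s = "\<lambda>P m. Poly_Mapping.single m (Poly_Mapping.lookup P m)"
  have "P * Q = (\<Sum>m\<in>Poly_Mapping.keys P. ?s P m) * (\<Sum>n\<in>Poly_Mapping.keys Q. ?s Q n)"
    using poly_mapping_monomials[of P] poly_mapping_monomials[of Q] by simp
  then have "rename_poly \<sigma> (P * Q)
      = (\<Sum>m\<in>Poly_Mapping.keys P. \<Sum>n\<in>Poly_Mapping.keys Q. rename_poly \<sigma> (?s P m * ?s Q n))"
    by (simp add: sum_product rename_poly_sum)
  also have "\<dots> = rename_poly \<sigma> P * rename_poly \<sigma> Q"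
    by (simp add: mult_single rename_mono_add rename_poly_def[of \<sigma> P] rename_poly_def[of \<sigma> Q] sum_product)
  finally show ?thesis .
qed

lemma rename_poly_eq_0_iff:
  assumes "inj \<sigma>"
  shows "rename_poly \<sigma> P = 0 \<longleftrightarrow> P = 0"
proof
  assume *: "rename_poly \<sigma> P = 0"
  show "P = 0"
  proof (rule poly_mapping_eqI)
    fix k
    have "Poly_Mapping.lookup (rename_poly \<sigma> P) (rename_mono \<sigma> k)
        = (\<Sum>m\<in>insert k (Poly_Mapping.keys P). if m = k then Poly_Mapping.lookup P m else 0)"
      using inj_rename_mono[OF assms]
      by (subst rename_poly_superset[of "insert k (Poly_Mapping.keys P)"])
        (auto simp: lookup_sum lookup_single when_def inj_eq intro!: sum.cong)
    then show "Poly_Mapping.lookup P k = Poly_Mapping.lookup 0 k"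
      by (simp add: sum.delta *)
  qed
qed simp

lemma rename_Fract:
  assumes "inj \<sigma>" "Q \<noteq> 0"
  shows "rename \<sigma> (Fract P Q) = Fract (rename_poly \<sigma> P) (rename_poly \<sigma> Q)"
proof -
  obtain P' Q' where PQ: "(SOME (P', Q'). Q' \<noteq> 0 \<and> Fract P Q = Fract P' Q') = (P', Q')"
    by fastforce
  have "case (SOME (P', Q'). Q' \<noteq> 0 \<and> Fract P Q = Fract P' Q') of
      (P', Q') \<Rightarrow> Q' \<noteq> 0 \<and> Fract P Q = Fract P' Q'"
    by (rule someI_ex) (use assms in auto)
  then have *: "Q' \<noteq> 0" "Fract P Q = Fract P' Q'"
    by (simp_all add: PQ)
  then have "rename_poly \<sigma> (P * Q') = rename_poly \<sigma> (P' * Q)"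
    using assms by (simp add: eq_fract)
  then show ?thesis
    using assms * by (simp add: rename_def PQ eq_fract rename_poly_mult rename_poly_eq_0_iff)
qed

lemma rename_add: "inj \<sigma> \<Longrightarrow> rename \<sigma> (x + y) = rename \<sigma> x + rename \<sigma> y"
  by (cases x; cases y)
    (simp add: rename_Fract rename_poly_eq_0_iff rename_poly_add rename_poly_mult)

lemma rename_mult: "inj \<sigma> \<Longrightarrow> rename \<sigma> (x * y) = rename \<sigma> x * rename \<sigma> y"
  by (cases x; cases y) (simp add: rename_Fract rename_poly_mult)

lemma rename_scalar: "inj \<sigma> \<Longrightarrow> rename \<sigma> (scalar c) = scalar c"
  by (simp add: scalar_def rename_Fract)

lemma rename_tvar: "inj \<sigma> \<Longrightarrow> rename \<sigma> (tvar i j) = tvar (fst (\<sigma> (i, j))) (snd (\<sigma> (i, j)))"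
  by (simp add: tvar_def rename_Fract)


section \<open>The free associative algebra and \<open>U(n\<^sub>-)\<close>\<close>

text \<open>Finitely supported functions on the free monoid of words, with the convolution product,
  form the free associative algebra. Words are wrapped to obtain a monoid type.\<close>

datatype fword = Word (letters: "nat list")

instantiation fword :: monoid_add
begin

definition zero_fword :: fword where "zero_fword = Word []"

definition plus_fword :: "fword \<Rightarrow> fword \<Rightarrow> fword" where
  "plus_fword u v = Word (letters u @ letters v)"

instance
  by standard (auto simp: zero_fword_def plus_fword_def)

end

type_synonym freealg = "fword \<Rightarrow>\<^sub>0 complex"

definition gen :: "nat \<Rightarrow> freealg" where
  "gen i = Poly_Mapping.single (Word [i]) 1"

definition free_alg :: "nat \<Rightarrow> freealg ring" where
  "free_alg r = \<lparr>carrier = {x. \<forall>w\<in>Poly_Mapping.keys x. set (letters w) \<subseteq> {1..r}},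
                 monoid.mult = (*), one = 1, zero = 0, add = (+)\<rparr>"

definition multideg_part :: "nat \<Rightarrow> (nat \<Rightarrow> nat) \<Rightarrow> freealg set" where
  "multideg_part r k = {x \<in> carrier (free_alg r).
     \<forall>w\<in>Poly_Mapping.keys x. \<forall>i\<in>{1..r}. count_list (letters w) i = k i}"

definition comm :: "freealg \<Rightarrow> freealg \<Rightarrow> freealg" where
  "comm x y = x * y - y * x"

text \<open>A vector of the root lattice is a function giving the coefficients of the \<open>\<epsilon>\<^sub>u\<close>.\<close>

definition eps :: "nat \<Rightarrow> nat \<Rightarrow> int" where
  "eps i u = (if u = i then 1 else 0)"

definition simple_root :: "nat \<Rightarrow> nat \<Rightarrow> int" where
  "simple_root i u = (if i = 1 then eps 1 u + eps 2 u else eps i u - eps (i - 1) u)"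

definition cartan :: "nat \<Rightarrow> nat \<Rightarrow> nat \<Rightarrow> int" where
  "cartan r i j = 2 * (\<Sum>u=1..r. simple_root i u * simple_root j u)
                    div (\<Sum>u=1..r. simple_root i u * simple_root i u)"

definition serre_relations :: "nat \<Rightarrow> freealg set" where
  "serre_relations r =
     {(comm (gen i) ^^ nat (1 - cartan r i j)) (gen j) | i j. i \<in> {1..r} \<and> j \<in> {1..r} \<and> i \<noteq> j}"

definition serre_ideal :: "nat \<Rightarrow> freealg set" where
  "serre_ideal r = Idl\<^bsub>free_alg r\<^esub> (serre_relations r)"

definition U_nminus :: "nat \<Rightarrow> freealg set ring" where
  "U_nminus r = free_alg r Quot serre_ideal r"

definition qmap :: "nat \<Rightarrow> freealg \<Rightarrow> freealg set" where
  "qmap r x = serre_ideal r +>\<^bsub>free_alg r\<^esub> x"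

lemma ring_free_alg: "ring (free_alg r)"
proof -
  define C :: "freealg set"
    where "C = {x. \<forall>w\<in>Poly_Mapping.keys x. set (letters w) \<subseteq> {1..r}}"
  have R: "free_alg r = \<lparr>carrier = C, monoid.mult = (*), one = 1, zero = 0, add = (+)\<rparr>"
    by (simp add: free_alg_def C_def)
  have add: "x + y \<in> C" if "x \<in> C" "y \<in> C" for x y
    using that keys_add[of x y] unfolding C_def by blast
  have neg: "- x \<in> C" if "x \<in> C" for x
    using that by (simp add: C_def keys.rep_eq)
  have mult: "x * y \<in> C" if "x \<in> C" "y \<in> C" for x y
    unfolding C_def
  proof (intro CollectI ballI)
    fix w assume "w \<in> Poly_Mapping.keys (x * y)"
    then obtain u v where "w = u + v" "u \<in> Poly_Mapping.keys x" "v \<in> Poly_Mapping.keys y"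
      using keys_mult[of x y] by blast
    then have "set (letters u) \<subseteq> {1..r}" "set (letters v) \<subseteq> {1..r}" "w = u + v"
      using that unfolding C_def by blast+
    then show "set (letters w) \<subseteq> {1..r}"
      by (simp add: plus_fword_def)
  qed
  have zero: "0 \<in> C" and one: "1 \<in> C"
    by (simp_all add: C_def zero_fword_def)
  have "abelian_group (free_alg r)"
  proof (rule abelian_groupI)
    fix x assume "x \<in> carrier (free_alg r)"
    then show "\<exists>y\<in>carrier (free_alg r). y \<oplus>\<^bsub>free_alg r\<^esub> x = \<zero>\<^bsub>free_alg r\<^esub>"
      by (intro bexI[of _ "- x"]) (simp_all add: R neg)
  qed (simp_all add: R add zero algebra_simps)
  moreover have "Group.monoid (free_alg r)"
    by (rule monoidI) (simp_all add: R mult one mult.assoc)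
  ultimately show ?thesis
    by (rule ringI) (simp_all add: R algebra_simps)
qed

lemma gen_in_carrier: "i \<in> {1..r} \<Longrightarrow> gen i \<in> carrier (free_alg r)"
  by (simp add: gen_def free_alg_def)

lemma comm_in_carrier:
  assumes "x \<in> carrier (free_alg r)" "y \<in> carrier (free_alg r)"
  shows "comm x y \<in> carrier (free_alg r)"
proof -
  interpret ring "free_alg r" by (rule ring_free_alg)
  have neg: "- z \<in> carrier (free_alg r)" if "z \<in> carrier (free_alg r)" for z
    using that by (simp add: free_alg_def keys.rep_eq)
  have "comm x y = x \<otimes>\<^bsub>free_alg r\<^esub> y \<oplus>\<^bsub>free_alg r\<^esub> (- (y \<otimes>\<^bsub>free_alg r\<^esub> x))"
    by (simp add: comm_def free_alg_def)
  also have "\<dots> \<in> carrier (free_alg r)"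
    by (intro a_closed m_closed neg assms)
  finally show ?thesis .
qed

lemma serre_relations_in_carrier: "serre_relations r \<subseteq> carrier (free_alg r)"
proof -
  have "(comm (gen i) ^^ n) (gen j) \<in> carrier (free_alg r)"
    if "i \<in> {1..r}" "j \<in> {1..r}" for i j n
    using gen_in_carrier[OF that(1)] gen_in_carrier[OF that(2)]
    by (induction n) (simp_all add: comm_in_carrier)
  then show ?thesis by (auto simp: serre_relations_def)
qed

lemma ideal_serre_ideal: "ideal (serre_ideal r) (free_alg r)"
  unfolding serre_ideal_def
  by (rule ring.genideal_ideal[OF ring_free_alg serre_relations_in_carrier])

lemma qmap_ring_hom: "qmap r \<in> ring_hom (free_alg r) (U_nminus r)"
  unfolding qmap_def U_nminus_def by (rule ideal.rcos_ring_hom[OF ideal_serre_ideal])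


section \<open>Extension of scalars\<close>

text \<open>Let \<open>K\<close> be the field of rational functions. Having the words as a basis, \<open>K \<otimes> U\<^sub>r\<close> consists
  of the \<open>K\<close>-valued finitely supported functions on words. By right exactness of the tensor
  product, \<open>K \<otimes> U(n\<^sub>-)\<close> is its quotient by the image of \<open>K \<otimes> serre_ideal r\<close>, and
  \<open>id_tensor_qmap r\<close> is \<open>id \<otimes> q\<close>.\<close>

definition tensor :: "ratfun \<Rightarrow> freealg \<Rightarrow> (fword \<Rightarrow>\<^sub>0 ratfun)" where
  "tensor a x = Poly_Mapping.map (\<lambda>c. a * scalar c) x"

inductive_set serre_tensor :: "nat \<Rightarrow> (fword \<Rightarrow>\<^sub>0 ratfun) set" for r :: nat where
  zero: "0 \<in> serre_tensor r"
| add: "y \<in> serre_ideal r \<Longrightarrow> z \<in> serre_tensor r \<Longrightarrow> tensor a y + z \<in> serre_tensor r"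

definition id_tensor_qmap :: "nat \<Rightarrow> (fword \<Rightarrow>\<^sub>0 ratfun) \<Rightarrow> (fword \<Rightarrow>\<^sub>0 ratfun) set" where
  "id_tensor_qmap r x = (\<lambda>z. x + z) ` serre_tensor r"


section \<open>The canonical differential form\<close>

definition total :: "nat \<Rightarrow> (nat \<Rightarrow> nat) \<Rightarrow> nat" where
  "total r k = (\<Sum>i=1..r. k i)"

definition labellings :: "nat \<Rightarrow> (nat \<Rightarrow> nat) \<Rightarrow> (nat \<Rightarrow> nat) set" where
  "labellings r k = {J \<in> {1..total r k} \<rightarrow>\<^sub>E {1..r}.
     \<forall>i\<in>{1..r}. card {u \<in> {1..total r k}. J u = i} = k i}"

text \<open>\<open>t\<^sub>u\<close> under the identification given by \<open>J\<close>, with \<open>t\<^sub>0 = 0\<close>; the cardinality is \<open>c(u)\<close>,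
  the rank of \<open>u\<close> in the fibre \<open>J\<^sup>-\<^sup>1(J(u))\<close>.\<close>

definition label_var :: "(nat \<Rightarrow> nat) \<Rightarrow> nat \<Rightarrow> ratfun" where
  "label_var J u = (if u = 0 then 0 else tvar (J u) (card {v \<in> {1..u}. J v = J u}))"

definition label_word :: "nat \<Rightarrow> (nat \<Rightarrow> nat) \<Rightarrow> freealg" where
  "label_word n J = prod_list (map (\<lambda>u. gen (J u)) (rev [1..<n + 1]))"

text \<open>All forms of multidegree \<open>k\<close> are multiples of \<open>dV\<^sub>k\<close>, and \<open>Omega r k\<close> is the coefficient
  of \<open>dV\<^sub>k\<close> in \<open>\<Omega>\<^sub>k\<close>.\<close>

definition Omega :: "nat \<Rightarrow> (nat \<Rightarrow> nat) \<Rightarrow> (fword \<Rightarrow>\<^sub>0 ratfun)" where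
  "Omega r k = (\<Sum>J\<in>labellings r k.
     tensor (Sym r k (\<Prod>u=1..total r k. 1 / (label_var J u - label_var J (u - 1))))
            (label_word (total r k) J))"


section \<open>Positive roots and root vectors\<close>

text \<open>\<open>EpsPlus j i\<close> and \<open>EpsMinus j i\<close>, with \<open>i < j\<close>, stand for
  \<open>\<epsilon>\<^sub>j + \<epsilon>\<^sub>i\<close> and \<open>\<epsilon>\<^sub>j - \<epsilon>\<^sub>i\<close>.\<close>

datatype root = EpsPlus nat nat | EpsMinus nat nat

fun root_vec :: "root \<Rightarrow> nat \<Rightarrow> int" where
  "root_vec (EpsPlus j i) = (\<lambda>u. eps j u + eps i u)"
| "root_vec (EpsMinus j i) = (\<lambda>u. eps j u - eps i u)"

definition positive_roots :: "nat \<Rightarrow> root set" where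
  "positive_roots r = {EpsPlus j i | i j. 1 \<le> i \<and> i < j \<and> j \<le> r}
                    \<union> {EpsMinus j i | i j. 1 \<le> i \<and> i < j \<and> j \<le> r}"

fun root_less :: "root \<Rightarrow> root \<Rightarrow> bool" where
  "root_less (EpsPlus j i) (EpsPlus j' i') \<longleftrightarrow> j < j' \<or> j = j' \<and> i' < i"
| "root_less (EpsPlus j i) (EpsMinus j' i') \<longleftrightarrow> j \<le> j'"
| "root_less (EpsMinus j i) (EpsPlus j' i') \<longleftrightarrow> j < j'"
| "root_less (EpsMinus j i) (EpsMinus j' i') \<longleftrightarrow> j < j' \<or> j = j' \<and> i < i'"

text \<open>The positive roots in increasing order, see \<open>sorted_root_list\<close>.\<close>

definition root_list :: "nat \<Rightarrow> root list" where
  "root_list r = concat (map (\<lambda>j. map (EpsPlus j) (rev [1..<j]) @ map (EpsMinus j) [1..<j]) [2..<r + 1])"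

lemma set_root_list: "set (root_list r) = positive_roots r"
  by (auto simp: root_list_def positive_roots_def image_iff)

lemma sorted_root_list: "sorted_wrt root_less (root_list r)"
proof -
  have "sorted_wrt root_less
      (concat (map (\<lambda>j. map (EpsPlus j) (rev [1..<j]) @ map (EpsMinus j) [1..<j]) [2..<n]))" for n
    by (induction n)
      (auto simp: sorted_wrt_append sorted_wrt_map sorted_wrt_rev upt_Suc)
  then show ?thesis by (simp only: root_list_def)
qed

text \<open>Coefficients of a positive root with respect to the simple roots.\<close>

fun root_content :: "root \<Rightarrow> nat \<Rightarrow> nat" where
  "root_content (EpsMinus j i) = (\<lambda>u. if u \<in> {i + 1..j} then 1 else 0)"
| "root_content (EpsPlus j i) =
     (if i = 1 then (\<lambda>u. if u \<in> insert 1 {3..j} then 1 else 0)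
      else (\<lambda>u. if u \<in> {1, 2} then 1 else if u \<in> {3..i} then 2 else if u \<in> {i + 1..j} then 1 else 0))"

fun lbracket :: "nat list \<Rightarrow> freealg" where
  "lbracket [] = 0"
| "lbracket (a # as) = foldl (\<lambda>x b. comm x (gen b)) (gen a) as"

text \<open>Lifts to the free algebra of the root vectors \<open>F\<^sub>\<beta>\<close> and of the monomials \<open>F\<^sup>p\<close>; note that
  \<open>q\<close> is multiplicative, so that \<open>F\<^sup>p\<close> is the image of \<open>pbw_monomial r p\<close>.\<close>

fun root_vector :: "root \<Rightarrow> freealg" where
  "root_vector (EpsMinus j i) = lbracket (rev [i + 1..<j + 1])"
| "root_vector (EpsPlus j i) =
     (if i = 1 then lbracket (rev [3..<j + 1] @ [1])
      else lbracket (rev [1..<j + 1] @ [3..<i + 1]))"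

definition pbw_monomial :: "nat \<Rightarrow> (root \<Rightarrow> nat) \<Rightarrow> freealg" where
  "pbw_monomial r p = prod_list (map (\<lambda>\<beta>. root_vector \<beta> ^ p \<beta>) (root_list r))"


section \<open>The coefficients of \<open>\<Omega>\<^sup>g\<^sub>k\<close>\<close>

definition pbw_exponents :: "nat \<Rightarrow> (nat \<Rightarrow> nat) \<Rightarrow> (root \<Rightarrow> nat) set" where
  "pbw_exponents r k = {p. (\<forall>\<beta>. \<beta> \<notin> positive_roots r \<longrightarrow> p \<beta> = 0) \<and>
     qmap r (pbw_monomial r p) \<in> qmap r ` multideg_part r k}"

definition Omega_g :: "nat \<Rightarrow> (nat \<Rightarrow> nat) \<Rightarrow> (fword \<Rightarrow>\<^sub>0 ratfun) set" where
  "Omega_g r k = id_tensor_qmap r (Omega r k)"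

definition pbw_expansion :: "nat \<Rightarrow> (nat \<Rightarrow> nat) \<Rightarrow> ((root \<Rightarrow> nat) \<Rightarrow> ratfun) \<Rightarrow> bool" where
  "pbw_expansion r k \<omega> \<longleftrightarrow>
     finite {p. \<omega> p \<noteq> 0} \<and> {p. \<omega> p \<noteq> 0} \<subseteq> pbw_exponents r k \<and>
     Omega_g r k = id_tensor_qmap r (\<Sum>p | \<omega> p \<noteq> 0. tensor (\<omega> p) (pbw_monomial r p))"

text \<open>By the Poincare-Birkhoff-Witt theorem there is exactly one such family. A statement about
  \<open>omega\<close> is therefore provable only together with existence of the expansion and uniqueness
  of the coefficients concerned.\<close>

definition omega :: "nat \<Rightarrow> (nat \<Rightarrow> nat) \<Rightarrow> (root \<Rightarrow> nat) \<Rightarrow> ratfun" where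
  "omega r k = (SOME \<omega>. pbw_expansion r k \<omega>)"

definition eta :: "nat \<Rightarrow> root \<Rightarrow> ratfun" where
  "eta r \<beta> = omega r (root_content \<beta>) (\<lambda>\<gamma>. if \<gamma> = \<beta> then 1 else 0)"

text \<open>The vector \<open>(1\<^sup>2 2\<^sup>a 1\<^sup>b 0\<^sup>c)\<close>, with entries indexed from 1.\<close>

definition content_vec :: "nat \<Rightarrow> nat \<Rightarrow> nat \<Rightarrow> nat \<Rightarrow> nat" where
  "content_vec a b c n =
     (let xs = replicate 2 1 @ replicate a 2 @ replicate b 1 @ replicate c 0
      in if n \<in> {1..length xs} then xs ! (n - 1) else 0)"

lemma root_content_eq_content_vec:
  assumes "2 \<le> i" "i < j" "j \<le> r"
  shows "root_content (EpsPlus j i) = content_vec (i - 2) (j - i) (r - j)"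
proof
  fix n show "root_content (EpsPlus j i) n = content_vec (i - 2) (j - i) (r - j) n"
    using assms by (auto simp: content_vec_def nth_append nth_Cons' numeral_2_eq_2)
qed

lemma sum_simple_roots:
  assumes "1 \<le> a" "a \<le> b"
  shows "(\<Sum>i=a+1..b. simple_root i u) = eps b u - eps a u"
  using assms(2,1) by (induction rule: dec_induct) (auto simp: simple_root_def)

lemma root_vec_eq_sum_simple_roots:
  assumes "\<beta> \<in> positive_roots r"
  shows "root_vec \<beta> u = (\<Sum>i=1..r. int (root_content \<beta> i) * simple_root i u)"
proof -
  have restrict: "(\<Sum>i=1..r. (if i \<in> A then 1 else 0) * simple_root i u) = (\<Sum>i\<in>A. simple_root i u)"
    if "A \<subseteq> {1..r}" for A
    using that by (intro sum.mono_neutral_cong_right) auto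
  from assms consider
      (minus) i j where "\<beta> = EpsMinus j i" "1 \<le> i" "i < j" "j \<le> r"
    | (plus1) j where "\<beta> = EpsPlus j 1" "1 < j" "j \<le> r"
    | (plus) i j where "\<beta> = EpsPlus j i" "2 \<le> i" "i < j" "j \<le> r"
    unfolding positive_roots_def by (force simp: le_Suc_eq)
  then show ?thesis
  proof cases
    case minus
    have "(\<Sum>n=1..r. int (root_content \<beta> n) * simple_root n u)
        = (\<Sum>n=1..r. (if n \<in> {i + 1..j} then 1 else 0) * simple_root n u)"
      using minus by (intro sum.cong) auto
    also have "\<dots> = eps j u - eps i u"
      using minus by (subst restrict) (auto simp: sum_simple_roots[of i j u, simplified])
    finally show ?thesis using minus by simp
  next
    case plus1
    have "(\<Sum>n=1..r. int (root_content \<beta> n) * simple_root n u)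
        = (\<Sum>n=1..r. (if n \<in> insert 1 {3..j} then 1 else 0) * simple_root n u)"
      using plus1 by (intro sum.cong) auto
    also have "\<dots> = simple_root 1 u + (eps j u - eps 2 u)"
      using plus1 sum_simple_roots[of 2 j u] by (subst restrict) auto
    finally show ?thesis using plus1 by (simp add: simple_root_def)
  next
    case plus
    have "(\<Sum>n=1..r. int (root_content \<beta> n) * simple_root n u)
        = (\<Sum>n=1..r. (if n \<in> {1, 2} then 1 else 0) * simple_root n u)
        + (\<Sum>n=1..r. (if n \<in> {3..j} then 1 else 0) * simple_root n u)
        + (\<Sum>n=1..r. (if n \<in> {3..i} then 1 else 0) * simple_root n u)"
      using plus unfolding sum.distrib[symmetric] by (intro sum.cong) auto
    also have "\<dots> = (simple_root 1 u + simple_root 2 u) + (eps j u - eps 2 u) + (eps i u - eps 2 u)"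
      using plus sum_simple_roots[of 2 j u] sum_simple_roots[of 2 i u]
      by (subst (1 2 3) restrict) auto
    finally show ?thesis using plus by (simp add: simple_root_def)
  qed
qed

end

theory Submission
  imports Defs "HOL-Library.Multiset"
begin

text \<open>Let \<open>U(n\<^sub>-)\<close> act on the vector representation, with weights \<open>\<plusminus>\<epsilon>\<^sub>u\<close>. For \<open>i < j\<close>, the matrix
  coefficient between \<open>\<epsilon>\<^sub>j\<close> and \<open>\<plusminus>\<epsilon>\<^sub>i\<close> vanishes on every ordered PBW monomial with at least two
  factors and on every root vector except the one of \<open>\<epsilon>\<^sub>j \<minusplus> \<epsilon>\<^sub>i\<close>, where it is 1. Applied to
  \<open>\<Omega>\<^sub>k\<close>, it therefore gives \<open>\<eta>\<close> as the sum over the words which label the paths between the two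
  weights. There is one such path, except for \<open>\<epsilon>\<^sub>j + \<epsilon>\<^sub>i\<close> with \<open>i \<ge> 2\<close>, where the path turns
  through either \<open>\<epsilon>\<^sub>1\<close> or \<open>-\<epsilon>\<^sub>1\<close>, and the two fractions add up to the stated one. That the
  expansion exists at all is the spanning half of the PBW theorem, for which the Serre relations
  must be shown to imply that the root vectors span a Lie algebra; by the Jacobi identity it is
  enough to bracket root vectors with the generators.\<close>

text \<open>Since \<open>eta\<close> rests on a choice of expansion, the functional is applied to an
  arbitrary one: it returns the same value for each, and the spanning statement ensures that there
  is one to choose. An expansion may use only monomials of content \<open>k\<close>, so the whole
  spanning argument carries along the multiset of letters. The hard relations are the brackets that
  must vanish although the new letter is adjacent to letters inside the root vector. Most of them
  come from one identity in type A3, \<open>null_A3\<close>, whose outer nodes may be composite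
  elements: the part of a bracket that precedes the critical letters serves as one node. The
  identity yields twice the bracket, hence the halving in \<open>null_double\<close>. Words are read
  from left to right, which is a right action. As the monomial of a labelling lists the labels
  backwards, the path of a labelling starts with its last label.\<close>

lemma poly_mapping_induct_add [case_names zero single add]:
  fixes x :: "'a \<Rightarrow>\<^sub>0 'b::comm_monoid_add"
  assumes "P 0" "\<And>m c. P (Poly_Mapping.single m c)" "\<And>x y. P x \<Longrightarrow> P y \<Longrightarrow> P (x + y)"
  shows "P x"
proof -
  have "P (\<Sum>m\<in>A. Poly_Mapping.single m (f m))" for A and f :: "'a \<Rightarrow> 'b"
    by (induction A rule: infinite_finite_induct) (auto intro: assms)
  from this[where A = "Poly_Mapping.keys x" and f = "Poly_Mapping.lookup x"] show ?thesis
    by (simp flip: poly_mapping_monomials)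
qed

text \<open>The index \<open>0\<close> is the empty word, so \<open>Poly_Mapping.single 0 c\<close>
  is the scalar \<open>c\<close> inside the free algebra, and scalars are central.\<close>

lemma mult_scale_right: "x * (Poly_Mapping.single 0 c * y) = Poly_Mapping.single 0 c * (x * y)"
  for x y :: freealg
proof -
  have "x * Poly_Mapping.single 0 c = Poly_Mapping.single 0 c * x"
    by (induction x rule: poly_mapping_induct_add) (simp_all add: mult_single algebra_simps)
  then show ?thesis by (metis mult.assoc)
qed

lemma comm_scale_left: "comm (Poly_Mapping.single 0 c * x) y = Poly_Mapping.single 0 c * comm x y"
  by (simp add: comm_def mult_scale_right algebra_simps)

section \<open>The Serre ideal\<close>

text \<open>Erasing the words with letters outside \<open>1, \<dots>, r\<close> turns the Serre ideal into an ideal of the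
  whole type \<open>freealg\<close>, which makes all membership conditions on the factors disappear.\<close>

definition kill :: "nat \<Rightarrow> freealg \<Rightarrow> freealg" where
  "kill r x = Poly_Mapping.mapp (\<lambda>w c. c when set (letters w) \<subseteq> {1..r}) x"

lemma lookup_kill:
  "Poly_Mapping.lookup (kill r x) w = (Poly_Mapping.lookup x w when set (letters w) \<subseteq> {1..r})"
  by (auto simp: kill_def lookup_mapp when_def in_keys_iff)

lemma kill_zero [simp]: "kill r 0 = 0"
  by (rule poly_mapping_eqI) (simp add: lookup_kill)

lemma kill_add: "kill r (x + y) = kill r x + kill r y"
  by (rule poly_mapping_eqI) (simp add: lookup_kill lookup_add when_def)

lemma kill_single:
  "kill r (Poly_Mapping.single w c) = (if set (letters w) \<subseteq> {1..r} then Poly_Mapping.single w c else 0)"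
  by (rule poly_mapping_eqI) (auto simp: lookup_kill lookup_single when_def)

lemma kill_mult: "kill r (x * y) = kill r x * kill r y"
proof (induction x rule: poly_mapping_induct_add)
  case (single u c)
  show ?case
    by (induction y rule: poly_mapping_induct_add)
      (auto simp: mult_single kill_single kill_add algebra_simps plus_fword_def)
qed (simp_all add: kill_add algebra_simps)

lemma kill_in_carrier: "kill r x \<in> carrier (free_alg r)"
  by (auto simp: free_alg_def lookup_kill in_keys_iff)

lemma kill_id: "x \<in> carrier (free_alg r) \<Longrightarrow> kill r x = x"
  by (rule poly_mapping_eqI) (auto simp: free_alg_def lookup_kill when_def in_keys_iff)

definition null :: "nat \<Rightarrow> freealg \<Rightarrow> bool" where
  "null r x \<longleftrightarrow> kill r x \<in> serre_ideal r"

context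
  fixes r :: nat
begin

interpretation S: ideal "serre_ideal r" "free_alg r"
  by (rule ideal_serre_ideal)

lemma serre_ideal_zero: "0 \<in> serre_ideal r"
  using additive_subgroup.zero_closed[OF S.additive_subgroup_axioms] by (simp add: free_alg_def)

lemma serre_ideal_add: "x \<in> serre_ideal r \<Longrightarrow> y \<in> serre_ideal r \<Longrightarrow> x + y \<in> serre_ideal r"
  using additive_subgroup.a_closed[OF S.additive_subgroup_axioms, of x y] by (simp add: free_alg_def)

lemma serre_ideal_lmult: "x \<in> serre_ideal r \<Longrightarrow> a \<in> carrier (free_alg r) \<Longrightarrow> a * x \<in> serre_ideal r"
  using S.I_l_closed[of x a] by (simp add: free_alg_def)

lemma serre_ideal_rmult: "x \<in> serre_ideal r \<Longrightarrow> a \<in> carrier (free_alg r) \<Longrightarrow> x * a \<in> serre_ideal r"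
  using S.I_r_closed[of x a] by (simp add: free_alg_def)

lemma null_zero [simp]: "null r 0"
  by (simp add: null_def serre_ideal_zero)

lemma null_add: "null r x \<Longrightarrow> null r y \<Longrightarrow> null r (x + y)"
  by (simp add: null_def kill_add serre_ideal_add)

lemma null_lmult: "null r x \<Longrightarrow> null r (a * x)"
  by (simp add: null_def kill_mult serre_ideal_lmult kill_in_carrier)

lemma null_rmult: "null r x \<Longrightarrow> null r (x * a)"
  by (simp add: null_def kill_mult serre_ideal_rmult kill_in_carrier)

lemma null_uminus: "null r x \<Longrightarrow> null r (- x)"
  using null_lmult[of x "- 1"] by simp

lemma null_minus_iff [simp]: "null r (- x) \<longleftrightarrow> null r x"
  using null_uminus[of x] null_uminus[of "- x"] by auto

lemma null_diff: "null r x \<Longrightarrow> null r y \<Longrightarrow> null r (x - y)"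
  using null_add[of x "- y"] by simp

lemma null_comm_left: "null r x \<Longrightarrow> null r (comm x y)"
  unfolding comm_def by (intro null_diff null_lmult null_rmult)

lemma null_comm_right: "null r y \<Longrightarrow> null r (comm x y)"
  unfolding comm_def by (intro null_diff null_lmult null_rmult)

lemma null_double: "null r (x + x) \<Longrightarrow> null r x"
proof -
  assume "null r (x + x)"
  then have "null r (Poly_Mapping.single 0 (1/2) * (x + x))" by (rule null_lmult)
  also have "Poly_Mapping.single 0 (1/2) * (x + x) = (Poly_Mapping.single 0 (1/2) + Poly_Mapping.single 0 (1/2)) * x"
    by (simp add: algebra_simps)
  also have "\<dots> = x" by (simp add: single_add[symmetric])
  finally show "null r x" .
qed

text \<open>Generators beyond the rank count as zero. The commutation lemmas can therefore be stated
  for all indices, also where a bracket would leave the Dynkin diagram.\<close>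

lemma null_gen_outside: "l \<notin> {1..r} \<Longrightarrow> null r (gen l)"
  by (auto simp: null_def gen_def kill_single serre_ideal_zero)

lemma null_serre_relation: "x \<in> serre_relations r \<Longrightarrow> null r x"
  using S.genideal_self[OF serre_relations_in_carrier] serre_relations_in_carrier
  by (auto simp: null_def serre_ideal_def kill_id subset_iff)

end

text \<open>The edges of the Dynkin diagram: the chain 2, 3, 4, ... and the extra node 1 attached to
  the branch node 3. There is no upper end, in keeping with \<open>null_gen_outside\<close>.\<close>

definition adj :: "nat \<Rightarrow> nat \<Rightarrow> bool" where
  "adj a b \<longleftrightarrow> a = 1 \<and> b = 3 \<or> a = 3 \<and> b = 1 \<or> 2 \<le> a \<and> b = a + 1 \<or> 2 \<le> b \<and> a = b + 1"

lemma sum_eps: "(\<Sum>u=1..r. eps a u * eps b u) = (if a = b \<and> a \<in> {1..r} then 1 else 0)"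
proof -
  have "(\<Sum>u=1..r. eps a u * eps b u) = (\<Sum>u=1..r. if u = a then if a = b then 1 else 0 else 0)"
    by (intro sum.cong) (auto simp: eps_def)
  then show ?thesis by (simp add: sum.delta)
qed

lemma cartan_eq:
  assumes "2 \<le> r" "a \<in> {1..r}" "b \<in> {1..r}" "a \<noteq> b"
  shows "cartan r a b = (if adj a b then - 1 else 0)"
proof -
  \<comment> \<open>Every simple root becomes \<open>eps a + s * eps a'\<close>, so that one
    bilinear expansion serves all pairs. Writing the index as \<open>Suc (Suc n)\<close> avoids the
    truncated subtraction \<open>i - 1\<close>. The bound \<open>2 <= r\<close> puts both
    coordinates of the first simple root into the range of summation.\<close>
  have simple: "simple_root 1 = (\<lambda>u. eps 1 u + 1 * eps 2 u)"
    "simple_root (Suc (Suc n)) = (\<lambda>u. eps (Suc (Suc n)) u + - 1 * eps (Suc n) u)" for n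
    by (auto simp: simple_root_def)
  have cases_index: "c = 1 \<or> (\<exists>n. c = Suc (Suc n))" if "c \<in> {1..r}" for c
  proof (cases c)
    case (Suc d)
    then show ?thesis by (cases d) auto
  qed (use that in simp)
  have adj_eqs: "adj 1 (Suc (Suc n)) \<longleftrightarrow> n = 1" "adj (Suc (Suc n)) 1 \<longleftrightarrow> n = 1"
    "adj (Suc (Suc n)) (Suc (Suc m)) \<longleftrightarrow> m = Suc n \<or> n = Suc m" for m n
    by (auto simp: adj_def)
  have expand: "(\<Sum>u=1..r. (eps a u + s * eps a' u) * (eps b u + t * eps b' u)) =
      (\<Sum>u=1..r. eps a u * eps b u) + t * (\<Sum>u=1..r. eps a u * eps b' u)
      + s * (\<Sum>u=1..r. eps a' u * eps b u) + s * t * (\<Sum>u=1..r. eps a' u * eps b' u)"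
    for a a' b b' s t
    by (simp add: algebra_simps sum.distrib sum_distrib_left)
  have ip: "(\<Sum>u=1..r. simple_root a u * simple_root b u)
    = (if a = b then 2 else if adj a b then - 1 else 0)" if ab: "a \<in> {1..r}" "b \<in> {1..r}" for a b
  proof -
    consider (1) "a = 1" "b = 1" | (2) n where "a = 1" "b = Suc (Suc n)"
      | (3) n where "a = Suc (Suc n)" "b = 1" | (4) m n where "a = Suc (Suc n)" "b = Suc (Suc m)"
      using cases_index[OF ab(1)] cases_index[OF ab(2)] by blast
    then show ?thesis
    proof cases
      case 1
      show ?thesis unfolding 1 simple expand sum_eps using assms(1) by simp
    next
      case 2
      show ?thesis using assms(1) that unfolding 2 simple expand sum_eps adj_eqs by simp
    next
      case 3
      show ?thesis using assms(1) that unfolding 3 simple expand sum_eps adj_eqs by simp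
    next
      case 4
      show ?thesis using assms(1) that unfolding 4 simple expand sum_eps adj_eqs by simp
    qed
  qed
  show ?thesis
    using assms unfolding cartan_def ip[OF assms(2,3)] ip[OF assms(2,2)] by simp
qed

lemma null_comm_gen:
  assumes "2 \<le> r" "\<not> adj a b"
  shows "null r (comm (gen a) (gen b))"
proof (cases "a \<in> {1..r} \<and> b \<in> {1..r} \<and> a \<noteq> b")
  case True
  then have "comm (gen a) (gen b) \<in> serre_relations r"
    using assms cartan_eq[of r a b] unfolding serre_relations_def
    by (intro CollectI exI[of _ a] exI[of _ b]) simp
  then show ?thesis by (rule null_serre_relation)
next
  case False
  then show ?thesis
    using null_gen_outside[of a r] null_gen_outside[of b r]
    by (auto simp del: atLeastAtMost_iff intro: null_comm_left null_comm_right simp: comm_def[of "gen b" "gen b"])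
qed

text \<open>The Serre relation in the left-normed shape in which it meets the root vectors. For
  pairs that are not adjacent the inner bracket is already null, so all pairs are covered.\<close>

lemma null_serre:
  assumes "2 \<le> r"
  shows "null r (comm (comm (gen b) (gen a)) (gen a))"
proof -
  have swap: "comm (comm (gen b) (gen a)) (gen a) = comm (gen a) (comm (gen a) (gen b))"
    by (simp add: comm_def algebra_simps)
  show ?thesis
  proof (cases "a \<in> {1..r} \<and> b \<in> {1..r} \<and> adj a b")
    case True
    then have "a \<noteq> b" by (auto simp: adj_def)
    with True have "comm (gen a) (comm (gen a) (gen b)) \<in> serre_relations r"
      using assms cartan_eq[of r a b] unfolding serre_relations_def
      by (intro CollectI exI[of _ a] exI[of _ b]) (simp add: numeral_2_eq_2)
    then show ?thesis unfolding swap by (rule null_serre_relation)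
  next
    case False
    then show ?thesis
      unfolding swap
      using null_gen_outside[of a r] null_gen_outside[of b r] null_comm_gen[OF assms, of a b]
      by (auto simp del: atLeastAtMost_iff intro: null_comm_left null_comm_right)
  qed
qed

section \<open>Brackets of root vectors with Chevalley generators\<close>

text \<open>The letters are kept apart from the bracket: content and weights depend only on their
  multiset, while the paths depend on their order.\<close>

fun root_letters :: "root \<Rightarrow> nat list" where
  "root_letters (EpsMinus j i) = rev [i + 1..<j + 1]"
| "root_letters (EpsPlus j i) =
     (if i = 1 then rev [3..<j + 1] @ [1] else rev [1..<j + 1] @ [3..<i + 1])"

lemma root_vector_eq: "root_vector \<beta> = lbracket (root_letters \<beta>)"
  by (cases \<beta>) simp_all

lemma lbracket_snoc: "xs \<noteq> [] \<Longrightarrow> lbracket (xs @ [a]) = comm (lbracket xs) (gen a)"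
  by (cases xs) simp_all

lemma rev_upt_rec: "a < b \<Longrightarrow> rev [a..<b] = rev [Suc a..<b] @ [a]"
  by (simp add: upt_conv_Cons)

lemma root_letters_minus: "2 \<le> i \<Longrightarrow> i < j \<Longrightarrow> root_letters (EpsMinus j (i - 1)) = root_letters (EpsMinus j i) @ [i]"
  and root_letters_minus_simple: "1 < j \<Longrightarrow> root_letters (EpsMinus j (j - 1)) = [j]"
  and root_letters_plus_one: "3 \<le> j \<Longrightarrow> root_letters (EpsPlus j 1) = root_letters (EpsMinus j 2) @ [1]"
  and root_letters_plus_simple: "root_letters (EpsPlus 2 1) = [1]"
  and root_letters_plus_two: "3 \<le> j \<Longrightarrow> root_letters (EpsPlus j 2) = root_letters (EpsMinus j 1) @ [1]"
  and root_letters_plus: "2 \<le> i \<Longrightarrow> i + 1 < j \<Longrightarrow> root_letters (EpsPlus j (i + 1)) = root_letters (EpsPlus j i) @ [i + 1]"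
proof -
  show "root_letters (EpsPlus j 2) = root_letters (EpsMinus j 1) @ [1]" if "3 \<le> j"
    using that rev_upt_rec[of 1 "Suc j"] by (simp add: numeral_2_eq_2)
  show "2 \<le> i \<Longrightarrow> i < j \<Longrightarrow> root_letters (EpsMinus j (i - 1)) = root_letters (EpsMinus j i) @ [i]"
    using rev_upt_rec[of i "Suc j"] by simp
qed (simp_all add: eval_nat_numeral)

lemma root_letters_neq_Nil: "\<beta> \<in> positive_roots r \<Longrightarrow> root_letters \<beta> \<noteq> []"
  by (auto simp: positive_roots_def split: if_splits)

abbreviation minus_vec :: "nat \<Rightarrow> nat \<Rightarrow> freealg" where
  "minus_vec j i \<equiv> root_vector (EpsMinus j i)"

abbreviation plus_vec :: "nat \<Rightarrow> nat \<Rightarrow> freealg" where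
  "plus_vec j i \<equiv> root_vector (EpsPlus j i)"

text \<open>For fixed \<open>j >= 3\<close> the root vectors form a tree grown from
  \<open>gen j\<close> by bracketing with one more generator. The branch of the
  \<open>EpsMinus j i\<close> descends in \<open>i\<close>; the letter 1 leads from
  \<open>EpsMinus j 2\<close> to \<open>EpsPlus j 1\<close> and from \<open>EpsMinus j 1\<close> to
  \<open>EpsPlus j 2\<close>; from the latter \<open>i\<close> ascends. The brackets with generators
  are computed by induction along this tree.\<close>

lemma minus_vec_rec: "2 \<le> i \<Longrightarrow> i < j \<Longrightarrow> minus_vec j (i - 1) = comm (minus_vec j i) (gen i)"
  and minus_vec_simple: "1 < j \<Longrightarrow> minus_vec j (j - 1) = gen j"
  and plus_vec_one: "3 \<le> j \<Longrightarrow> plus_vec j 1 = comm (minus_vec j 2) (gen 1)"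
  and plus_vec_simple: "plus_vec 2 1 = gen 1"
  and plus_vec_two: "3 \<le> j \<Longrightarrow> plus_vec j 2 = comm (minus_vec j 1) (gen 1)"
  and plus_vec_rec: "2 \<le> i \<Longrightarrow> i + 1 < j \<Longrightarrow> plus_vec j (i + 1) = comm (plus_vec j i) (gen (i + 1))"
proof -
  have ne: "root_letters (EpsMinus j i) \<noteq> []" if "i < j" for i j
    using that by simp
  have ne': "root_letters (EpsPlus j i) \<noteq> []" if "i < j" for i j
    using that by simp
  show "minus_vec j (i - 1) = comm (minus_vec j i) (gen i)" if "2 \<le> i" "i < j"
    unfolding root_vector_eq using that lbracket_snoc[OF ne[OF that(2)]] by (simp only: root_letters_minus)
  show "1 < j \<Longrightarrow> minus_vec j (j - 1) = gen j"
    unfolding root_vector_eq by (simp only: root_letters_minus_simple) simp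
  show "plus_vec j 1 = comm (minus_vec j 2) (gen 1)" if "3 \<le> j"
    unfolding root_vector_eq using that ne[of 2 j, THEN lbracket_snoc] by (simp add: root_letters_plus_one del: root_letters.simps One_nat_def)
  show "plus_vec 2 1 = gen 1"
    unfolding root_vector_eq by (simp only: root_letters_plus_simple) simp
  show "plus_vec j 2 = comm (minus_vec j 1) (gen 1)" if "3 \<le> j"
    unfolding root_vector_eq using that ne[of 1 j, THEN lbracket_snoc] by (simp add: root_letters_plus_two del: root_letters.simps One_nat_def)
  show "plus_vec j (i + 1) = comm (plus_vec j i) (gen (i + 1))" if "2 \<le> i" "i + 1 < j"
    unfolding root_vector_eq unfolding root_letters_plus[OF that] using that by (intro lbracket_snoc ne') simp
qed

declare root_vector.simps [simp del]

context
  fixes r :: nat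
begin

section \<open>Consequences of the Jacobi identity modulo the Serre ideal\<close>

lemma comm_add_left: "comm (x + y) z = comm x z + comm y z"
  by (simp add: comm_def algebra_simps)

lemma jacobi: "comm (comm x y) z = comm (comm x z) y + comm x (comm y z)"
  by (simp add: comm_def algebra_simps)

lemma null_comm_comm: "null r (comm x z) \<Longrightarrow> null r (comm y z) \<Longrightarrow> null r (comm (comm x y) z)"
  unfolding jacobi[of x y z] by (simp add: null_add null_comm_left null_comm_right)

text \<open>The relation which makes \<open>ad b\<close> vanish on the root vector of the highest root of
  \<open>A\<^sub>3\<close>, where \<open>b\<close> is the middle node.\<close>

lemma null_A3:
  assumes "null r (comm a c)" "null r (comm (comm a b) b)" "null r (comm (comm c b) b)"
  shows "null r (comm (comm (comm a b) c) b)"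
proof -
  let ?x = "comm (comm (comm a b) c) b" and ?p = "comm (comm (comm a c) b) b"
  let ?q = "comm (comm (comm a b) b) c" and ?n = "comm a (comm (comm c b) b)"
  \<comment> \<open>Expanding with Jacobi gives x = p + m - n, where m = [[a, b], [b, c]], and a
    second use of Jacobi gives m = q - x. Hence 2x = p + q - n, and each of p, q, n contains one of
    the brackets assumed to be null.\<close>
  have double: "x + x = p + q - n" if "x = p + (m + - n)" "m = q - x" for x p q m n :: freealg
  proof -
    have "x + x - (p + q - n) = (x - (p + (m + - n))) + (m - (q - x))"
      by (simp add: algebra_simps)
    also have "\<dots> = 0"
      unfolding that(1)[symmetric] that(2)[symmetric] by simp
    finally show ?thesis by (simp only: right_minus_eq)
  qed
  have "?x = ?p + (comm (comm a b) (comm b c) + comm a (comm (comm b c) b))"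
    by (simp only: jacobi[of a b c] comm_add_left jacobi[of a "comm b c" b])
  also have "comm a (comm (comm b c) b) = - ?n"
    by (simp add: comm_def algebra_simps)
  finally have "?x + ?x = ?p + ?q - ?n"
  proof (rule double)
    show "comm (comm a b) (comm b c) = ?q - ?x"
      using jacobi[of "comm a b" b c] by simp
  qed
  then show ?thesis
    using assms by - (rule null_double, simp add: null_add null_diff null_comm_left null_comm_right)
qed

text \<open>The Leibniz rule for the square of the derivation [-, b], with binomial coefficients 1,
  2, 1.\<close>

lemma null_ad_twice:
  assumes "null r (comm (comm a b) b)" "null r (comm (comm c b) b)" "null r (comm (comm a b) (comm c b))"
  shows "null r (comm (comm (comm a c) b) b)"
proof -
  have "comm (comm (comm a c) b) b
      = comm (comm (comm a b) b) c + comm a (comm (comm c b) b)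
        + (comm (comm a b) (comm c b) + comm (comm a b) (comm c b))"
    by (simp add: comm_def algebra_simps)
  then show ?thesis
    using assms by (simp add: null_add null_comm_left null_comm_right)
qed

lemma null_ad_twice_left:
  assumes "null r (comm a b)" "null r (comm (comm c b) b)"
  shows "null r (comm (comm (comm a c) b) b)"
  using assms by (simp add: null_ad_twice null_comm_left)

lemma null_ad_twice_right:
  assumes "null r (comm (comm a b) b)" "null r (comm c b)"
  shows "null r (comm (comm (comm a c) b) b)"
  using assms by (simp add: null_ad_twice null_comm_left null_comm_right)

lemma null_swap: "null r (comm a b) \<Longrightarrow> null r (comm (comm x a) b - comm (comm x b) a)"
proof -
  have "comm (comm x a) b - comm (comm x b) a = comm x (comm a b)"
    by (simp add: comm_def algebra_simps)
  then show "null r (comm a b) \<Longrightarrow> null r (comm (comm x a) b - comm (comm x b) a)"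
    by (simp add: null_comm_right)
qed

text \<open>Carries a relation [x, g] = -x' along the recursion of the root vectors, as long as the
  appended letter \<open>b\<close> commutes with \<open>g\<close>. It is used with \<open>g\<close>
  the generator \<open>j + 1\<close>; the sign arises because that generator comes first in the root
  vectors with top index \<open>j + 1\<close>, but last in the bracket.\<close>

lemma null_shift:
  assumes "null r (comm x g + x')" "null r (comm b g)"
  shows "null r (comm (comm x b) g + comm x' b)"
proof -
  have "comm (comm x b) g + comm x' b = comm (comm x g + x') b + comm x (comm b g)"
    by (simp add: comm_def algebra_simps)
  then show ?thesis
    using assms by (simp add: null_add null_comm_left null_comm_right)
qed

context
  assumes r: "2 \<le> r"
begin

lemmas null_gen = null_comm_gen[OF r] and serre = null_serre[OF r]

section \<open>Brackets with the root vectors of \<open>EpsMinus j i\<close>\<close>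

lemma comm_minus_far:
  assumes "1 \<le> i" "i < j" "\<And>m. i < m \<Longrightarrow> m \<le> j \<Longrightarrow> \<not> adj m l"
  shows "null r (comm (minus_vec j i) (gen l))"
proof -
  have "i \<le> j - 1" using assms by simp
  then show ?thesis
    using assms(1,3)
  proof (induction i rule: inc_induct)
    case base
    then show ?case
      using minus_vec_simple[of j] assms(1,2) by (simp add: null_gen)
  next
    case (step i)
    have "null r (comm (minus_vec j (Suc i)) (gen l))"
      using step by auto
    then show ?case
      using minus_vec_rec[of "Suc i" j] step by (simp add: null_comm_comm null_gen)
  qed
qed

lemma comm_minus_top:
  assumes "1 \<le> i" "i < j"
  shows "null r (comm (minus_vec j i) (gen j))"
proof (cases "i = j - 1")
  case True
  then show ?thesis using assms minus_vec_simple[of j] by (simp add: comm_def)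
next
  case False
  then have "i \<le> j - 2" "3 \<le> j" using assms by auto
  from this(1) assms(1) show ?thesis
  proof (induction i rule: inc_induct)
    case base
    have "minus_vec j (j - 2) = comm (gen j) (gen (j - 1))"
      using minus_vec_rec[of "j - 1" j] minus_vec_simple[of j] \<open>3 \<le> j\<close> by (simp add: numeral_2_eq_2)
    moreover have "comm (comm (gen j) (gen (j - 1))) (gen j) = - comm (comm (gen (j - 1)) (gen j)) (gen j)"
      by (simp add: comm_def algebra_simps)
    ultimately show ?case using serre by simp
  next
    case (step i)
    have "\<not> adj (Suc i) j" using step \<open>3 \<le> j\<close> by (auto simp: adj_def)
    then show ?case
      using minus_vec_rec[of "Suc i" j] step \<open>3 \<le> j\<close> by (simp add: null_comm_comm null_gen)
  qed
qed

text \<open>Among the letters of the bracket \<open>a\<close> is adjacent only to the last one,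
  \<open>i + 1\<close>, and it commutes with the bracket of the earlier ones. So the Serre relation
  for this one letter carries over to the whole bracket.\<close>

lemma comm_minus_twice:
  assumes "2 \<le> i" "i < j" "a = i \<or> i = 2 \<and> a = 1"
  shows "null r (comm (comm (minus_vec j i) (gen a)) (gen a))"
proof (cases "i = j - 1")
  case True
  then show ?thesis using assms minus_vec_simple[of j] by (simp add: serre)
next
  case False
  have "null r (comm (minus_vec j (Suc i)) (gen a))"
    using assms False by (intro comm_minus_far) (auto simp: adj_def)
  then have "null r (comm (comm (comm (minus_vec j (Suc i)) (gen (Suc i))) (gen a)) (gen a))"
    by (intro null_ad_twice_left serre)
  then show ?thesis
    using minus_vec_rec[of "Suc i" j] assms False by simp
qed

text \<open>For \<open>l\<close> strictly inside the string the decisive bracket is the one that has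
  just passed \<open>l - 1\<close>. It is the highest root vector of an A3 with middle node
  \<open>l\<close> and outer nodes \<open>minus_vec j l\<close> and \<open>gen (l - 1)\<close>; the
  letters appended later are not adjacent to \<open>l\<close>.\<close>

lemma comm_minus_inner:
  assumes "1 \<le> i" "i < l" "l \<le> j"
  shows "null r (comm (minus_vec j i) (gen l))"
proof -
  consider "l = j" | "l = i + 1" "l < j" | "i + 1 < l" "l < j"
    using assms by linarith
  then show ?thesis
  proof cases
    case 1
    then show ?thesis using assms comm_minus_top by simp
  next
    case 2
    then show ?thesis
      using comm_minus_twice[of l j l] minus_vec_rec[of l j] assms by simp
  next
    case 3
    then have "i \<le> l - 2" by simp
    from this assms(1) show ?thesis
    proof (induction i rule: inc_induct)
      case base
      have "null r (comm (comm (comm (minus_vec j l) (gen l)) (gen (l - 1))) (gen l))"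
        using 3 assms
        by (intro null_A3 comm_minus_twice serre comm_minus_far) (auto simp: adj_def)
      then show ?case
        using minus_vec_rec[of l j] minus_vec_rec[of "l - 1" j] 3 assms by (simp add: numeral_2_eq_2)
    next
      case (step i)
      have "\<not> adj (Suc i) l" using step by (auto simp: adj_def)
      then show ?case
        using minus_vec_rec[of "Suc i" j] step 3 by (simp add: null_comm_comm null_gen)
    qed
  qed
qed

lemma comm_minus_raise:
  assumes "1 \<le> i" "i < j"
  shows "null r (comm (minus_vec j i) (gen (j + 1)) + minus_vec (j + 1) i)"
proof -
  have "i \<le> j - 1" using assms by simp
  then show ?thesis
    using assms(1)
  proof (induction i rule: inc_induct)
    case base
    have "minus_vec (j + 1) (j - 1) = comm (gen (j + 1)) (gen j)"
      using minus_vec_rec[of j "j + 1"] minus_vec_simple[of "j + 1"] assms by simp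
    then show ?case
      using minus_vec_simple[of j] assms by (simp add: comm_def)
  next
    case (step i)
    have "\<not> adj (Suc i) (j + 1)" using step assms by (auto simp: adj_def)
    then have "null r (comm (comm (minus_vec j (Suc i)) (gen (Suc i))) (gen (j + 1))
        + comm (minus_vec (j + 1) (Suc i)) (gen (Suc i)))"
      using step by (intro null_shift null_gen) auto
    then show ?case
      using minus_vec_rec[of "Suc i" j] minus_vec_rec[of "Suc i" "j + 1"] step by simp
  qed
qed

section \<open>Brackets with the root vectors of \<open>EpsPlus j 1\<close>\<close>

lemma comm_plus_one_inner:
  assumes "3 \<le> l" "l \<le> j"
  shows "null r (comm (plus_vec j 1) (gen l))"
proof -
  have j: "3 \<le> j" using assms by simp
  consider "4 \<le> l" | "l = 3" "j = 3" | "l = 3" "4 \<le> j"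
    using assms by linarith
  then have "null r (comm (comm (minus_vec j 2) (gen 1)) (gen l))"
  proof cases
    case 1
    then show ?thesis
      using assms by (intro null_comm_comm comm_minus_inner null_gen) (auto simp: adj_def)
  next
    case 2
    have "comm (comm (gen 3) (gen 1)) (gen 3) = - comm (comm (gen 1) (gen 3)) (gen 3)"
      by (simp add: comm_def algebra_simps)
    then show ?thesis
      using 2 minus_vec_simple[of 3] serre by simp
  next
    case 3
    then have "null r (comm (comm (comm (minus_vec j 3) (gen 3)) (gen 1)) (gen 3))"
      by (intro null_A3 comm_minus_twice serre comm_minus_far) (auto simp: adj_def)
    then show ?thesis
      using 3 minus_vec_rec[of 3 j] by simp
  qed
  then show ?thesis
    using plus_vec_one[OF j] by simp
qed

text \<open>The nodes 1 and 2 commute, so \<open>EpsPlus j 2\<close> is reached from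
  \<open>EpsMinus j 2\<close> in either order of the two letters.\<close>

lemma comm_plus_one_two:
  assumes "3 \<le> j"
  shows "null r (comm (plus_vec j 1) (gen 2) - plus_vec j 2)"
proof -
  have "null r (comm (comm (minus_vec j 2) (gen 1)) (gen 2) - comm (comm (minus_vec j 2) (gen 2)) (gen 1))"
    by (intro null_swap null_gen) (simp add: adj_def)
  then show ?thesis
    using assms plus_vec_one[of j] plus_vec_two[of j] minus_vec_rec[of 2 j] by simp
qed

lemma comm_plus_one_raise:
  assumes "2 \<le> j"
  shows "null r (comm (plus_vec j 1) (gen (j + 1)) + plus_vec (j + 1) 1)"
proof (cases "j = 2")
  case True
  then show ?thesis
    using plus_vec_simple plus_vec_one[of 3] minus_vec_simple[of 3] by (simp add: comm_def)
next
  case False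
  have "null r (comm (comm (minus_vec j 2) (gen 1)) (gen (j + 1)) + comm (minus_vec (j + 1) 2) (gen 1))"
    using False assms by (intro null_shift null_gen comm_minus_raise) (auto simp: adj_def)
  then show ?thesis
    using plus_vec_one[of j] plus_vec_one[of "j + 1"] False assms by simp
qed

lemma comm_plus_one_far:
  assumes "2 \<le> j" "j + 2 \<le> l \<or> l = 1 \<or> l = 2 \<and> j = 2"
  shows "null r (comm (plus_vec j 1) (gen l))"
proof (cases "j = 2")
  case True
  then show ?thesis
    using plus_vec_simple assms by (auto simp: adj_def intro: null_gen)
next
  case False
  have "null r (comm (comm (minus_vec j 2) (gen 1)) (gen l))"
  proof (cases "l = 1")
    case True
    then show ?thesis using False assms by (auto intro: comm_minus_twice)
  next
    case l: False
    then show ?thesis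
      using False assms by (intro null_comm_comm comm_minus_far null_gen) (auto simp: adj_def)
  qed
  then show ?thesis
    using plus_vec_one[of j] False assms by simp
qed

section \<open>Brackets with the root vectors of \<open>EpsPlus j i\<close> for
  \<open>2 <= i\<close>\<close>

lemma comm_plus_far:
  assumes "2 \<le> i" "i < j" "4 \<le> l" "i + 2 \<le> l" "l \<noteq> j + 1"
  shows "null r (comm (plus_vec j i) (gen l))"
  using assms
proof (induction i rule: nat_induct_at_least)
  case base
  have "null r (comm (minus_vec j 1) (gen l))"
  proof (cases "l \<le> j")
    case True
    then show ?thesis using base by (intro comm_minus_inner) auto
  next
    case False
    then show ?thesis using base by (intro comm_minus_far) (auto simp: adj_def)
  qed
  then show ?case
    using plus_vec_two[of j] base by (simp add: null_comm_comm null_gen adj_def)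
next
  case (Suc i)
  then have "\<not> adj (Suc i) l" by (auto simp: adj_def)
  then show ?case
    using plus_vec_rec[of i j] Suc by (simp add: null_comm_comm null_gen)
qed

lemma comm_plus_raise:
  assumes "2 \<le> i" "i < j"
  shows "null r (comm (plus_vec j i) (gen (j + 1)) + plus_vec (j + 1) i)"
  using assms
proof (induction i rule: nat_induct_at_least)
  case base
  have "null r (comm (comm (minus_vec j 1) (gen 1)) (gen (j + 1)) + comm (minus_vec (j + 1) 1) (gen 1))"
    using base by (intro null_shift null_gen comm_minus_raise) (auto simp: adj_def)
  then show ?case
    using plus_vec_two[of j] plus_vec_two[of "j + 1"] base by simp
next
  case (Suc i)
  have "null r (comm (comm (plus_vec j i) (gen (Suc i))) (gen (j + 1)) + comm (plus_vec (j + 1) i) (gen (Suc i)))"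
    using Suc by (intro null_shift null_gen) (auto simp: adj_def)
  then show ?case
    using plus_vec_rec[of i j] plus_vec_rec[of i "j + 1"] Suc by simp
qed

text \<open>The critical case is \<open>i = 3\<close>, where the letter 3 has been appended after 1:
  an A3 with middle node 1 and outer nodes \<open>minus_vec j 1\<close> and \<open>gen 3\<close>.
  All later letters commute with \<open>gen 1\<close>.\<close>

lemma comm_plus_gen_1:
  assumes "2 \<le> i" "i < j"
  shows "null r (comm (plus_vec j i) (gen 1))"
proof -
  have twice: "null r (comm (comm (minus_vec j 1) (gen 1)) (gen 1))"
  proof -
    have "null r (comm (comm (comm (minus_vec j 2) (gen 2)) (gen 1)) (gen 1))"
      using assms by (intro null_ad_twice_right comm_minus_twice null_gen) (auto simp: adj_def)
    then show ?thesis using minus_vec_rec[of 2 j] assms by simp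
  qed
  from assms show ?thesis
  proof (induction i rule: nat_induct_at_least)
    case base
    then show ?case using plus_vec_two[of j] twice by simp
  next
    case (Suc i)
    show ?case
    proof (cases "i = 2")
      case True
      have "null r (comm (comm (comm (minus_vec j 1) (gen 1)) (gen 3)) (gen 1))"
        using Suc True by (intro null_A3 comm_minus_inner twice serre) auto
      then show ?thesis
        using plus_vec_rec[of 2 j] plus_vec_two[of j] True Suc by simp
    next
      case False
      then show ?thesis
        using plus_vec_rec[of i j] Suc by (simp add: null_comm_comm null_gen adj_def)
    qed
  qed
qed

lemma comm_plus_gen_2:
  assumes "2 \<le> i" "i < j"
  shows "null r (comm (plus_vec j i) (gen 2))"
  using assms
proof (induction i rule: nat_induct_at_least)
  case base
  have "null r (comm (comm (comm (minus_vec j 2) (gen 2)) (gen 1)) (gen 2))"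
    using base by (intro null_comm_comm comm_minus_twice null_gen) (auto simp: adj_def)
  then show ?case
    using plus_vec_two[of j] minus_vec_rec[of 2 j] base by simp
next
  case (Suc i)
  show ?case
  proof (cases "i = 2")
    case True
    have j: "4 \<le> j" using Suc True by simp
    \<comment> \<open>To apply \<open>null_A3\<close> with middle node 2, the letter 2 must be the
      last one before 3, but \<open>plus_vec j 2\<close> ends with the letter 1. The null element
      \<open>?d\<close> exchanges the two forms, and its own brackets are subtracted
      afterwards.\<close>
    let ?d = "comm (plus_vec j 1) (gen 2) - plus_vec j 2"
    have d: "null r ?d" using comm_plus_one_two j by simp
    have "null r (comm ?d (gen 2) + comm (plus_vec j 2) (gen 2))"
      using Suc True by (intro null_add null_comm_left[OF d]) simp
    also have "comm ?d (gen 2) + comm (plus_vec j 2) (gen 2) = comm (comm (plus_vec j 1) (gen 2)) (gen 2)"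
      by (simp add: comm_def algebra_simps)
    finally have "null r (comm (comm (comm (plus_vec j 1) (gen 2)) (gen 3)) (gen 2))"
      using j by (intro null_A3 comm_plus_one_inner serre) auto
    then have "null r (comm (comm (comm (plus_vec j 1) (gen 2)) (gen 3)) (gen 2)
        - comm (comm ?d (gen 3)) (gen 2))"
      by (intro null_diff null_comm_left[OF null_comm_left[OF d]])
    also have "comm (comm (comm (plus_vec j 1) (gen 2)) (gen 3)) (gen 2) - comm (comm ?d (gen 3)) (gen 2)
        = comm (comm (plus_vec j 2) (gen 3)) (gen 2)"
      by (simp add: comm_def algebra_simps)
    finally show ?thesis
      using plus_vec_rec[of 2 j] True j by simp
  next
    case False
    then show ?thesis
      using plus_vec_rec[of i j] Suc by (simp add: null_comm_comm null_gen adj_def)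
  qed
qed

text \<open>The letter \<open>i\<close> commutes with the bracket that precedes the last two
  letters, so the Serre relation between \<open>i\<close> and the last letter but one decides. That
  letter is \<open>i - 1\<close>, except for \<open>i = 3\<close>, where it is 1.\<close>

lemma comm_plus_gen_same:
  assumes "3 \<le> i" "i < j"
  shows "null r (comm (plus_vec j i) (gen i))"
proof (cases "i = 3")
  case True
  have "null r (comm (comm (comm (minus_vec j 1) (gen 1)) (gen 3)) (gen 3))"
    using assms True by (intro null_ad_twice_left comm_minus_inner serre) auto
  then show ?thesis
    using plus_vec_two[of j] plus_vec_rec[of 2 j] assms True by simp
next
  case False
  have "null r (comm (comm (comm (plus_vec j (i - 2)) (gen (i - 1))) (gen i)) (gen i))"
    using assms False by (intro null_ad_twice_left comm_plus_far serre) auto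
  then show ?thesis
    using plus_vec_rec[of "i - 2" j] plus_vec_rec[of "i - 1" j] assms False
    by (simp add: numeral_2_eq_2 Suc_diff_Suc)
qed

text \<open>The critical case is \<open>i = l + 1\<close>: an A3 with middle node \<open>l\<close>
  and outer nodes \<open>plus_vec j (l - 1)\<close> and \<open>gen (l + 1)\<close>. The letters
  appended later are not adjacent to \<open>l\<close>.\<close>

lemma comm_plus_gen_inner:
  assumes "3 \<le> l" "l < i" "i < j"
  shows "null r (comm (plus_vec j i) (gen l))"
proof -
  have "Suc l \<le> i" using assms by simp
  then show ?thesis
    using assms(3)
  proof (induction i rule: dec_induct)
    case base
    have rec: "comm (plus_vec j (l - 1)) (gen l) = plus_vec j l"
      using plus_vec_rec[of "l - 1" j] assms base by simp
    have "null r (comm (comm (comm (plus_vec j (l - 1)) (gen l)) (gen (l + 1))) (gen l))"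
    proof (rule null_A3)
      show "null r (comm (comm (plus_vec j (l - 1)) (gen l)) (gen l))"
        unfolding rec using comm_plus_gen_same[of l j] assms base by simp
    qed (use assms base in \<open>auto intro!: comm_plus_far serre\<close>)
    then show ?case
      unfolding rec using plus_vec_rec[of l j] assms base by simp
  next
    case (step i)
    then have "\<not> adj (Suc i) l" using assms by (auto simp: adj_def)
    then show ?case
      using plus_vec_rec[of i j] step assms by (simp add: null_comm_comm null_gen)
  qed
qed

text \<open>The sum of the two roots is twice \<open>eps j\<close>, which is not a root. The letter
  \<open>j\<close> stands at the very beginning of the bracket, out of reach of the recursion in
  \<open>i\<close>; therefore the induction is on \<open>j\<close>, and the top letter is first
  moved to the end.\<close>

lemma comm_plus_gen_top:
  assumes "3 \<le> j"
  shows "null r (comm (plus_vec j (j - 1)) (gen j))"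
  using assms
proof (induction j rule: nat_induct_at_least)
  case base
  have "null r (comm (comm (comm (gen 2) (gen 3)) (gen 1)) (gen 3))"
    by (intro null_A3 serre null_gen) (simp add: adj_def)
  moreover have "plus_vec 3 2 = - comm (comm (gen 2) (gen 3)) (gen 1)"
  proof -
    have "minus_vec 3 2 = gen 3" using minus_vec_simple[of 3] by simp
    then have "minus_vec 3 1 = comm (gen 3) (gen 2)" using minus_vec_rec[of 2 3] by simp
    then have "plus_vec 3 2 = comm (comm (gen 3) (gen 2)) (gen 1)" using plus_vec_two[of 3] by simp
    then show ?thesis by (simp add: comm_def algebra_simps)
  qed
  moreover have "comm (- x) y = - comm x y" for x y
    by (simp add: comm_def)
  ultimately show ?case by simp
next
  case (Suc j)
  let ?c = "plus_vec j (j - 1)" and ?g = "gen (Suc j)"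
  \<comment> \<open>Modulo the null element \<open>?d\<close>,
    \<open>plus_vec (Suc j) (j - 1)\<close> is minus the bracket of \<open>?c\<close> with the top
    letter. This makes the root vector in question an A3 bracket with outer nodes \<open>?c\<close>
    and \<open>gen j\<close>, which commute by the induction hypothesis, and with the top letter as
    middle node.\<close>
  let ?d = "comm ?c ?g + plus_vec (Suc j) (j - 1)"
  have d: "null r ?d"
    using comm_plus_raise[of "j - 1" j] Suc by simp
  have rec: "plus_vec (Suc j) j = comm (plus_vec (Suc j) (j - 1)) (gen j)"
    using plus_vec_rec[of "j - 1" "Suc j"] Suc by simp
  have "null r (comm (plus_vec (Suc j) (j - 1)) ?g)"
    using Suc by (intro comm_plus_far) auto
  then have "null r (comm ?d ?g - comm (plus_vec (Suc j) (j - 1)) ?g)"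
    by (intro null_diff null_comm_left[OF d])
  also have "comm ?d ?g - comm (plus_vec (Suc j) (j - 1)) ?g = comm (comm ?c ?g) ?g"
    by (simp add: comm_def algebra_simps)
  finally have "null r (comm (comm (comm ?c ?g) (gen j)) ?g)"
    using Suc by (intro null_A3 serre) auto
  then have "null r (comm (comm ?d (gen j)) ?g - comm (comm (comm ?c ?g) (gen j)) ?g)"
    by (intro null_diff null_comm_left[OF null_comm_left[OF d]])
  also have "comm (comm ?d (gen j)) ?g - comm (comm (comm ?c ?g) (gen j)) ?g = comm (plus_vec (Suc j) j) ?g"
    unfolding rec by (simp add: comm_def algebra_simps)
  finally show ?case by simp
qed

end

end

section \<open>Spanning by the ordered monomials\<close>

text \<open>The complex span modulo the Serre ideal, taken in the free algebra so that no
  computation takes place in cosets.\<close>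

inductive_set lspan :: "nat \<Rightarrow> freealg set \<Rightarrow> freealg set" for r :: nat and G :: "freealg set" where
  null: "null r x \<Longrightarrow> x \<in> lspan r G"
| base: "g \<in> G \<Longrightarrow> g \<in> lspan r G"
| add: "x \<in> lspan r G \<Longrightarrow> y \<in> lspan r G \<Longrightarrow> x + y \<in> lspan r G"
| scale: "x \<in> lspan r G \<Longrightarrow> Poly_Mapping.single 0 c * x \<in> lspan r G"

lemma lspan_uminus: "x \<in> lspan r G \<Longrightarrow> - x \<in> lspan r G"
  using lspan.scale[of x r G "- 1"] by (simp add: single_uminus)

lemma lspan_diff: "x \<in> lspan r G \<Longrightarrow> y \<in> lspan r G \<Longrightarrow> x - y \<in> lspan r G"
  using lspan.add[of x r G "- y"] by (simp add: lspan_uminus)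

text \<open>Multidegrees are encoded by multisets of letters.\<close>

definition root_span :: "nat \<Rightarrow> nat multiset \<Rightarrow> freealg set" where
  "root_span r M = lspan r {root_vector \<beta> | \<beta>. \<beta> \<in> positive_roots r \<and> mset (root_letters \<beta>) = M}"

lemma root_spanI:
  assumes "\<beta> \<in> positive_roots r" "mset (root_letters \<beta>) = M"
  shows "root_vector \<beta> \<in> root_span r M"
  unfolding root_span_def by (rule lspan.base) (use assms in blast)

lemma root_spanI_diff:
  assumes "null r (x - root_vector \<beta>)" "\<beta> \<in> positive_roots r" "mset (root_letters \<beta>) = M"
  shows "x \<in> root_span r M"
  using lspan.add[OF lspan.null[OF assms(1)], of "root_vector \<beta>"] root_spanI[OF assms(2,3)]
  by (simp add: root_span_def)

lemma root_spanI_add: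
  assumes "null r (x + root_vector \<beta>)" "\<beta> \<in> positive_roots r" "mset (root_letters \<beta>) = M"
  shows "x \<in> root_span r M"
  using lspan_diff[OF lspan.null[OF assms(1)], of "root_vector \<beta>"] root_spanI[OF assms(2,3)]
  by (simp add: root_span_def)

lemma root_span_null: "null r x \<Longrightarrow> x \<in> root_span r M"
  unfolding root_span_def by (rule lspan.null)

lemma root_letters_minus_raise:
  "i < j \<Longrightarrow> mset (root_letters (EpsMinus (j + 1) i)) = mset (root_letters (EpsMinus j i)) + {#j + 1#}"
  by simp

lemma root_letters_plus_raise:
  "i < j \<Longrightarrow> 2 \<le> j \<Longrightarrow> mset (root_letters (EpsPlus (j + 1) i)) = mset (root_letters (EpsPlus j i)) + {#j + 1#}"
  by simp

lemma positive_roots_iff [simp]: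
  "EpsMinus j i \<in> positive_roots r \<longleftrightarrow> 1 \<le> i \<and> i < j \<and> j \<le> r"
  "EpsPlus j i \<in> positive_roots r \<longleftrightarrow> 1 \<le> i \<and> i < j \<and> j \<le> r"
  by (auto simp: positive_roots_def)

declare root_letters.simps [simp del]

section \<open>The span of the root vectors is closed under brackets\<close>

lemma comm_minus_in_root_span:
  assumes "2 \<le> r" "1 \<le> i" "i < j" "j \<le> r" "l \<in> {1..r}"
  shows "comm (minus_vec j i) (gen l) \<in> root_span r (mset (root_letters (EpsMinus j i)) + {#l#})"
proof -
  consider (a) "l = i" "2 \<le> i" | (b) "l = 1" "i = 1" "3 \<le> j" | (c) "l = 1" "i = 1" "j = 2"
    | (d) "l = 1" "i = 2" | (e) "l = j + 1" | (f) "i < l" "l \<le> j"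
    | (g) "j + 2 \<le> l \<or> l < i \<and> \<not> (l = 1 \<and> i = 2)"
    using assms unfolding atLeastAtMost_iff by atomize_elim presburger
  then show ?thesis
  proof cases
    case a
    then show ?thesis
      using assms minus_vec_rec[of i j] root_letters_minus[of i j]
      by (intro root_spanI_diff[of _ _ "EpsMinus j (i - 1)"]) auto
  next
    case b
    then show ?thesis
      using assms plus_vec_two[of j] root_letters_plus_two[of j]
      by (intro root_spanI_diff[of _ _ "EpsPlus j 2"]) simp_all
  next
    case c
    then have "minus_vec j i = gen 2"
      using minus_vec_simple[of 2] by simp
    moreover have "null r (comm (gen 2) (gen 1))"
      using assms(1) by (rule null_comm_gen) (simp add: adj_def)
    ultimately show ?thesis
      using c(1) by (intro root_span_null) simp
  next
    case d
    then show ?thesis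
      using assms plus_vec_one[of j] root_letters_plus_one[of j]
      by (intro root_spanI_diff[of _ _ "EpsPlus j 1"]) simp_all
  next
    case e
    then show ?thesis
      using assms comm_minus_raise[of r i j] root_letters_minus_raise[of i j]
      by (intro root_spanI_add[of _ _ "EpsMinus (j + 1) i"]) simp_all
  next
    case f
    then show ?thesis
      using assms by (intro root_span_null comm_minus_inner)
  next
    case g
    then show ?thesis
      using assms by (intro root_span_null comm_minus_far) (auto simp: adj_def)
  qed
qed

lemma comm_plus_one_in_root_span:
  assumes "2 \<le> r" "2 \<le> j" "j \<le> r" "l \<in> {1..r}"
  shows "comm (plus_vec j 1) (gen l) \<in> root_span r (mset (root_letters (EpsPlus j 1)) + {#l#})"
proof -
  consider (a) "j + 2 \<le> l \<or> l = 1 \<or> l = 2 \<and> j = 2" | (b) "l = 2" "3 \<le> j" | (c) "l = j + 1"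
    | (d) "3 \<le> l" "l \<le> j"
    using assms unfolding atLeastAtMost_iff by atomize_elim presburger
  then show ?thesis
  proof cases
    case a
    then show ?thesis
      using assms by (intro root_span_null comm_plus_one_far)
  next
    case b
    have "mset (root_letters (EpsPlus j 2)) = mset (root_letters (EpsPlus j 1)) + {#l#}"
      using b root_letters_plus_two[of j] root_letters_plus_one[of j] root_letters_minus[of 2 j] by simp
    then show ?thesis
      using b assms comm_plus_one_two[of r j]
      by (intro root_spanI_diff[of _ _ "EpsPlus j 2"]) simp_all
  next
    case c
    then show ?thesis
      using assms comm_plus_one_raise[of r j] root_letters_plus_raise[of 1 j]
      by (intro root_spanI_add[of _ _ "EpsPlus (j + 1) 1"]) simp_all
  next
    case d
    then show ?thesis
      using assms by (intro root_span_null comm_plus_one_inner)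
  qed
qed

lemma comm_plus_in_root_span:
  assumes "2 \<le> r" "2 \<le> i" "i < j" "j \<le> r" "l \<in> {1..r}"
  shows "comm (plus_vec j i) (gen l) \<in> root_span r (mset (root_letters (EpsPlus j i)) + {#l#})"
proof -
  consider (a) "l = 1" | (b) "l = 2" | (c) "l = i + 1" "l < j" | (d) "l = i + 1" "l = j"
    | (e) "l = j + 1" | (f) "3 \<le> l" "l < i" | (g) "l = i" "3 \<le> i" | (h) "4 \<le> l" "i + 2 \<le> l" "l \<noteq> j + 1"
    using assms unfolding atLeastAtMost_iff by atomize_elim presburger
  then show ?thesis
  proof cases
    case a
    then show ?thesis using assms by (auto intro!: root_span_null simp: comm_plus_gen_1 simp del: One_nat_def)
  next
    case b
    then show ?thesis using assms by (auto intro!: root_span_null simp: comm_plus_gen_2)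
  next
    case c
    then show ?thesis
      using assms plus_vec_rec[of i j] root_letters_plus[of i j]
      by (intro root_spanI_diff[of _ _ "EpsPlus j (i + 1)"]) simp_all
  next
    case d
    then show ?thesis
      using assms comm_plus_gen_top[of r j] by (intro root_span_null) auto
  next
    case e
    then show ?thesis
      using assms comm_plus_raise[of r i j] root_letters_plus_raise[of i j]
      by (intro root_spanI_add[of _ _ "EpsPlus (j + 1) i"]) simp_all
  next
    case f
    then show ?thesis
      using assms by (intro root_span_null comm_plus_gen_inner)
  next
    case g
    then show ?thesis
      using assms by (auto intro!: root_span_null comm_plus_gen_same)
  next
    case h
    then show ?thesis
      using assms by (intro root_span_null comm_plus_far)
  qed
qed

lemma comm_gen_in_root_span:
  assumes "2 \<le> r" "\<beta> \<in> positive_roots r" "l \<in> {1..r}"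
  shows "comm (root_vector \<beta>) (gen l) \<in> root_span r (mset (root_letters \<beta>) + {#l#})"
proof (cases \<beta>)
  case (EpsPlus j i)
  then show ?thesis
    using assms comm_plus_one_in_root_span[of r j l] comm_plus_in_root_span[of r i j l]
    by (cases "i = 1") auto
next
  case (EpsMinus j i)
  then show ?thesis
    using assms comm_minus_in_root_span[of r i j l] by simp
qed

text \<open>The elements whose adjoint action preserves the span of the root vectors form a Lie
  subalgebra; containing the generators, it contains all root vectors.\<close>

definition stabilizer :: "nat \<Rightarrow> nat multiset \<Rightarrow> freealg set" where
  "stabilizer r M = {x. \<forall>\<beta>\<in>positive_roots r. comm (root_vector \<beta>) x \<in> root_span r (mset (root_letters \<beta>) + M)}"

lemma comm_stabilizer:
  assumes "x \<in> root_span r K" "z \<in> stabilizer r M"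
  shows "comm x z \<in> root_span r (K + M)"
  using assms(1) unfolding root_span_def[of r K]
proof (induction rule: lspan.induct)
  case (null x)
  then show ?case by (intro root_span_null null_comm_left)
next
  case (base g)
  then show ?case using assms(2) by (auto simp: stabilizer_def)
next
  case (add x y)
  then show ?case unfolding comm_add_left by (simp add: root_span_def lspan.add)
next
  case (scale x c)
  then show ?case unfolding comm_scale_left by (simp add: root_span_def lspan.scale)
qed

lemma stabilizer_comm:
  assumes "x \<in> stabilizer r M" "z \<in> stabilizer r N"
  shows "comm x z \<in> stabilizer r (M + N)"
  unfolding stabilizer_def
proof (intro CollectI ballI)
  fix \<beta> assume \<beta>: "\<beta> \<in> positive_roots r"
  let ?y = "root_vector \<beta>" and ?K = "mset (root_letters \<beta>)"
  have "?y \<in> root_span r ?K" using \<beta> by (rule root_spanI) simp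
  then have "comm (comm ?y x) z \<in> root_span r (?K + M + N)" "comm (comm ?y z) x \<in> root_span r (?K + N + M)"
    using assms by (auto intro: comm_stabilizer)
  then have "comm (comm ?y x) z - comm (comm ?y z) x \<in> root_span r (?K + (M + N))"
    by (simp add: root_span_def lspan_diff ac_simps)
  also have "comm (comm ?y x) z - comm (comm ?y z) x = comm ?y (comm x z)"
    by (simp add: comm_def algebra_simps)
  finally show "comm ?y (comm x z) \<in> root_span r (?K + (M + N))" .
qed

lemma lbracket_in_stabilizer:
  assumes "2 \<le> r" "xs \<noteq> []" "set xs \<subseteq> {1..r}"
  shows "lbracket xs \<in> stabilizer r (mset xs)"
  using assms(2,3)
proof (induction xs rule: rev_nonempty_induct)
  case (single x)
  then show ?case
    using comm_gen_in_root_span[OF assms(1)] by (simp add: stabilizer_def)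
next
  case (snoc x xs)
  have "gen x \<in> stabilizer r {#x#}"
    using comm_gen_in_root_span[OF assms(1)] snoc by (simp add: stabilizer_def)
  then show ?case
    using stabilizer_comm[of "lbracket xs" r "mset xs" "gen x" "{#x#}"] snoc by (simp add: lbracket_snoc)
qed

lemma set_root_letters: "\<beta> \<in> positive_roots r \<Longrightarrow> set (root_letters \<beta>) \<subseteq> {1..r}"
  by (cases \<beta>) (auto simp: root_letters.simps)

lemma comm_root_vectors:
  assumes "2 \<le> r" "\<beta> \<in> positive_roots r" "\<gamma> \<in> positive_roots r"
  shows "comm (root_vector \<beta>) (root_vector \<gamma>) \<in> root_span r (mset (root_letters \<beta>) + mset (root_letters \<gamma>))"
  using lbracket_in_stabilizer[OF assms(1) root_letters_neq_Nil[OF assms(3)] set_root_letters[OF assms(3)]] assms(2)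
  by (simp add: stabilizer_def root_vector_eq)

section \<open>Straightening of products of root vectors\<close>

definition root_prod :: "root list \<Rightarrow> freealg" where
  "root_prod \<Gamma> = prod_list (map root_vector \<Gamma>)"

definition list_letters :: "root list \<Rightarrow> nat multiset" where
  "list_letters \<Gamma> = (\<Sum>\<beta>\<leftarrow>\<Gamma>. mset (root_letters \<beta>))"

lemma root_prod_simps [simp]:
  "root_prod [] = 1" "root_prod (\<beta> # \<Gamma>) = root_vector \<beta> * root_prod \<Gamma>"
  "root_prod (\<Gamma> @ \<Delta>) = root_prod \<Gamma> * root_prod \<Delta>"
  by (simp_all add: root_prod_def)

lemma list_letters_simps [simp]:
  "list_letters [] = {#}" "list_letters (\<beta> # \<Gamma>) = mset (root_letters \<beta>) + list_letters \<Gamma>"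
  "list_letters (\<Gamma> @ \<Delta>) = list_letters \<Gamma> + list_letters \<Delta>"
  by (simp_all add: list_letters_def)

lemma list_letters_cong: "mset \<Gamma> = mset \<Delta> \<Longrightarrow> list_letters \<Gamma> = list_letters \<Delta>"
  unfolding list_letters_def by (metis mset_map sum_mset_sum_list)

definition exponent_list :: "nat \<Rightarrow> (root \<Rightarrow> nat) \<Rightarrow> root list" where
  "exponent_list r p = concat (map (\<lambda>\<beta>. replicate (p \<beta>) \<beta>) (root_list r))"

lemma pbw_monomial_eq: "pbw_monomial r p = root_prod (exponent_list r p)"
proof -
  have "prod_list (map root_vector (replicate n \<beta>)) = root_vector \<beta> ^ n" for n \<beta>
    by (induction n) simp_all
  then have "prod_list (map (\<lambda>\<beta>. root_vector \<beta> ^ p \<beta>) L) = root_prod (concat (map (\<lambda>\<beta>. replicate (p \<beta>) \<beta>) L))" for L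
    by (induction L) (simp_all add: root_prod_def)
  then show ?thesis by (simp add: pbw_monomial_def exponent_list_def)
qed

lemma distinct_root_list: "distinct (root_list r)"
proof -
  have "\<not> root_less \<beta> \<beta>" for \<beta> by (cases \<beta>) auto
  then show ?thesis
    using sorted_root_list[of r] by (auto simp: distinct_conv_nth sorted_wrt_iff_nth_less)
      (metis linorder_neqE_nat)
qed

lemma count_exponent_list:
  "count (mset (exponent_list r p)) \<beta> = (if \<beta> \<in> positive_roots r then p \<beta> else 0)"
proof -
  have "count (mset (concat (map (\<lambda>\<beta>. replicate (p \<beta>) \<beta>) L))) \<beta> = (if \<beta> \<in> set L then p \<beta> else 0)"
    if "distinct L" for L
    using that by (induction L) auto
  then show ?thesis
    by (simp add: exponent_list_def distinct_root_list set_root_list)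
qed

lemma mset_exponent_list:
  assumes "set \<Gamma> \<subseteq> positive_roots r"
  shows "mset (exponent_list r (count (mset \<Gamma>))) = mset \<Gamma>"
  by (rule multiset_eqI) (use assms in \<open>auto simp: count_exponent_list count_eq_zero_iff\<close>)

definition pbw_span :: "nat \<Rightarrow> nat multiset \<Rightarrow> freealg set" where
  "pbw_span r M = lspan r {pbw_monomial r p | p.
     (\<forall>\<beta>. \<beta> \<notin> positive_roots r \<longrightarrow> p \<beta> = 0) \<and> list_letters (exponent_list r p) = M}"

lemma pbw_span_add: "x \<in> pbw_span r M \<Longrightarrow> y \<in> pbw_span r M \<Longrightarrow> x + y \<in> pbw_span r M"
  by (simp add: pbw_span_def lspan.add)

text \<open>Exchanging two neighbouring factors costs their bracket, that is, a combination of
  shorter products with the same letters, which are in the span by induction on the length. So the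
  order of the factors is immaterial modulo the span: \<open>swap\<close> treats neighbours,
  \<open>move\<close> one factor passing a list, \<open>perm\<close> an arbitrary rearrangement, in
  particular the sorted one.\<close>

lemma root_prod_in_pbw_span:
  assumes "2 \<le> r" "set \<Gamma> \<subseteq> positive_roots r"
  shows "root_prod \<Gamma> \<in> pbw_span r (list_letters \<Gamma>)"
  using assms(2)
proof (induction "length \<Gamma>" arbitrary: \<Gamma> rule: less_induct)
  case less
  define n where "n = length \<Gamma>"
  have short: "root_prod \<Delta> \<in> pbw_span r (list_letters \<Delta>)"
    if "length \<Delta> < n" "set \<Delta> \<subseteq> positive_roots r" for \<Delta>
    using less that by (simp add: n_def)
  \<comment> \<open>Here \<open>x\<close> is the bracket that replaces two factors. It counts as a
    single root, so the products that arise fall under \<open>short\<close>.\<close>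
  have insert_span: "root_prod u * x * root_prod v \<in> pbw_span r (list_letters u + K + list_letters v)"
    if "x \<in> root_span r K" "length u + 1 + length v < n"
      "set u \<subseteq> positive_roots r" "set v \<subseteq> positive_roots r" for u v x K
    using that(1) unfolding root_span_def
  proof (induction rule: lspan.induct)
    case (null x)
    then show ?case
      unfolding pbw_span_def by (intro lspan.null null_lmult null_rmult)
  next
    case (base g)
    then obtain \<beta> where \<beta>: "g = root_vector \<beta>" "\<beta> \<in> positive_roots r" "mset (root_letters \<beta>) = K"
      by blast
    show ?case
      using short[of "u @ \<beta> # v"] that \<beta> by (simp add: mult.assoc add.assoc)
  next
    case (add x y)
    then show ?case by (simp add: algebra_simps pbw_span_add)
  next
    case (scale x c)
    have "root_prod u * (Poly_Mapping.single 0 c * x) * root_prod v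
        = Poly_Mapping.single 0 c * (root_prod u * x * root_prod v)"
      by (simp only: mult_scale_right mult.assoc)
    then show ?case using scale by (simp add: pbw_span_def lspan.scale)
  qed
  have swap: "root_prod (u @ \<alpha> # \<beta> # v) - root_prod (u @ \<beta> # \<alpha> # v) \<in> pbw_span r (list_letters (u @ \<alpha> # \<beta> # v))"
    if "length u + 2 + length v \<le> n" "set u \<union> {\<alpha>, \<beta>} \<union> set v \<subseteq> positive_roots r" for u v \<alpha> \<beta>
  proof -
    have "root_prod u * comm (root_vector \<alpha>) (root_vector \<beta>) * root_prod v
        \<in> pbw_span r (list_letters u + (mset (root_letters \<alpha>) + mset (root_letters \<beta>)) + list_letters v)"
      using that by (intro insert_span comm_root_vectors assms(1)) auto
    also have "root_prod u * comm (root_vector \<alpha>) (root_vector \<beta>) * root_prod v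
        = root_prod (u @ \<alpha> # \<beta> # v) - root_prod (u @ \<beta> # \<alpha> # v)"
      by (simp add: comm_def algebra_simps)
    finally show ?thesis by (simp add: ac_simps)
  qed
  have move: "root_prod (u @ \<alpha> # v @ w) - root_prod (u @ v @ \<alpha> # w) \<in> pbw_span r (list_letters (u @ \<alpha> # v @ w))"
    if "length u + 1 + length v + length w \<le> n" "set u \<union> {\<alpha>} \<union> set v \<union> set w \<subseteq> positive_roots r" for u v w \<alpha>
    using that
  proof (induction v arbitrary: u)
    case Nil
    show ?case by (simp add: pbw_span_def lspan.null)
  next
    case (Cons \<beta> v)
    have "(root_prod (u @ \<alpha> # \<beta> # v @ w) - root_prod (u @ \<beta> # \<alpha> # v @ w))
       + (root_prod ((u @ [\<beta>]) @ \<alpha> # v @ w) - root_prod ((u @ [\<beta>]) @ v @ \<alpha> # w))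
      \<in> pbw_span r (list_letters (u @ \<alpha> # \<beta> # v @ w))"
    proof (rule pbw_span_add)
      show "root_prod (u @ \<alpha> # \<beta> # v @ w) - root_prod (u @ \<beta> # \<alpha> # v @ w)
        \<in> pbw_span r (list_letters (u @ \<alpha> # \<beta> # v @ w))"
        using Cons.prems by (intro swap) auto
      have "list_letters (u @ \<alpha> # \<beta> # v @ w) = list_letters ((u @ [\<beta>]) @ \<alpha> # v @ w)"
        by (simp add: ac_simps)
      then show "root_prod ((u @ [\<beta>]) @ \<alpha> # v @ w) - root_prod ((u @ [\<beta>]) @ v @ \<alpha> # w)
        \<in> pbw_span r (list_letters (u @ \<alpha> # \<beta> # v @ w))"
        using Cons.IH[of "u @ [\<beta>]"] Cons.prems by (simp only:) simp
    qed
    then show ?case by (simp add: algebra_simps)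
  qed
  have perm: "root_prod (u @ xs) - root_prod (u @ ys) \<in> pbw_span r (list_letters (u @ xs))"
    if "mset xs = mset ys" "length u + length xs \<le> n" "set u \<union> set xs \<subseteq> positive_roots r" for u xs ys
    using that
  proof (induction xs arbitrary: u ys)
    case Nil
    then show ?case by (simp add: pbw_span_def lspan.null)
  next
    case (Cons \<alpha> xs)
    then have "\<alpha> \<in> set ys" by (metis list.set_intros(1) mset_eq_setD)
    then obtain y1 y2 where ys: "ys = y1 @ \<alpha> # y2" by (meson split_list)
    with Cons.prems have m: "mset xs = mset (y1 @ y2)" by simp
    then have len: "length xs = length y1 + length y2" and set: "set xs = set y1 \<union> set y2"
      by (metis length_append mset_eq_length, metis mset_eq_setD set_append)
    have "(root_prod ((u @ [\<alpha>]) @ xs) - root_prod ((u @ [\<alpha>]) @ (y1 @ y2)))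
       + (root_prod (u @ \<alpha> # y1 @ y2) - root_prod (u @ y1 @ \<alpha> # y2))
      \<in> pbw_span r (list_letters (u @ \<alpha> # xs))"
    proof (rule pbw_span_add)
      have "list_letters (u @ \<alpha> # xs) = list_letters ((u @ [\<alpha>]) @ xs)" by simp
      then show "root_prod ((u @ [\<alpha>]) @ xs) - root_prod ((u @ [\<alpha>]) @ (y1 @ y2))
        \<in> pbw_span r (list_letters (u @ \<alpha> # xs))"
        using Cons.IH[OF m, of "u @ [\<alpha>]"] Cons.prems by (simp only:) simp
      have "list_letters (u @ \<alpha> # xs) = list_letters (u @ \<alpha> # y1 @ y2)"
        using m by (intro list_letters_cong) simp
      then show "root_prod (u @ \<alpha> # y1 @ y2) - root_prod (u @ y1 @ \<alpha> # y2)
        \<in> pbw_span r (list_letters (u @ \<alpha> # xs))"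
        using Cons.prems len set by (simp only:) (intro move; auto)
    qed
    then show ?case by (simp add: ys algebra_simps)
  qed
  let ?p = "count (mset \<Gamma>)"
  let ?\<Delta> = "exponent_list r ?p"
  have eq: "mset \<Gamma> = mset ?\<Delta>"
    using less.prems by (simp add: mset_exponent_list)
  have "root_prod ([] @ \<Gamma>) - root_prod ([] @ ?\<Delta>) \<in> pbw_span r (list_letters ([] @ \<Gamma>))"
    by (rule perm[OF eq]) (use less.prems in \<open>auto simp: n_def\<close>)
  moreover have "root_prod ?\<Delta> \<in> pbw_span r (list_letters \<Gamma>)"
    unfolding pbw_span_def pbw_monomial_eq[symmetric]
  proof (rule lspan.base, intro CollectI exI[of _ ?p] conjI refl allI impI)
    show "?p \<beta> = 0" if "\<beta> \<notin> positive_roots r" for \<beta>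
      using that less.prems by (auto simp: count_eq_zero_iff)
    show "list_letters ?\<Delta> = list_letters \<Gamma>"
      using eq by (intro list_letters_cong) simp
  qed
  ultimately show ?case
    using pbw_span_add by fastforce
qed

lemma word_in_pbw_span:
  assumes "2 \<le> r" "set ws \<subseteq> {1..r}"
  shows "Poly_Mapping.single (Word ws) 1 \<in> pbw_span r (mset ws)"
proof -
  \<comment> \<open>The root whose root vector is the generator \<open>l\<close>; the first simple
    root is \<open>eps 2 + eps 1\<close>, hence the exception.\<close>
  define root_of where "root_of l = (if l = 1 then EpsPlus 2 1 else EpsMinus l (l - 1))" for l :: nat
  have letters: "root_letters (root_of l) = [l]" if "1 \<le> l" for l
    using that root_letters_plus_simple root_letters_minus_simple[of l] by (simp add: root_of_def)
  have pos: "root_of l \<in> positive_roots r" if "1 \<le> l" "l \<le> r" for l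
    using that assms(1) by (auto simp: root_of_def)
  have "root_prod (map root_of ws) = Poly_Mapping.single (Word ws) 1"
    "list_letters (map root_of ws) = mset ws"
    using assms(2)
    by (induction ws)
      (simp_all add: root_vector_eq letters gen_def mult_single plus_fword_def zero_fword_def
        flip: single_one)
  then show ?thesis
    using root_prod_in_pbw_span[OF assms(1), of "map root_of ws"] pos assms(2) by fastforce
qed

section \<open>Linear functionals given by paths\<close>

definition lin :: "('a \<Rightarrow> 'b::comm_ring_1) \<Rightarrow> ('a \<Rightarrow>\<^sub>0 'b) \<Rightarrow> 'b" where
  "lin h P = (\<Sum>w\<in>Poly_Mapping.keys P. Poly_Mapping.lookup P w * h w)"

lemma lin_superset:
  assumes "finite A" "Poly_Mapping.keys P \<subseteq> A"
  shows "lin h P = (\<Sum>w\<in>A. Poly_Mapping.lookup P w * h w)"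
  unfolding lin_def using assms
  by (intro sum.mono_neutral_left) (auto simp: in_keys_iff)

lemma lin_zero [simp]: "lin h 0 = 0"
  by (simp add: lin_def)

lemma lin_add: "lin h (P + Q) = lin h P + lin h Q"
proof -
  let ?A = "Poly_Mapping.keys P \<union> Poly_Mapping.keys Q"
  have "Poly_Mapping.keys (P + Q) \<subseteq> ?A" by (rule keys_add)
  then show ?thesis
    by (simp add: lin_superset[of ?A] lookup_add sum.distrib algebra_simps)
qed

lemma lin_uminus: "lin h (- P) = - lin h P"
  using lin_add[of h P "- P"] by (simp add: eq_neg_iff_add_eq_0 add.commute)

lemma lin_diff: "lin h (P - Q) = lin h P - lin h Q"
  using lin_add[of h P "- Q"] by (simp add: lin_uminus)

lemma lin_sum: "lin h (sum f A) = (\<Sum>a\<in>A. lin h (f a))"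
  by (induction A rule: infinite_finite_induct) (simp_all add: lin_add)

lemma lin_single [simp]: "lin h (Poly_Mapping.single w c) = c * h w"
  by (simp add: lin_def)

lemma lin_single_mult: "lin h (Poly_Mapping.single a c * P) = c * lin (\<lambda>w. h (a + w)) P"
  by (induction P rule: poly_mapping_induct_add) (simp_all add: mult_single algebra_simps lin_add)

lemma lin_mult_single: "lin h (P * Poly_Mapping.single a c) = c * lin (\<lambda>w. h (w + a)) P"
  by (induction P rule: poly_mapping_induct_add) (simp_all add: mult_single algebra_simps lin_add)

lemma lin_eq_0: "(\<And>w. w \<in> Poly_Mapping.keys P \<Longrightarrow> h w = 0) \<Longrightarrow> lin h P = 0"
  by (simp add: lin_def)

text \<open>The generators act on the weights \<open>\<plusminus>\<epsilon>\<^sub>u\<close> of the vector representation, coded as the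
  integers \<open>\<plusminus>u\<close>; \<open>0\<close> codes the zero vector. The usual signs of the matrices are
  dispensable, since \<open>f\<^sub>a f\<^sub>a\<close> and \<open>f\<^sub>a f\<^sub>b f\<^sub>a\<close> act as zero.\<close>

definition step :: "int \<Rightarrow> nat \<Rightarrow> int" where
  "step s m = (if m = 1 then (if s = 2 then - 1 else if s = 1 then - 2 else 0)
     else if 2 \<le> m \<and> (s = int m \<or> s = 1 - int m) then s - 1 else 0)"

abbreviation run :: "int \<Rightarrow> nat list \<Rightarrow> int" where
  "run \<equiv> foldl step"

lemma step_0 [simp]: "step 0 m = 0"
  by (auto simp: step_def)

lemma run_0 [simp]: "run 0 ws = 0"
  by (induction ws) simp_all

lemma step_twice: "step (step s a) a = 0"
  by (auto simp: step_def)

lemma step_aba: "adj a b \<Longrightarrow> step (step (step s a) b) a = 0"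
  unfolding adj_def by (elim disjE) (auto simp: step_def)

text \<open>The exception {1, 2} is the only pair of commuting generators with a nonzero product: it
  gives the square from 2 through 1 or -1 to -2, whose two sides agree by
  \<open>step_commute\<close>.\<close>

lemma step_nonadj:
  assumes "\<not> adj a b" "1 \<le> a" "1 \<le> b" "{a, b} \<noteq> {1, 2}"
  shows "step (step s a) b = 0"
proof -
  consider "a = b" | "a = 1" "4 \<le> b" | "b = 1" "4 \<le> a"
    | "2 \<le> a" "2 \<le> b" "b \<noteq> a" "b \<noteq> a + 1" "a \<noteq> b + 1"
    using assms(1-3,4)[unfolded adj_def doubleton_eq_iff] by atomize_elim presburger
  then show ?thesis
  proof cases
    case 1
    then show ?thesis by (simp add: step_twice)
  next
    case 2
    then show ?thesis by (simp add: step_def)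
  next
    case 3
    then have "step s a = 0 \<or> step s a = int a - 1 \<or> step s a = - int a"
      by (auto simp: step_def)
    then show ?thesis using 3 by (auto simp: step_def)
  next
    case 4
    then have "step s a = 0 \<or> step s a = int a - 1 \<or> step s a = - int a"
      by (auto simp: step_def)
    then show ?thesis using 4 by (auto simp: step_def[of _ b])
  qed
qed

lemma step_commute:
  assumes "\<not> adj a b" "1 \<le> a" "1 \<le> b"
  shows "step (step s a) b = step (step s b) a"
proof (cases "{a, b} = {1, 2}")
  case True
  have "step (step s 1) 2 = step (step s 2) 1" by (simp add: step_def)
  then show ?thesis using True by (auto simp: doubleton_eq_iff simp del: One_nat_def)
next
  case False
  moreover have "\<not> adj b a" using assms(1) by (auto simp: adj_def)
  ultimately show ?thesis
    using assms step_nonadj[of a b s] step_nonadj[of b a s] by (simp add: insert_commute)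
qed

text \<open>In the coding of the weights by integers every path descends. This confines the
  intermediate points of a path once its end is known.\<close>

lemma step_less: "step s m \<noteq> 0 \<Longrightarrow> step s m < s"
  by (auto simp: step_def split: if_splits)

lemma run_le: "run s ws \<noteq> 0 \<Longrightarrow> run s ws \<le> s"
proof (induction ws rule: rev_induct)
  case (snoc m ws)
  then show ?case using step_less[of "run s ws" m] by (cases "run s ws = 0") auto
qed simp

text \<open>The annihilator of the representation: \<open>s\<close> runs through the basis vectors
  and \<open>g\<close> through the functionals, with \<open>g 0 = 0\<close> because 0 codes the zero
  vector. With arbitrary \<open>g\<close> the condition survives right multiplication, since
  \<open>g\<close> may be composed with the action of a further word.\<close>

definition path_null :: "nat \<Rightarrow> freealg set" where
  "path_null r = {x \<in> carrier (free_alg r). \<forall>g s. g 0 = 0 \<longrightarrow> lin (\<lambda>w. g (run s (letters w))) x = 0}"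

lemma path_null_lmult:
  assumes "x \<in> path_null r" "g 0 = 0"
  shows "lin (\<lambda>w. g (run s (letters w))) (y * x) = 0"
proof (induction y rule: poly_mapping_induct_add)
  case (single a c)
  show ?case using assms by (simp add: lin_single_mult plus_fword_def path_null_def)
qed (simp_all add: algebra_simps lin_add)

lemma path_null_rmult:
  assumes "x \<in> path_null r" "g 0 = 0"
  shows "lin (\<lambda>w. g (run s (letters w))) (x * y) = 0"
proof (induction y rule: poly_mapping_induct_add)
  case (single a c)
  have "lin (\<lambda>w. g (run (run s (letters w)) (letters a))) x = 0"
    using assms by (auto simp: path_null_def dest!: spec[of _ "\<lambda>t. g (run t (letters a))"])
  then show ?case by (simp add: lin_mult_single plus_fword_def)
qed (simp_all add: algebra_simps lin_add)

lemma ideal_path_null: "ideal (path_null r) (free_alg r)"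
proof -
  interpret R: ring "free_alg r" by (rule ring_free_alg)
  have carrier: "x * y \<in> carrier (free_alg r)" "x + y \<in> carrier (free_alg r)"
    if "x \<in> carrier (free_alg r)" "y \<in> carrier (free_alg r)" for x y
    using R.m_closed[OF that] R.a_closed[OF that] by (simp_all add: free_alg_def)
  have neg: "- x \<in> carrier (free_alg r)" if "x \<in> carrier (free_alg r)" for x
    using that by (simp add: free_alg_def keys.rep_eq)
  have inv: "inv\<^bsub>add_monoid (free_alg r)\<^esub> x = - x" if "x \<in> carrier (free_alg r)" for x
    using R.minus_equality[of "- x" x] that neg[OF that] by (simp add: a_inv_def free_alg_def)
  show ?thesis
  proof (rule idealI[OF ring_free_alg])
    show "subgroup (path_null r) (add_monoid (free_alg r))"
    proof (rule subgroup.intro)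
      show "path_null r \<subseteq> carrier (add_monoid (free_alg r))"
        by (auto simp: path_null_def)
      show "x \<otimes>\<^bsub>add_monoid (free_alg r)\<^esub> y \<in> path_null r" if "x \<in> path_null r" "y \<in> path_null r" for x y
        using that carrier(2)[of x y] by (simp add: path_null_def lin_add) (simp add: free_alg_def lin_add)
      show "\<one>\<^bsub>add_monoid (free_alg r)\<^esub> \<in> path_null r"
        by (simp add: path_null_def) (simp add: free_alg_def)
      show "inv\<^bsub>add_monoid (free_alg r)\<^esub> x \<in> path_null r" if "x \<in> path_null r" for x
      proof -
        have x: "x \<in> carrier (free_alg r)" using that by (simp add: path_null_def)
        show ?thesis unfolding inv[OF x] using that neg[OF x] by (simp add: path_null_def lin_uminus)
      qed
    qed
    show "y \<otimes>\<^bsub>free_alg r\<^esub> x \<in> path_null r" if "x \<in> path_null r" "y \<in> carrier (free_alg r)" for x y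
    proof -
      have "x \<in> carrier (free_alg r)" using that by (simp add: path_null_def)
      then have "y * x \<in> path_null r"
        using that path_null_lmult[of x r _ _ y] carrier(1)[of y x] by (simp add: path_null_def)
      then show ?thesis by (simp add: free_alg_def)
    qed
    show "x \<otimes>\<^bsub>free_alg r\<^esub> y \<in> path_null r" if "x \<in> path_null r" "y \<in> carrier (free_alg r)" for x y
    proof -
      have "x \<in> carrier (free_alg r)" using that by (simp add: path_null_def)
      then have "x * y \<in> path_null r"
        using that path_null_rmult[of x r _ _ y] carrier(1)[of x y] by (simp add: path_null_def)
      then show ?thesis by (simp add: free_alg_def)
    qed
  qed
qed

lemma serre_ideal_path_null:
  assumes "2 \<le> r"
  shows "serre_ideal r \<subseteq> path_null r"
proof -
  interpret R: ring "free_alg r" by (rule ring_free_alg)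
  have "(comm (gen a) ^^ nat (1 - cartan r a b)) (gen b) \<in> path_null r"
    if ab: "a \<in> {1..r}" "b \<in> {1..r}" "a \<noteq> b" for a b
  proof -
    have "lin (\<lambda>w. g (run s (letters w))) ((comm (gen a) ^^ nat (1 - cartan r a b)) (gen b)) = 0"
      if g: "g 0 = 0" for g s
    proof (cases "adj a b")
      case True
      have "comm (gen a) (comm (gen a) (gen b)) =
          Poly_Mapping.single (Word [a, a, b]) 1 - Poly_Mapping.single (Word [a, b, a]) 1
          - Poly_Mapping.single (Word [a, b, a]) 1 + Poly_Mapping.single (Word [b, a, a]) 1"
        by (simp add: comm_def gen_def algebra_simps mult_single plus_fword_def)
      moreover have "nat (1 - cartan r a b) = 2"
        using True ab assms by (simp add: cartan_eq)
      ultimately show ?thesis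
        using g True by (simp add: numeral_2_eq_2 lin_add lin_diff step_twice step_aba)
    next
      case False
      have "comm (gen a) (gen b) = Poly_Mapping.single (Word [a, b]) 1 - Poly_Mapping.single (Word [b, a]) 1"
        by (simp add: comm_def gen_def mult_single plus_fword_def)
      moreover have "nat (1 - cartan r a b) = 1"
        using False ab assms by (simp add: cartan_eq)
      ultimately show ?thesis
        using ab step_commute[OF False] by (simp add: lin_diff)
    qed
    moreover have "(comm (gen a) ^^ nat (1 - cartan r a b)) (gen b) \<in> carrier (free_alg r)"
      using ab serre_relations_in_carrier[of r] by (force simp: serre_relations_def)
    ultimately show ?thesis by (simp add: path_null_def)
  qed
  then have "serre_relations r \<subseteq> path_null r" by (auto simp: serre_relations_def)
  then show ?thesis
    unfolding serre_ideal_def by (rule R.genideal_minimal[OF ideal_path_null])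
qed

subsection \<open>Extension of scalars\<close>

lemma scalar_zero [simp]: "scalar 0 = 0"
  by (simp add: scalar_def Zero_fract_def)

lemma scalar_one [simp]: "scalar 1 = 1"
  by (simp add: scalar_def One_fract_def)

lemma scalar_add: "scalar (c + d) = scalar c + scalar d"
  by (simp add: scalar_def single_add)

lemma scalar_mult: "scalar (c * d) = scalar c * scalar d"
  by (simp add: scalar_def mult_single)

lemma scalar_sum: "scalar (sum f A) = (\<Sum>a\<in>A. scalar (f a))"
  by (induction A rule: infinite_finite_induct) (simp_all add: scalar_add)

lemma lookup_tensor: "Poly_Mapping.lookup (tensor a x) w = a * scalar (Poly_Mapping.lookup x w)"
  by (simp add: tensor_def map.rep_eq when_def)

lemma keys_tensor: "Poly_Mapping.keys (tensor a x) \<subseteq> Poly_Mapping.keys x"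
  by (auto simp: in_keys_iff lookup_tensor)

lemma tensor_add: "tensor a (x + y) = tensor a x + tensor a y"
  by (rule poly_mapping_eqI) (simp add: lookup_tensor lookup_add scalar_add algebra_simps)

lemma tensor_zero_left [simp]: "tensor 0 x = 0"
  by (rule poly_mapping_eqI) (simp add: lookup_tensor)

lemma tensor_zero_right [simp]: "tensor a 0 = 0"
  by (rule poly_mapping_eqI) (simp add: lookup_tensor)

lemma tensor_add_left: "tensor (a + b) x = tensor a x + tensor b x"
  by (rule poly_mapping_eqI) (simp add: lookup_tensor lookup_add algebra_simps)

lemma tensor_uminus: "tensor (- a) x = - tensor a x"
  by (rule poly_mapping_eqI) (simp add: lookup_tensor)

lemma tensor_single: "tensor a (Poly_Mapping.single w 1) = Poly_Mapping.single w a"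
  by (rule poly_mapping_eqI) (simp add: lookup_tensor lookup_single when_def)

lemma lookup_scale: "Poly_Mapping.lookup (Poly_Mapping.single 0 c * x) w = c * Poly_Mapping.lookup x w"
  for x :: freealg
  by (induction x rule: poly_mapping_induct_add)
    (simp_all add: mult_single lookup_single when_def algebra_simps lookup_add)

lemma tensor_scale: "tensor a (Poly_Mapping.single 0 c * x) = tensor (a * scalar c) x"
  by (rule poly_mapping_eqI) (simp add: lookup_tensor lookup_scale scalar_mult algebra_simps)

lemma serre_tensor_tensor: "y \<in> serre_ideal r \<Longrightarrow> tensor a y \<in> serre_tensor r"
  using serre_tensor.add[OF _ serre_tensor.zero, of y r a] by simp

lemma serre_tensor_add: "x \<in> serre_tensor r \<Longrightarrow> y \<in> serre_tensor r \<Longrightarrow> x + y \<in> serre_tensor r"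
  by (induction rule: serre_tensor.induct) (simp_all add: add.assoc serre_tensor.add)

lemma serre_tensor_uminus: "x \<in> serre_tensor r \<Longrightarrow> - x \<in> serre_tensor r"
proof (induction rule: serre_tensor.induct)
  case (add y z a)
  then show ?case using serre_tensor.add[of y r "- z" "- a"] by (simp add: tensor_uminus)
qed (simp add: serre_tensor.zero)

lemma id_tensor_qmap_eq_iff: "id_tensor_qmap r x = id_tensor_qmap r y \<longleftrightarrow> x - y \<in> serre_tensor r"
proof
  assume "id_tensor_qmap r x = id_tensor_qmap r y"
  moreover have "x \<in> id_tensor_qmap r x"
    unfolding id_tensor_qmap_def by (rule image_eqI[of _ _ 0]) (simp_all add: serre_tensor.zero)
  ultimately obtain z where "z \<in> serre_tensor r" "x = y + z"
    by (auto simp: id_tensor_qmap_def)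
  then show "x - y \<in> serre_tensor r" by simp
next
  have sub: "id_tensor_qmap r x \<subseteq> id_tensor_qmap r y" if "x - y \<in> serre_tensor r" for x y
  proof
    fix w assume "w \<in> id_tensor_qmap r x"
    then obtain z where "z \<in> serre_tensor r" "w = x + z" by (auto simp: id_tensor_qmap_def)
    then show "w \<in> id_tensor_qmap r y"
      using serre_tensor_add[OF that, of z] unfolding id_tensor_qmap_def
      by (intro image_eqI[of _ _ "x - y + z"]) simp_all
  qed
  assume "x - y \<in> serre_tensor r"
  moreover from this have "y - x \<in> serre_tensor r" using serre_tensor_uminus by fastforce
  ultimately show "id_tensor_qmap r x = id_tensor_qmap r y" using sub by blast
qed

text \<open>The matrix coefficient between the basis vectors \<open>s\<close> and \<open>t\<close>.
  It is polymorphic in the scalars because it is evaluated on complex root monomials as well as on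
  the canonical form; \<open>path_coeff_tensor\<close> relates the two.\<close>

definition path_coeff :: "int \<Rightarrow> int \<Rightarrow> (fword \<Rightarrow>\<^sub>0 'b::comm_ring_1) \<Rightarrow> 'b" where
  "path_coeff s t = lin (\<lambda>w. of_bool (run s (letters w) = t))"

lemma path_coeff_tensor: "path_coeff s t (tensor a x) = a * scalar (path_coeff s t x)"
proof -
  have "path_coeff s t (tensor a x)
    = (\<Sum>w\<in>Poly_Mapping.keys x. a * scalar (Poly_Mapping.lookup x w) * of_bool (run s (letters w) = t))"
    unfolding path_coeff_def by (subst lin_superset[OF _ keys_tensor]) (simp_all add: lookup_tensor)
  also have "\<dots> = (\<Sum>w\<in>Poly_Mapping.keys x. a * scalar (Poly_Mapping.lookup x w * of_bool (run s (letters w) = t)))"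
    by (intro sum.cong) auto
  finally show ?thesis
    unfolding path_coeff_def lin_def scalar_sum sum_distrib_left .
qed

lemma path_coeff_serre_tensor:
  assumes "2 \<le> r" "t \<noteq> 0" "x \<in> serre_tensor r"
  shows "path_coeff s t x = 0"
  using assms(3)
proof (induction rule: serre_tensor.induct)
  case zero
  show ?case by (simp add: path_coeff_def)
next
  case (add y z a)
  have "y \<in> path_null r" using serre_ideal_path_null[OF assms(1)] add by blast
  then have "path_coeff s t y = 0"
    using assms(2) by (auto simp: path_null_def path_coeff_def dest!: spec[of _ "\<lambda>u. of_bool (u = t)"])
  then show ?case
    using add path_coeff_tensor[of s t a y] by (simp add: path_coeff_def lin_add)
qed

subsection \<open>Paths through products of root vectors\<close>

definition weight :: "int \<Rightarrow> nat \<Rightarrow> int" where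
  "weight s u = (if int u = \<bar>s\<bar> then sgn s else 0)"

lemma weight_pos: "0 < a \<Longrightarrow> weight (int a) u = eps a u"
  and weight_neg: "0 < a \<Longrightarrow> weight (- int a) u = - eps a u"
  by (auto simp: weight_def eps_def)

lemma step_weight:
  assumes "step s m \<noteq> 0"
  shows "weight s u - weight (step s m) u = simple_root m u"
proof -
  consider "m = 1" "s = int 2" "step s m = - int 1" | "m = 1" "s = int 1" "step s m = - int 2"
    | "2 \<le> m" "s = int m" "step s m = int (m - 1)" | "2 \<le> m" "s = - int (m - 1)" "step s m = - int m"
    using assms by (auto simp: step_def split: if_splits)
  then show ?thesis
    by cases (simp_all only: weight_pos weight_neg zero_less_numeral zero_less_one,
      simp_all add: weight_pos weight_neg simple_root_def)
qed

lemma run_weight: "run s ws \<noteq> 0 \<Longrightarrow> weight s u - weight (run s ws) u = (\<Sum>m\<leftarrow>ws. simple_root m u)"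
proof (induction ws rule: rev_induct)
  case (snoc m ws)
  then show ?case using step_weight[of "run s ws" m u] by (cases "run s ws = 0") auto
qed simp

lemma sum_root_letters:
  assumes "\<beta> \<in> positive_roots r"
  shows "(\<Sum>m\<leftarrow>root_letters \<beta>. simple_root m u) = root_vec \<beta> u"
proof -
  have upt: "(\<Sum>m\<leftarrow>[a + 1..<b + 1]. simple_root m u) = eps b u - eps a u" if "1 \<le> a" "a \<le> b" for a b
  proof -
    have "set [a + 1..<b + 1] = {a + 1..b}" by auto
    then show ?thesis
      by (simp only: interv_sum_list_conv_sum_set_nat sum_simple_roots[OF that])
  qed
  have rev: "(\<Sum>m\<leftarrow>rev xs. simple_root m u) = (\<Sum>m\<leftarrow>xs. simple_root m u)" for xs
    by (induction xs) simp_all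
  show ?thesis
  proof (cases \<beta>)
    case (EpsMinus j i)
    then show ?thesis
      using assms upt[of i j] rev[of "[i + 1..<j + 1]"] by (simp add: root_letters.simps)
  next
    case (EpsPlus j i)
    have j: "[1..<j + 1] = 1 # [1 + 1..<j + 1]"
      using assms EpsPlus by (simp add: upt_conv_Cons)
    have one: "(\<Sum>m\<leftarrow>[1..<j + 1]. simple_root m u) = simple_root 1 u + (eps j u - eps 1 u)"
      unfolding j list.map sum_list.Cons using assms EpsPlus upt[of 1 j] by simp
    have three: "(\<Sum>m\<leftarrow>[3..<b + 1]. simple_root m u) = eps b u - eps 2 u" if "2 \<le> b" for b
      using upt[of 2 b] that by simp
    have simple: "simple_root 1 u = eps 1 u + eps 2 u" by (simp add: simple_root_def)
    have ij: "1 \<le> i" "i < j" using assms EpsPlus by auto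
    show ?thesis
    proof (cases "i = 1")
      case True
      then have letters: "root_letters \<beta> = rev [3..<j + 1] @ [1]"
        using EpsPlus by (simp add: root_letters.simps)
      have "2 \<le> j" using True ij by simp
      then have "(\<Sum>m\<leftarrow>root_letters \<beta>. simple_root m u) = eps j u - eps 2 u + simple_root 1 u"
        unfolding letters
        by (simp only: map_append sum_list_append rev three list.map sum_list.Cons sum_list.Nil add_0_right)
      then show ?thesis using EpsPlus True simple by simp
    next
      case False
      then have letters: "root_letters \<beta> = rev [1..<j + 1] @ [3..<i + 1]"
        using EpsPlus by (simp add: root_letters.simps)
      have "2 \<le> i" using False ij by simp
      then have "(\<Sum>m\<leftarrow>root_letters \<beta>. simple_root m u) = simple_root 1 u + (eps j u - eps 1 u) + (eps i u - eps 2 u)"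
        unfolding letters by (simp only: map_append sum_list_append rev one three)
      then show ?thesis using EpsPlus simple by simp
    qed
  qed
qed

text \<open>Each step subtracts the simple root of its letter, so the end points of the path differ
  by the root. A difference of two weights plus or minus \<open>eps a\<close> and plus or minus
  \<open>eps b\<close> equals a given root in exactly two ways.\<close>

lemma run_root:
  assumes "\<beta> \<in> positive_roots r" "mset ws = mset (root_letters \<beta>)" "run s ws \<noteq> 0"
  shows "(\<exists>j i. \<beta> = EpsPlus j i \<and> (s = int j \<and> run s ws = - int i \<or> s = int i \<and> run s ws = - int j))
    \<or> (\<exists>j i. \<beta> = EpsMinus j i \<and> (s = int j \<and> run s ws = int i \<or> s = - int i \<and> run s ws = - int j))"
proof -
  have "s \<noteq> 0" using assms(3) by auto
  define y where "y = run s ws"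
  have "weight s u - weight y u = root_vec \<beta> u" for u
  proof -
    have "(\<Sum>m\<leftarrow>ws. simple_root m u) = (\<Sum>m\<leftarrow>root_letters \<beta>. simple_root m u)"
      using assms(2) by (metis mset_map sum_mset_sum_list)
    then show ?thesis
      using run_weight[OF assms(3), of u] sum_root_letters[OF assms(1), of u] by (simp add: y_def)
  qed
  note w = this
  have y: "y \<noteq> 0" using assms(3) by (simp add: y_def)
  define a b where "a = nat \<bar>s\<bar>" and "b = nat \<bar>y\<bar>"
  have pos: "0 < a" "0 < b" using \<open>s \<noteq> 0\<close> y by (auto simp: a_def b_def)
  define c d where "c = sgn s" and "d = sgn y"
  have cd: "c * eps a u - d * eps b u = root_vec \<beta> u" "s = c * int a" "y = d * int b"
    "c = 1 \<or> c = - 1" "d = 1 \<or> d = - 1" for u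
  proof -
    have "weight s u = c * eps a u" "weight y u = d * eps b u"
      by (auto simp: weight_def eps_def a_def b_def c_def d_def)
    then show "c * eps a u - d * eps b u = root_vec \<beta> u" using w[of u] by simp
  qed (use y \<open>s \<noteq> 0\<close> in \<open>auto simp: a_def b_def c_def d_def sgn_if\<close>)
  show ?thesis
  proof (cases \<beta>)
    case (EpsPlus j i)
    then have ij: "i < j" "1 \<le> i" using assms(1) by auto
    have "c = 1 \<and> d = - 1 \<and> (a = j \<and> b = i \<or> a = i \<and> b = j)"
    proof -
      \<comment> \<open>For \<open>a = b\<close> the left side of \<open>cd(1)\<close> at coordinate
        \<open>j\<close> would be 0 or \<open>c - d\<close>, an even number, whereas the root has
        coefficient 1 there.\<close>
      have "a \<noteq> b"
        using cd(1)[of j] cd(4,5) ij by (auto simp: EpsPlus eps_def split: if_splits)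
      moreover from this have "c = eps j a + eps i a" "- d = eps j b + eps i b"
        using cd(1)[of a] cd(1)[of b] by (simp_all add: EpsPlus eps_def)
      ultimately show ?thesis
        using cd(4,5) ij by (auto simp: eps_def split: if_splits)
    qed
    then show ?thesis
      unfolding y_def[symmetric] using cd(2,3) EpsPlus by auto
  next
    case (EpsMinus j i)
    then have ij: "i < j" "1 \<le> i" using assms(1) by auto
    have "c = 1 \<and> d = 1 \<and> a = j \<and> b = i \<or> c = - 1 \<and> d = - 1 \<and> a = i \<and> b = j"
    proof -
      have "a \<noteq> b"
        using cd(1)[of j] cd(4,5) ij by (auto simp: EpsMinus eps_def split: if_splits)
      moreover from this have "c = eps j a - eps i a" "- d = eps j b - eps i b"
        using cd(1)[of a] cd(1)[of b] by (simp_all add: EpsMinus eps_def)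
      ultimately show ?thesis
        using cd(4,5) ij by (auto simp: eps_def split: if_splits)
    qed
    then show ?thesis
      unfolding y_def[symmetric] using cd(2,3) EpsMinus by auto
  qed
qed

lemma mset_keys_lbracket: "w \<in> Poly_Mapping.keys (lbracket xs) \<Longrightarrow> mset (letters w) = mset xs"
proof (induction xs arbitrary: w rule: rev_induct)
  case (snoc x xs)
  show ?case
  proof (cases "xs = []")
    case True
    then show ?thesis using snoc.prems by (simp add: gen_def)
  next
    case False
    then have "w \<in> Poly_Mapping.keys (lbracket xs * gen x - gen x * lbracket xs)"
      using snoc.prems by (simp add: lbracket_snoc comm_def)
    then have "w \<in> Poly_Mapping.keys (lbracket xs * gen x) \<union> Poly_Mapping.keys (gen x * lbracket xs)"
      using keys_add[of "lbracket xs * gen x" "- (gen x * lbracket xs)"] by (auto simp: in_keys_iff)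
    then obtain v where "v \<in> Poly_Mapping.keys (lbracket xs)" "w = v + Word [x] \<or> w = Word [x] + v"
      using keys_mult[of "lbracket xs" "gen x"] keys_mult[of "gen x" "lbracket xs"]
      by (auto simp: gen_def)
    then show ?thesis using snoc.IH by (auto simp: plus_fword_def)
  qed
qed simp

lemma mset_keys_root_vector: "w \<in> Poly_Mapping.keys (root_vector \<beta>) \<Longrightarrow> mset (letters w) = mset (root_letters \<beta>)"
  unfolding root_vector_eq by (rule mset_keys_lbracket)

lemma mset_keys_root_prod: "w \<in> Poly_Mapping.keys (root_prod \<Gamma>) \<Longrightarrow> mset (letters w) = list_letters \<Gamma>"
proof (induction \<Gamma> arbitrary: w)
  case Nil
  then show ?case by (simp add: zero_fword_def)
next
  case (Cons \<beta> \<Gamma>)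
  then obtain u v where "w = u + v" "u \<in> Poly_Mapping.keys (root_vector \<beta>)" "v \<in> Poly_Mapping.keys (root_prod \<Gamma>)"
    using keys_mult[of "root_vector \<beta>" "root_prod \<Gamma>"] by auto
  then show ?case using Cons.IH[of v] mset_keys_root_vector[of u] by (simp add: plus_fword_def)
qed

fun top_index :: "root \<Rightarrow> nat" where
  "top_index (EpsPlus j i) = j"
| "top_index (EpsMinus j i) = j"

text \<open>The difference between \<open>eps j\<close> and the weight coded by \<open>t\<close>, so
  that both families of roots are treated at once.\<close>

definition path_root :: "nat \<Rightarrow> int \<Rightarrow> root" where
  "path_root j t = (if t < 0 then EpsPlus j (nat (- t)) else EpsMinus j (nat t))"

text \<open>The first factor has largest index \<open>j\<close> and leads from \<open>j\<close> to some \<open>y\<close> with \<open>\<bar>y\<bar> < j\<close>; the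
  second, whose largest index is not smaller, can only lead from \<open>y\<close> to \<open>-j\<close> or below.\<close>

lemma run_two_roots:
  assumes "\<beta> \<in> positive_roots r" "\<gamma> \<in> positive_roots r" "top_index \<beta> \<le> top_index \<gamma>"
    and "mset u = mset (root_letters \<beta>)" "mset v = mset (root_letters \<gamma>)"
    and "t \<noteq> 0" "\<bar>t\<bar> < int j"
  shows "run (int j) (u @ v @ ws) \<noteq> t"
proof
  assume run: "run (int j) (u @ v @ ws) = t"
  define y where "y = run (int j) u"
  define z where "z = run y v"
  have "z \<noteq> 0" using run \<open>t \<noteq> 0\<close> by (auto simp: y_def z_def)
  then have "y \<noteq> 0" by (auto simp: z_def)
  have "t \<le> z" using run_le[of z ws] run \<open>t \<noteq> 0\<close> by (simp add: y_def z_def)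
  have "z \<le> y" using run_le[of y v] \<open>z \<noteq> 0\<close> by (simp add: z_def)
  have y: "top_index \<beta> = j \<and> \<bar>y\<bar> < int j"
    using run_root[OF assms(1,4), of "int j"] \<open>y \<noteq> 0\<close> \<open>z \<le> y\<close> \<open>t \<le> z\<close> assms(1,6,7)
    by (auto simp flip: y_def)
  show False
    using run_root[OF assms(2,5), of y] \<open>z \<noteq> 0\<close> \<open>t \<le> z\<close> y assms(2,3,6,7)
    by (auto simp flip: z_def)
qed

lemma run_one_root:
  assumes "\<beta> \<in> positive_roots r" "mset u = mset (root_letters \<beta>)" "t \<noteq> 0" "\<bar>t\<bar> < int j" "run (int j) u = t"
  shows "\<beta> = path_root j t"
  using run_root[OF assms(1,2), of "int j"] assms(1,3,4,5) by (auto simp: path_root_def)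

lemma run_descend: "1 \<le> i \<Longrightarrow> i \<le> j \<Longrightarrow> run (int j) (rev [i + 1..<j + 1]) = int i"
proof (induction j)
  case (Suc j)
  show ?case
  proof (cases "i = Suc j")
    case False
    then have "step (int (Suc j)) (Suc j) = int j" using Suc by (simp add: step_def)
    then show ?thesis using Suc False by simp
  qed simp
qed simp

lemma run_ascend: "2 \<le> i \<Longrightarrow> run (- 2) [3..<i + 1] = - int i"
proof (induction i rule: nat_induct_at_least)
  case (Suc i)
  then show ?case by (simp add: step_def)
qed simp

lemma path_root_positive:
  "t \<noteq> 0 \<Longrightarrow> \<bar>t\<bar> < int j \<Longrightarrow> j \<le> r \<Longrightarrow> path_root j t \<in> positive_roots r"
  by (auto simp: path_root_def)

lemma run_root_letters:
  assumes "t \<noteq> 0" "\<bar>t\<bar> < int j"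
  shows "run (int j) (root_letters (path_root j t)) = t"
proof (cases "t < 0")
  case True
  define i where "i = nat (- t)"
  have t: "t = - int i" "1 \<le> i" "i < j" "path_root j t = EpsPlus j i"
    using True assms by (auto simp: i_def path_root_def)
  have two: "run (int j) (rev [3..<j + 1]) = 2"
    using run_descend[of 2 j] t by simp
  show ?thesis
  proof (cases "i = 1")
    case True
    then show ?thesis using t two by (simp add: root_letters.simps step_def)
  next
    case False
    then have "[1..<j + 1] = [1, 2] @ [3..<j + 1]"
      using t by (simp add: upt_conv_Cons eval_nat_numeral)
    then have "root_letters (EpsPlus j i) = rev [3..<j + 1] @ [2, 1] @ [3..<i + 1]"
      using False by (simp add: root_letters.simps)
    moreover have "step (step 2 2) 1 = - 2" by (simp add: step_def)
    ultimately show ?thesis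
      using t False two run_ascend[of i] by simp
  qed
next
  case False
  then show ?thesis
    using assms run_descend[of "nat t" j] by (simp add: path_root_def root_letters.simps)
qed

text \<open>For \<open>j >= 3\<close> only the letter \<open>j\<close> leads out of
  \<open>j\<close>, and it occurs only at the head of the list. For \<open>j = 2\<close> both
  letters 1 and 2 lead out, but then the list is a single letter.\<close>

lemma root_letters_path_root:
  assumes "t \<noteq> 0" "\<bar>t\<bar> < int j"
  obtains as where "root_letters (path_root j t) = j # as \<or> j = 2 \<and> as = [] \<and> root_letters (path_root j t) = [1]"
    "\<forall>b\<in>set as. step (int j) b = 0"
proof (cases "j = 2")
  case True
  then have "t = 1 \<or> t = - 1" using assms by linarith
  then show ?thesis
    using that[of "[]"] True root_letters_plus_simple root_letters_minus_simple[of 2] by (auto simp: path_root_def)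
next
  case False
  have "2 \<le> j" using assms by linarith
  with False have "3 \<le> j" by simp
  have step: "step (int j) b = 0" if "b \<noteq> j" for b
    using that \<open>3 \<le> j\<close> by (simp add: step_def)
  show ?thesis
  proof (cases "path_root j t")
    case (EpsMinus j' i)
    then have "j' = j" "i < j" using assms by (auto simp: path_root_def split: if_splits)
    then show ?thesis
      using that[of "rev [i + 1..<j]"] EpsMinus step by (simp add: root_letters.simps)
  next
    case (EpsPlus j' i)
    then have "j' = j" "i < j" using assms by (auto simp: path_root_def split: if_splits)
    show ?thesis
    proof (cases "i = 1")
      case True
      show ?thesis
        by (rule that[of "rev [3..<j] @ [1]"])
          (use True EpsPlus \<open>j' = j\<close> \<open>3 \<le> j\<close> in \<open>auto simp: root_letters.simps intro!: step\<close>)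
    next
      case False
      show ?thesis
        by (rule that[of "rev [1..<j] @ [3..<i + 1]"])
          (use False EpsPlus \<open>j' = j\<close> \<open>i < j\<close> \<open>3 \<le> j\<close> in \<open>auto simp: root_letters.simps intro!: step\<close>)
    qed
  qed
qed

text \<open>In [x, f] = x f - f x, with \<open>f\<close> the generator of a later letter, the second
  product starts with a letter that kills \<open>s\<close>. So of all the words in the expanded
  bracket only the one in the given order contributes.\<close>

lemma lin_run_lbracket:
  assumes "g 0 = 0" "\<forall>b\<in>set as. step s b = 0"
  shows "lin (\<lambda>w. g (run s (letters w))) (lbracket (a # as)) = g (run s (a # as))"
  using assms
proof (induction as arbitrary: g rule: rev_induct)
  case Nil
  then show ?case by (simp add: gen_def)
next
  case (snoc b as)
  have "lbracket (a # as @ [b]) = lbracket (a # as) * gen b - gen b * lbracket (a # as)"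
    using lbracket_snoc[of "a # as" b] by (simp add: comm_def)
  moreover have "lin (\<lambda>w. g (step (run s (letters w)) b)) (lbracket (a # as)) = g (step (run s (a # as)) b)"
    using snoc.IH[of "\<lambda>t. g (step t b)"] snoc.prems by simp
  moreover have "lin (\<lambda>w. g (run (step s b) (letters w))) (lbracket (a # as)) = 0"
    using snoc.prems by (intro lin_eq_0) simp
  ultimately show ?case
    by (simp add: lin_diff gen_def lin_single_mult lin_mult_single plus_fword_def)
qed

lemma path_coeff_root_vector:
  assumes "t \<noteq> 0" "\<bar>t\<bar> < int j"
  shows "path_coeff (int j) t (root_vector (path_root j t)) = 1"
proof -
  obtain as where as: "root_letters (path_root j t) = j # as \<or> j = 2 \<and> as = [] \<and> root_letters (path_root j t) = [1]"
    "\<forall>b\<in>set as. step (int j) b = 0"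
    using root_letters_path_root[OF assms] .
  then obtain a where a: "root_letters (path_root j t) = a # as" by blast
  have "path_coeff (int j) t (lbracket (a # as)) = of_bool (run (int j) (a # as) = t)"
    unfolding path_coeff_def using assms(1) as(2)
    by (intro lin_run_lbracket[of "\<lambda>u. of_bool (u = t)"]) auto
  then show ?thesis
    using run_root_letters[OF assms] by (simp add: root_vector_eq a)
qed

lemma top_index_less: "root_less \<beta> \<gamma> \<Longrightarrow> top_index \<beta> \<le> top_index \<gamma>"
  by (cases \<beta>; cases \<gamma>) auto

lemma sorted_exponent_list: "sorted_wrt (\<lambda>\<beta> \<gamma>. top_index \<beta> \<le> top_index \<gamma>) (exponent_list r p)"
proof -
  have "sorted_wrt (\<lambda>\<beta> \<gamma>. top_index \<beta> \<le> top_index \<gamma>) (concat (map (\<lambda>\<beta>. replicate (p \<beta>) \<beta>) L))"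
    if "sorted_wrt root_less L" for L
    using that
  proof (induction L)
    case (Cons \<beta> L)
    have "sorted_wrt (\<lambda>\<beta> \<gamma>. top_index \<beta> \<le> top_index \<gamma>) (replicate n \<beta>)" for n
      by (induction n) auto
    then show ?case using Cons by (auto simp: sorted_wrt_append dest: top_index_less)
  qed simp
  then show ?thesis by (simp add: exponent_list_def sorted_root_list)
qed

lemma set_exponent_list: "set (exponent_list r p) \<subseteq> positive_roots r"
  by (auto simp: exponent_list_def set_root_list)

lemma path_coeff_pbw_monomial:
  assumes "t \<noteq> 0" "\<bar>t\<bar> < int j" "j \<le> r" "\<forall>\<beta>. \<beta> \<notin> positive_roots r \<longrightarrow> p \<beta> = 0"
  shows "path_coeff (int j) t (pbw_monomial r p) = of_bool (p = (\<lambda>\<gamma>. if \<gamma> = path_root j t then 1 else 0))"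
proof -
  let ?\<Gamma> = "exponent_list r p" and ?\<beta> = "path_root j t"
  have pos: "?\<beta> \<in> positive_roots r" using assms by (intro path_root_positive)
  have iff: "p = (\<lambda>\<gamma>. if \<gamma> = ?\<beta> then 1 else 0) \<longleftrightarrow> ?\<Gamma> = [?\<beta>]"
  proof
    assume p: "p = (\<lambda>\<gamma>. if \<gamma> = ?\<beta> then 1 else 0)"
    have "mset ?\<Gamma> = {#?\<beta>#}"
      by (rule multiset_eqI) (use pos in \<open>auto simp: count_exponent_list p\<close>)
    then show "?\<Gamma> = [?\<beta>]" by simp
  next
    assume \<Gamma>: "?\<Gamma> = [?\<beta>]"
    show "p = (\<lambda>\<gamma>. if \<gamma> = ?\<beta> then 1 else 0)"
    proof
      fix \<gamma>
      show "p \<gamma> = (if \<gamma> = ?\<beta> then 1 else 0)"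
        using count_exponent_list[of r p \<gamma>] assms(4) \<Gamma> by (auto split: if_splits)
    qed
  qed
  show ?thesis
  proof (cases "?\<Gamma> = [?\<beta>]")
    case True
    then show ?thesis
      unfolding iff using path_coeff_root_vector[OF assms(1,2)] by (simp add: pbw_monomial_eq)
  next
    case False
    have "run (int j) (letters w) \<noteq> t" if "w \<in> Poly_Mapping.keys (root_prod ?\<Gamma>)" for w
    proof -
      consider "?\<Gamma> = []" | \<gamma> where "?\<Gamma> = [\<gamma>]" | \<gamma> \<delta> \<Delta> where "?\<Gamma> = \<gamma> # \<delta> # \<Delta>"
        by (metis list.exhaust)
      then show ?thesis
      proof cases
        case 1
        then show ?thesis using that assms(2) by (auto simp: zero_fword_def)
      next
        case (2 \<gamma>)
        then have "\<gamma> \<in> positive_roots r" using set_exponent_list[of r p] by simp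
        moreover have "mset (letters w) = mset (root_letters \<gamma>)"
          using mset_keys_root_prod[OF that] 2 by simp
        ultimately show ?thesis
          using run_one_root[of \<gamma> r "letters w" t j] assms(1,2) 2 False by auto
      next
        case (3 \<gamma> \<delta> \<Delta>)
        then have "w \<in> Poly_Mapping.keys (root_vector \<gamma> * (root_vector \<delta> * root_prod \<Delta>))"
          using that by simp
        then obtain u w' where u: "w = u + w'" "u \<in> Poly_Mapping.keys (root_vector \<gamma>)"
          and "w' \<in> Poly_Mapping.keys (root_vector \<delta> * root_prod \<Delta>)"
          using keys_mult[of "root_vector \<gamma>"] by blast
        then obtain v z where v: "w' = v + z" "v \<in> Poly_Mapping.keys (root_vector \<delta>)"
          using keys_mult[of "root_vector \<delta>"] by blast
        have w: "letters w = letters u @ letters v @ letters z"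
          using u v by (simp add: plus_fword_def)
        show ?thesis
          unfolding w
        proof (rule run_two_roots)
          show "\<gamma> \<in> positive_roots r" "\<delta> \<in> positive_roots r" "top_index \<gamma> \<le> top_index \<delta>"
            using set_exponent_list[of r p] sorted_exponent_list[of r p] 3 by auto
        qed (use u v assms mset_keys_root_vector in auto)
      qed
    qed
    then show ?thesis
      unfolding iff using False by (simp add: pbw_monomial_eq path_coeff_def lin_eq_0)
  qed
qed

section \<open>The coefficients of the expansion\<close>

text \<open>The right-hand side does not involve the family, which proves uniqueness of this
  coefficient and makes the choice in \<open>omega\<close> harmless.\<close>

lemma pbw_expansion_coefficient:
  assumes "2 \<le> r" "t \<noteq> 0" "\<bar>t\<bar> < int j" "j \<le> r" "pbw_expansion r k \<omega>"
  shows "\<omega> (\<lambda>\<gamma>. if \<gamma> = path_root j t then 1 else 0) = path_coeff (int j) t (Omega r k)"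
proof -
  let ?\<delta> = "\<lambda>\<gamma>. if \<gamma> = path_root j t then 1 else 0 :: nat"
  let ?S = "\<Sum>p | \<omega> p \<noteq> 0. tensor (\<omega> p) (pbw_monomial r p)"
  from assms(5) have fin: "finite {p. \<omega> p \<noteq> 0}" and sub: "{p. \<omega> p \<noteq> 0} \<subseteq> pbw_exponents r k"
    and "Omega r k - ?S \<in> serre_tensor r"
    by (auto simp: pbw_expansion_def Omega_g_def id_tensor_qmap_eq_iff)
  from path_coeff_serre_tensor[OF assms(1,2) this(3), of "int j"]
  have "path_coeff (int j) t (Omega r k) = path_coeff (int j) t ?S"
    by (simp add: path_coeff_def lin_diff)
  also have "\<dots> = (\<Sum>p | \<omega> p \<noteq> 0. path_coeff (int j) t (tensor (\<omega> p) (pbw_monomial r p)))"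
    by (simp add: path_coeff_def lin_sum)
  also have "\<dots> = (\<Sum>p | \<omega> p \<noteq> 0. if p = ?\<delta> then \<omega> p else 0)"
  proof (rule sum.cong[OF refl])
    fix p assume "p \<in> {p. \<omega> p \<noteq> 0}"
    then have "\<forall>\<beta>. \<beta> \<notin> positive_roots r \<longrightarrow> p \<beta> = 0" using sub by (auto simp: pbw_exponents_def)
    from path_coeff_pbw_monomial[OF assms(2-4) this]
    show "path_coeff (int j) t (tensor (\<omega> p) (pbw_monomial r p)) = (if p = ?\<delta> then \<omega> p else 0)"
      by (simp add: path_coeff_tensor)
  qed
  also have "\<dots> = \<omega> ?\<delta>"
    using fin by (simp add: sum.delta)
  finally show ?thesis by simp
qed

subsection \<open>Existence of the expansion\<close>

text \<open>A finite index set takes the place of the support of the coefficients, since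
  coefficients may cancel when two expansions are added.\<close>

definition expandable :: "nat \<Rightarrow> (nat \<Rightarrow> nat) \<Rightarrow> (fword \<Rightarrow>\<^sub>0 ratfun) \<Rightarrow> bool" where
  "expandable r k X \<longleftrightarrow> (\<exists>A \<omega>. finite A \<and> A \<subseteq> pbw_exponents r k \<and>
     X - (\<Sum>p\<in>A. tensor (\<omega> p) (pbw_monomial r p)) \<in> serre_tensor r)"

lemma expandable_serre_tensor: "X \<in> serre_tensor r \<Longrightarrow> expandable r k X"
  unfolding expandable_def by (rule exI[of _ "{}"]) simp

lemma expandable_add:
  assumes "expandable r k X" "expandable r k Y"
  shows "expandable r k (X + Y)"
proof -
  from assms(1) obtain A \<omega> where A: "finite A" "A \<subseteq> pbw_exponents r k"
    "X - (\<Sum>p\<in>A. tensor (\<omega> p) (pbw_monomial r p)) \<in> serre_tensor r"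
    by (auto simp: expandable_def)
  from assms(2) obtain B \<psi> where B: "finite B" "B \<subseteq> pbw_exponents r k"
    "Y - (\<Sum>p\<in>B. tensor (\<psi> p) (pbw_monomial r p)) \<in> serre_tensor r"
    by (auto simp: expandable_def)
  define \<phi> where "\<phi> p = (if p \<in> A then \<omega> p else 0) + (if p \<in> B then \<psi> p else 0)" for p
  have ext: "(\<Sum>p\<in>A \<union> B. tensor (if p \<in> C then f p else 0) (pbw_monomial r p)) = (\<Sum>p\<in>C. tensor (f p) (pbw_monomial r p))"
    if "C \<subseteq> A \<union> B" for C and f :: "(root \<Rightarrow> nat) \<Rightarrow> ratfun"
    using that A B by (intro sum.mono_neutral_cong_right) auto
  have "(\<Sum>p\<in>A \<union> B. tensor (\<phi> p) (pbw_monomial r p))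
      = (\<Sum>p\<in>A. tensor (\<omega> p) (pbw_monomial r p)) + (\<Sum>p\<in>B. tensor (\<psi> p) (pbw_monomial r p))"
    by (simp add: \<phi>_def tensor_add_left sum.distrib ext)
  then have "X + Y - (\<Sum>p\<in>A \<union> B. tensor (\<phi> p) (pbw_monomial r p)) \<in> serre_tensor r"
    using serre_tensor_add[OF A(3) B(3)] by (simp add: algebra_simps)
  then show ?thesis
    unfolding expandable_def using A(1,2) B(1,2) by (intro exI[of _ "A \<union> B"] exI[of _ \<phi>]) simp
qed

lemma expandable_sum: "(\<And>x. x \<in> A \<Longrightarrow> expandable r k (f x)) \<Longrightarrow> expandable r k (sum f A)"
  by (induction A rule: infinite_finite_induct)
    (simp_all add: expandable_add expandable_serre_tensor serre_tensor.zero)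

lemma set_list_letters:
  assumes "set \<Gamma> \<subseteq> positive_roots r"
  shows "set_mset (list_letters \<Gamma>) \<subseteq> {1..r}"
  using assms
proof (induction \<Gamma>)
  case (Cons \<beta> \<Gamma>)
  then show ?case using set_root_letters[of \<beta> r] by simp
qed simp

lemma pbw_monomial_multideg:
  assumes "\<forall>i\<in>{1..r}. count (list_letters (exponent_list r p)) i = k i"
  shows "pbw_monomial r p \<in> multideg_part r k"
proof -
  have "mset (letters w) = list_letters (exponent_list r p)" if "w \<in> Poly_Mapping.keys (pbw_monomial r p)" for w
    using that mset_keys_root_prod by (simp add: pbw_monomial_eq)
  moreover from this have "set (letters w) \<subseteq> {1..r}" if "w \<in> Poly_Mapping.keys (pbw_monomial r p)" for w
    using that set_list_letters[OF set_exponent_list, of r p] by (metis set_mset_mset)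
  ultimately show ?thesis
    using assms by (auto simp: multideg_part_def free_alg_def simp flip: count_mset)
qed

text \<open>A null element may contain letters outside \<open>1..r\<close>; only its erased part is
  known to lie in \<open>serre_ideal\<close>, hence the \<open>kill\<close> under the
  tensor.\<close>

lemma pbw_span_expandable:
  assumes "x \<in> pbw_span r M" "\<forall>i\<in>{1..r}. count M i = k i"
  shows "expandable r k (tensor a (kill r x))"
  using assms(1) unfolding pbw_span_def
proof (induction arbitrary: a rule: lspan.induct)
  case (null x)
  then show ?case by (intro expandable_serre_tensor serre_tensor_tensor) (simp add: null_def)
next
  case (base g)
  then obtain p where p: "g = pbw_monomial r p" "\<forall>\<beta>. \<beta> \<notin> positive_roots r \<longrightarrow> p \<beta> = 0"
    "list_letters (exponent_list r p) = M"
    by blast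
  have g: "g \<in> multideg_part r k"
    using pbw_monomial_multideg[of r p k] p assms(2) by simp
  then have "p \<in> pbw_exponents r k"
    using p by (auto simp: pbw_exponents_def)
  moreover have "kill r g = g"
    using g by (intro kill_id) (simp add: multideg_part_def)
  ultimately show ?case
    unfolding expandable_def using p(1)
    by (intro exI[of _ "{p}"] exI[of _ "\<lambda>_. a"]) (simp add: serre_tensor.zero)
next
  case (add x y)
  then show ?case by (simp add: kill_add tensor_add expandable_add)
next
  case (scale x c)
  moreover have "kill r (Poly_Mapping.single 0 c) = Poly_Mapping.single 0 c"
    by (simp add: kill_single) (simp add: zero_fword_def)
  ultimately show ?case by (simp add: kill_mult tensor_scale)
qed

text \<open>The labellings \<open>J\<close> as lists of their values in the order 1, 2, ...; the
  monomial of a labelling is the reversed list.\<close>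

definition words :: "nat \<Rightarrow> (nat \<Rightarrow> nat) \<Rightarrow> nat list set" where
  "words r k = {v. set v \<subseteq> {1..r} \<and> (\<forall>i\<in>{1..r}. count_list v i = k i)}"

lemma word_expandable:
  assumes "2 \<le> r" "v \<in> words r k"
  shows "expandable r k (Poly_Mapping.single (Word (rev v)) a)"
proof -
  have "expandable r k (tensor a (kill r (Poly_Mapping.single (Word (rev v)) 1)))"
    using assms by (intro pbw_span_expandable[OF word_in_pbw_span]) (auto simp: words_def count_mset)
  then show ?thesis
    using assms by (simp add: kill_single tensor_single words_def)
qed

text \<open>For the prefix of length \<open>u\<close> of a labelling this is the variable that the
  labelling assigns to position \<open>u\<close>: the number of occurrences of the last letter is
  its rank in the fibre. The empty prefix gives the convention that the variable at position 0 is
  0.\<close>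

definition last_var :: "nat list \<Rightarrow> ratfun" where
  "last_var v = (if v = [] then 0 else tvar (last v) (count_list v (last v)))"

definition path_fraction :: "nat list \<Rightarrow> ratfun" where
  "path_fraction v = (\<Prod>u=1..length v. 1 / (last_var (take u v) - last_var (take (u - 1) v)))"

lemma count_map_upt: "count_list (map J [1..<n + 1]) i = card {u \<in> {1..n}. J u = i}" for J :: "nat \<Rightarrow> nat"
proof -
  have "count_list (map J xs) i = length (filter (\<lambda>u. J u = i) xs)" for xs
    by (induction xs) auto
  then have "count_list (map J [1..<n + 1]) i = card ({u. J u = i} \<inter> set [1..<n + 1])"
    using distinct_length_filter[of "[1..<n + 1]" "\<lambda>u. J u = i"] by simp
  also have "{u. J u = i} \<inter> set [1..<n + 1] = {u \<in> {1..n}. J u = i}" by auto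
  finally show ?thesis .
qed

lemma bij_labellings: "bij_betw (\<lambda>J. map J [1..<total r k + 1]) (labellings r k) (words r k)"
proof -
  let ?n = "total r k"
  let ?f = "\<lambda>J. map J [1..<?n + 1]"
  have "inj_on ?f (labellings r k)"
  proof (rule inj_onI)
    fix J K assume J: "J \<in> labellings r k" and K: "K \<in> labellings r k" and "?f J = ?f K"
    then have eq: "\<forall>u\<in>{1..?n}. J u = K u" by auto
    show "J = K"
    proof
      fix u show "J u = K u"
      proof (cases "u \<in> {1..?n}")
        case False
        have "J \<in> {1..?n} \<rightarrow>\<^sub>E {1..r}" "K \<in> {1..?n} \<rightarrow>\<^sub>E {1..r}"
          using J K by (simp_all add: labellings_def)
        from this[THEN PiE_arb, OF False] show ?thesis by simp
      qed (use eq in blast)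
    qed
  qed
  moreover have "?f J \<in> words r k" if "J \<in> labellings r k" for J
  proof -
    have J: "J \<in> {1..?n} \<rightarrow>\<^sub>E {1..r}" "\<forall>i\<in>{1..r}. card {u \<in> {1..?n}. J u = i} = k i"
      using that by (simp_all add: labellings_def)
    have "set [1..<?n + 1] = {1..?n}" by auto
    then have "set (?f J) \<subseteq> {1..r}"
      using PiE_mem[OF J(1)] by (simp only: set_map image_subset_iff) blast
    then show ?thesis
      using J(2) unfolding words_def by (intro CollectI conjI) (simp_all only: count_map_upt)
  qed
  moreover have "v \<in> ?f ` labellings r k" if v: "v \<in> words r k" for v
  proof -
    have "length v = (\<Sum>i=1..r. count_list v i)"
      using v sum_count_set[of v "{1..r}"] by (simp add: words_def)
    also have "\<dots> = ?n"
      using v by (simp add: words_def total_def)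
    finally have len: "length v = ?n" .
    define J where "J = (\<lambda>u\<in>{1..?n}. v ! (u - 1))"
    have fJ: "?f J = v"
      by (rule nth_equalityI) (auto simp: J_def len nth_upt simp del: upt_Suc)
    moreover have "J \<in> labellings r k"
      unfolding labellings_def
    proof (intro CollectI conjI ballI)
      have "v ! (u - 1) \<in> {1..r}" if "u \<in> {1..?n}" for u
      proof -
        have "v ! (u - 1) \<in> set v" using that len by (intro nth_mem) auto
        then show ?thesis using v by (auto simp: words_def)
      qed
      then show "J \<in> {1..?n} \<rightarrow>\<^sub>E {1..r}" by (auto simp: J_def)
      show "card {u \<in> {1..?n}. J u = i} = k i" if "i \<in> {1..r}" for i
        using v that unfolding count_map_upt[symmetric] fJ by (simp add: words_def)
    qed
    ultimately show ?thesis by force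
  qed
  ultimately show ?thesis by (auto simp: bij_betw_def)
qed

lemma label_var_eq: "label_var J u = last_var (map J [1..<u + 1])"
proof (cases u)
  case (Suc n)
  then show ?thesis
    using count_map_upt[of J u "J u"] by (simp add: label_var_def last_var_def)
qed (simp add: label_var_def last_var_def)

lemma Omega_eq: "Omega r k = (\<Sum>v\<in>words r k. Poly_Mapping.single (Word (rev v)) (Sym r k (path_fraction v)))"
proof -
  have word: "label_word n J = Poly_Mapping.single (Word (rev (map J [1..<n + 1]))) 1" for n J
  proof -
    have "prod_list (map (\<lambda>u. gen (J u)) xs) = Poly_Mapping.single (Word (map J xs)) 1" for xs
      by (induction xs) (simp_all add: gen_def mult_single plus_fword_def zero_fword_def flip: single_one)
    then show ?thesis unfolding label_word_def rev_map .
  qed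
  have frac: "(\<Prod>u=1..n. 1 / (label_var J u - label_var J (u - 1))) = path_fraction (map J [1..<n + 1])" for n J
  proof -
    have "take u (map J [1..<n + 1]) = map J [1..<u + 1]" if "u \<le> n" for u
      using that by (simp add: take_map take_upt del: upt_Suc)
    note take = this
    show ?thesis
      unfolding path_fraction_def label_var_eq
    proof (rule prod.cong)
      fix u assume "u \<in> {1..length (map J [1..<n + 1])}"
      then have "u \<le> n" "u - 1 \<le> n" by (auto split: if_splits)
      then show "1 / (last_var (map J [1..<u + 1]) - last_var (map J [1..<u - 1 + 1])) =
        1 / (last_var (take u (map J [1..<n + 1])) - last_var (take (u - 1) (map J [1..<n + 1])))"
        by (simp only: take)
    qed simp
  qed
  show ?thesis
    unfolding Omega_def word frac tensor_single
    by (rule sum.reindex_bij_betw[OF bij_labellings])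
qed

text \<open>Spanning gives an expansion, so the family chosen in \<open>omega\<close> is one, and
  the functional reads off its coefficient. The words enter reversed because the monomial of a
  labelling is written from its last label to its first.\<close>

lemma eta_path_root:
  assumes "2 \<le> r" "t \<noteq> 0" "\<bar>t\<bar> < int j" "j \<le> r" "k = root_content (path_root j t)"
  shows "eta r (path_root j t) = (\<Sum>v | v \<in> words r k \<and> run (int j) (rev v) = t. Sym r k (path_fraction v))"
proof -
  have "expandable r k (Omega r k)"
    unfolding Omega_eq using assms(1) by (intro expandable_sum word_expandable)
  then obtain A \<psi> where A: "finite A" "A \<subseteq> pbw_exponents r k"
    "Omega r k - (\<Sum>p\<in>A. tensor (\<psi> p) (pbw_monomial r p)) \<in> serre_tensor r"
    by (auto simp: expandable_def)
  define \<omega> where "\<omega> p = (if p \<in> A then \<psi> p else 0)" for p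
  have "{p. \<omega> p \<noteq> 0} \<subseteq> A" by (auto simp: \<omega>_def)
  moreover from this have "(\<Sum>p | \<omega> p \<noteq> 0. tensor (\<omega> p) (pbw_monomial r p)) = (\<Sum>p\<in>A. tensor (\<psi> p) (pbw_monomial r p))"
    using A(1) by (intro sum.mono_neutral_cong_left) (auto simp: \<omega>_def)
  ultimately have "pbw_expansion r k \<omega>"
    using A unfolding pbw_expansion_def Omega_g_def id_tensor_qmap_eq_iff
    by (auto intro: finite_subset)
  then have "pbw_expansion r k (omega r k)"
    unfolding omega_def by (rule someI[where P = "pbw_expansion r k"])
  from pbw_expansion_coefficient[OF assms(1-4) this]
  have "eta r (path_root j t) = path_coeff (int j) t (Omega r k)"
    by (simp add: eta_def assms(5))
  also have "\<dots> = (\<Sum>v\<in>words r k. Sym r k (path_fraction v) * of_bool (run (int j) (rev v) = t))"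
    by (simp add: Omega_eq path_coeff_def lin_sum)
  also have "\<dots> = (\<Sum>v | v \<in> words r k \<and> run (int j) (rev v) = t. Sym r k (path_fraction v))"
  proof (rule sum.mono_neutral_cong_right)
    have "finite (labellings r k)"
      unfolding labellings_def by (rule finite_subset[of _ "{1..total r k} \<rightarrow>\<^sub>E {1..r}"]) (auto intro: finite_PiE)
    then show "finite (words r k)" using bij_betw_finite[OF bij_labellings] by blast
  qed auto
  finally show ?thesis .
qed

subsection \<open>The words of the paths\<close>

lemma words_rev_root_letters:
  assumes "\<beta> \<in> positive_roots r" "mset ws = mset (root_letters \<beta>)"
  shows "rev ws \<in> words r (root_content \<beta>)"
proof -
  have count: "count (mset (root_letters \<beta>)) i = root_content \<beta> i" for i
    using assms(1) by (cases \<beta>) (auto simp: root_letters.simps)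
  have "set ws \<subseteq> {1..r}"
    using set_root_letters[OF assms(1)] assms(2) by (metis set_mset_mset)
  moreover have "count_list (rev ws) i = root_content \<beta> i" for i
    using count[of i] assms(2) by (metis count_mset mset_rev)
  ultimately show ?thesis by (simp add: words_def)
qed

text \<open>The letter 1 leads from positive to negative weights, from which no path returns; the
  remaining letters only count down.\<close>

lemma run_pos_pos:
  assumes "run (int s) ws = int x" "1 \<le> x"
  shows "x \<le> s \<and> ws = rev [x + 1..<s + 1]"
  using assms(1)
proof (induction ws arbitrary: s)
  case (Cons b ws)
  have ne: "step (int s) b \<noteq> 0" using Cons.prems assms(2) by (intro notI) simp
  have "b \<noteq> 1"
  proof
    assume "b = 1"
    then have "step (int s) b < 0" using ne by (auto simp: step_def split: if_splits)
    moreover have "run (step (int s) b) ws \<le> step (int s) b"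
      using Cons.prems assms(2) by (intro run_le) simp
    ultimately show False using Cons.prems assms(2) by simp
  qed
  then have "b = s" "2 \<le> s" "step (int s) b = int (s - 1)"
    using ne by (auto simp: step_def split: if_splits)
  moreover from this have IH: "x \<le> s - 1 \<and> ws = rev [x + 1..<s - 1 + 1]"
    using Cons.prems by (intro Cons.IH) simp
  ultimately have "x + 1 \<le> s" by linarith
  then show ?case using IH \<open>b = s\<close> by simp
qed simp

lemma run_neg_neg:
  assumes "run (- int s) ws = - int x" "2 \<le> s" "1 \<le> x"
  shows "s \<le> x \<and> ws = [s + 1..<x + 1]"
  using assms
proof (induction ws arbitrary: s)
  case (Cons b ws)
  have ne: "step (- int s) b \<noteq> 0" using Cons.prems by (intro notI) simp
  then have "b = s + 1" "step (- int s) b = - int (s + 1)"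
    using Cons.prems(2) by (auto simp: step_def split: if_splits)
  then show ?case using Cons.IH[of "s + 1"] Cons.prems by (simp add: upt_conv_Cons)
qed simp

lemma run_minus_one:
  assumes "run (- 1) ws = - int x" "1 \<le> x"
  shows "x = 1 \<and> ws = [] \<or> 2 \<le> x \<and> ws = 2 # [3..<x + 1]"
proof (cases ws)
  case (Cons b us)
  have "step (- 1) b \<noteq> 0" using assms Cons by (intro notI) simp
  then have b: "b = 2" "step (- 1) b = - int 2" by (auto simp: step_def split: if_splits)
  then have "run (- int 2) us = - int x" using assms Cons by simp
  from run_neg_neg[OF this] show ?thesis using assms(2) b Cons by simp
qed (use assms in simp)

lemma run_one:
  assumes "run 1 ws = - int x" "1 \<le> x"
  shows "2 \<le> x \<and> ws = 1 # [3..<x + 1]"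
proof (cases ws)
  case (Cons b us)
  have "step 1 b \<noteq> 0" using assms Cons by (intro notI) simp
  then have b: "b = 1" "step 1 b = - int 2" by (auto simp: step_def split: if_splits)
  then have "run (- int 2) us = - int x" using assms Cons by simp
  from run_neg_neg[OF this] show ?thesis using assms(2) b Cons by simp
qed (use assms in simp)

text \<open>Down to 2 each weight has a single outgoing letter. At 2 the path chooses between the
  letters 1 and 2; it may end at -1, and otherwise both routes meet at -2, after which the letters
  are forced again.\<close>

lemma run_pos_neg:
  assumes "run (int s) ws = - int x" "2 \<le> s" "1 \<le> x"
  shows "x = 1 \<and> ws = rev [3..<s + 1] @ [1] \<or>
    2 \<le> x \<and> (ws = rev [3..<s + 1] @ [1, 2] @ [3..<x + 1] \<or> ws = rev [3..<s + 1] @ [2, 1] @ [3..<x + 1])"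
  using assms(1,2)
proof (induction ws arbitrary: s)
  case (Cons b ws)
  have ne: "step (int s) b \<noteq> 0" using Cons.prems assms(3) by (intro notI) simp
  show ?case
  proof (cases "s = 2")
    case True
    with ne consider "b = 1" "step (int s) b = - 1" | "b = 2" "step (int s) b = 1"
      by (auto simp: step_def split: if_splits)
    then show ?thesis
    proof cases
      case 1
      then show ?thesis using run_minus_one[of ws x] Cons.prems assms(3) True by auto
    next
      case 2
      then show ?thesis using run_one[of ws x] Cons.prems assms(3) True by auto
    qed
  next
    case False
    then have b: "b = s" "step (int s) b = int (s - 1)" and s: "2 \<le> s - 1"
      using ne Cons.prems(2) by (auto simp: step_def split: if_splits)
    have "rev [3..<s + 1] = s # rev [3..<s - 1 + 1]"
      using s by simp
    then show ?thesis using Cons.IH[of "s - 1"] Cons.prems b s by simp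
  qed
qed (use assms in simp)

lemma eta_single_path:
  assumes "2 \<le> r" "t \<noteq> 0" "\<bar>t\<bar> < int j" "j \<le> r" "k = root_content (path_root j t)"
    and "\<And>ws. run (int j) ws = t \<Longrightarrow> ws = root_letters (path_root j t)"
  shows "eta r (path_root j t) = Sym r k (path_fraction (rev (root_letters (path_root j t))))"
proof -
  let ?v = "rev (root_letters (path_root j t))"
  have "{v. v \<in> words r k \<and> run (int j) (rev v) = t} = {?v}"
  proof (intro equalityI subsetI)
    fix v assume "v \<in> {v. v \<in> words r k \<and> run (int j) (rev v) = t}"
    then have "rev v = root_letters (path_root j t)" using assms(6) by blast
    then have "v = ?v" using rev_rev_ident[of v] by metis
    then show "v \<in> {?v}" by simp
  next
    fix v assume "v \<in> {?v}"
    then show "v \<in> {v. v \<in> words r k \<and> run (int j) (rev v) = t}"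
      using run_root_letters[OF assms(2,3)] words_rev_root_letters[OF path_root_positive[OF assms(2-4)] refl]
      by (simp add: assms(5))
  qed
  then show ?thesis using eta_path_root[OF assms(1-5)] by simp
qed

lemma eta_two_paths:
  assumes "2 \<le> i" "i < j" "j \<le> r" "k = root_content (EpsPlus j i)"
  shows "eta r (EpsPlus j i) =
    Sym r k (path_fraction (rev [3..<i + 1] @ [1, 2] @ [3..<j + 1]))
    + Sym r k (path_fraction (rev [3..<i + 1] @ [2, 1] @ [3..<j + 1]))"
proof -
  let ?v = "\<lambda>xs. rev [3..<i + 1] @ xs @ [3..<j + 1]"
  have root: "path_root j (- int i) = EpsPlus j i" using assms by (simp add: path_root_def)
  have "[1..<j + 1] = [1, 2] @ [3..<j + 1]"
    using assms by (simp add: upt_conv_Cons eval_nat_numeral)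
  then have letters: "root_letters (EpsPlus j i) = rev (?v [1, 2])"
    using assms by (simp add: root_letters.simps)
  have "{v. v \<in> words r k \<and> run (int j) (rev v) = - int i} = {?v [1, 2], ?v [2, 1]}"
  proof (intro equalityI subsetI)
    fix v assume "v \<in> {v. v \<in> words r k \<and> run (int j) (rev v) = - int i}"
    then have "rev v = rev [3..<j + 1] @ [1, 2] @ [3..<i + 1] \<or> rev v = rev [3..<j + 1] @ [2, 1] @ [3..<i + 1]"
      using run_pos_neg[of j "rev v" i] assms by auto
    then show "v \<in> {?v [1, 2], ?v [2, 1]}"
      by (elim disjE) (simp_all add: rev_eq_append_conv)
  next
    fix v assume v: "v \<in> {?v [1, 2], ?v [2, 1]}"
    have pos: "EpsPlus j i \<in> positive_roots r" using assms by simp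
    have "mset (rev v) = mset (root_letters (EpsPlus j i))" using v unfolding letters by auto
    from words_rev_root_letters[OF pos this] have "v \<in> words r k" by (simp add: assms(4))
    moreover have "run (int j) (rev v) = - int i"
    proof -
      have "run (int j) (rev [3..<j + 1]) = 2" using run_descend[of 2 j] assms by simp
      moreover have "step (step 2 2) 1 = - 2" "step (step 2 1) 2 = - 2" by (simp_all add: step_def)
      ultimately show ?thesis using v run_ascend[of i] assms by auto
    qed
    ultimately show "v \<in> {v. v \<in> words r k \<and> run (int j) (rev v) = - int i}" by simp
  qed
  then show ?thesis
    using eta_path_root[of r "- int i" j k] assms by (simp add: root)
qed

section \<open>Symmetrization\<close>

lemma rename_mono_comp: "rename_mono \<sigma> (rename_mono \<tau> m) = rename_mono (\<sigma> \<circ> \<tau>) m"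
  by (induction m rule: poly_mapping_induct_add) (simp_all add: rename_mono_add)

lemma rename_poly_comp: "rename_poly \<sigma> (rename_poly \<tau> P) = rename_poly (\<sigma> \<circ> \<tau>) P"
  by (induction P rule: poly_mapping_induct_add) (simp_all add: rename_poly_add rename_mono_comp o_def)

lemma rename_comp:
  assumes "inj \<sigma>" "inj \<tau>"
  shows "rename \<sigma> (rename \<tau> x) = rename (\<sigma> \<circ> \<tau>) x"
  by (cases x) (simp add: assms rename_Fract rename_poly_eq_0_iff inj_compose rename_poly_comp)

lemma rename_mono_id: "rename_mono (\<lambda>v. v) m = m"
  by (induction m rule: poly_mapping_induct_add) (simp_all add: rename_mono_add)

lemma rename_poly_id: "rename_poly (\<lambda>v. v) P = P"
  by (induction P rule: poly_mapping_induct_add) (simp_all add: rename_poly_add rename_mono_id)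

lemma rename_id: "rename (\<lambda>v. v) x = x"
  by (cases x) (simp add: rename_Fract rename_poly_id)

lemma rename_one: "inj \<sigma> \<Longrightarrow> rename \<sigma> 1 = 1"
  using rename_scalar[of \<sigma> 1] by simp

lemma rename_zero: "inj \<sigma> \<Longrightarrow> rename \<sigma> 0 = 0"
  using rename_scalar[of \<sigma> 0] by simp

lemma rename_diff: "inj \<sigma> \<Longrightarrow> rename \<sigma> (x - y) = rename \<sigma> x - rename \<sigma> y"
  using rename_add[of \<sigma> "x - y" y] by (simp add: algebra_simps)

lemma rename_divide:
  assumes "inj \<sigma>"
  shows "rename \<sigma> (x / y) = rename \<sigma> x / rename \<sigma> y"
proof (cases "y = 0")
  case False
  then have "rename \<sigma> y * rename \<sigma> (inverse y) = 1"
    using rename_mult[OF assms, of y "inverse y"] rename_one[OF assms] by simp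
  then have "rename \<sigma> (inverse y) = inverse (rename \<sigma> y)"
    by (simp add: inverse_unique)
  then show ?thesis by (simp add: divide_inverse rename_mult[OF assms])
qed (simp add: rename_zero[OF assms])

lemma rename_prod: "inj \<sigma> \<Longrightarrow> rename \<sigma> (prod f A) = (\<Prod>a\<in>A. rename \<sigma> (f a))"
  by (induction A rule: infinite_finite_induct) (simp_all add: rename_one rename_mult)

lemma perm_group_inj: "\<sigma> \<in> perm_group r k \<Longrightarrow> inj \<sigma>"
  by (auto simp: perm_group_def intro: permutes_inj)

lemma perm_group_comp:
  assumes "\<sigma> \<in> perm_group r k" "\<tau> \<in> perm_group r k"
  shows "\<sigma> \<circ> \<tau> \<in> perm_group r k"
proof -
  have "fst ((\<sigma> \<circ> \<tau>) v) = fst v" for v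
    using assms unfolding perm_group_def o_apply by (metis (mono_tags, lifting) mem_Collect_eq)
  then show ?thesis
    using assms by (simp add: perm_group_def permutes_compose)
qed

lemma perm_group_inv:
  assumes "\<tau> \<in> perm_group r k"
  shows "inv_into UNIV \<tau> \<in> perm_group r k"
proof -
  have \<tau>: "\<tau> permutes variables r k" "\<And>v. fst (\<tau> v) = fst v" using assms by (auto simp: perm_group_def)
  have "fst (inv_into UNIV \<tau> v) = fst v" for v
    using \<tau>(2)[of "inv_into UNIV \<tau> v"] permutes_inverses(1)[OF \<tau>(1), of v] by simp
  then show ?thesis using permutes_inv[OF \<tau>(1)] by (simp add: perm_group_def)
qed

text \<open>Composition with an element of the group permutes the summands. This allows the
  variables to be renumbered under the symmetrization.\<close>

lemma Sym_rename:
  assumes "\<tau> \<in> perm_group r k"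
  shows "Sym r k (rename \<tau> x) = Sym r k x"
proof -
  have \<tau>: "\<tau> permutes variables r k" using assms by (auto simp: perm_group_def)
  have "Sym r k (rename \<tau> x) = (\<Sum>\<sigma>\<in>perm_group r k. rename (\<sigma> \<circ> \<tau>) x)"
    unfolding Sym_def using assms by (intro sum.cong) (auto simp: rename_comp perm_group_inj)
  also have "\<dots> = Sym r k x"
    unfolding Sym_def
    by (rule sum.reindex_bij_witness[where i = "\<lambda>\<sigma>. \<sigma> \<circ> inv_into UNIV \<tau>" and j = "\<lambda>\<sigma>. \<sigma> \<circ> \<tau>"])
      (use assms permutes_inv_o[OF \<tau>] in \<open>auto simp: perm_group_comp perm_group_inv comp_assoc\<close>)
  finally show ?thesis .
qed

lemma Sym_add: "Sym r k (x + y) = Sym r k x + Sym r k y"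
  unfolding Sym_def sum.distrib[symmetric]
  by (intro sum.cong) (auto simp: rename_add perm_group_inj)

lemma Sym_trivial:
  assumes "\<And>i. k i \<le> 1"
  shows "Sym r k x = x"
proof -
  have "perm_group r k = {id}"
  proof (intro equalityI subsetI)
    fix \<sigma> assume "\<sigma> \<in> perm_group r k"
    then have \<sigma>: "\<sigma> permutes variables r k" "\<And>v. fst (\<sigma> v) = fst v" by (auto simp: perm_group_def)
    have "\<sigma> v = v" for v
    proof (cases "v \<in> variables r k")
      case True
      have one: "snd w = 1" if "w \<in> variables r k" for w
        using that assms[of "fst w"] by (auto simp: variables_def)
      have "\<sigma> v \<in> variables r k" using True \<sigma>(1) by (simp add: permutes_in_image)
      then show ?thesis using \<sigma>(2) one True by (simp add: prod_eq_iff)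
    next
      case False
      then show ?thesis using \<sigma>(1) by (simp add: permutes_not_in)
    qed
    then show "\<sigma> \<in> {id}" by auto
  next
    fix \<sigma> :: "nat \<times> nat \<Rightarrow> nat \<times> nat" assume "\<sigma> \<in> {id}"
    then show "\<sigma> \<in> perm_group r k" by (simp add: perm_group_def permutes_id)
  qed
  then show ?thesis by (simp add: Sym_def rename_id id_def)
qed

text \<open>The upper indices \<open>3..i\<close> are those which occur twice in the content of
  \<open>EpsPlus j i\<close>; \<open>3 - snd v\<close> exchanges the lower indices 1 and 2.\<close>

definition swap_var :: "nat \<Rightarrow> nat \<times> nat \<Rightarrow> nat \<times> nat" where
  "swap_var i v = (if fst v \<in> {3..i} \<and> snd v \<in> {1, 2} then (fst v, 3 - snd v) else v)"

lemma swap_var_perm_group: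
  assumes "\<And>m. m \<in> {3..i} \<Longrightarrow> k m = 2" "i \<le> r"
  shows "swap_var i \<in> perm_group r k"
proof -
  have invol: "swap_var i (swap_var i v) = v" for v
    by (auto simp: swap_var_def prod_eq_iff)
  have "swap_var i v = v" if "v \<notin> variables r k" for v
  proof (rule ccontr)
    assume "swap_var i v \<noteq> v"
    then have "fst v \<in> {3..i}" "snd v \<in> {1, 2}" by (auto simp: swap_var_def split: if_splits)
    then have "v \<in> variables r k"
      using assms(1)[of "fst v"] assms(2) by (cases v) (auto simp: variables_def)
    with that show False by simp
  qed
  moreover have "\<exists>!w. swap_var i w = v" for v
    by (rule ex1I[of _ "swap_var i v"]) (use invol in auto)
  ultimately show ?thesis
    by (auto simp: perm_group_def permutes_def) (auto simp: swap_var_def)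
qed

lemma inj_swap_var: "inj (swap_var i)"
proof (rule injI)
  have invol: "swap_var i (swap_var i v) = v" for v
    by (auto simp: swap_var_def prod_eq_iff)
  show "swap_var i v = swap_var i w \<Longrightarrow> v = w" for v w by (metis invol)
qed

lemma tvar_eq_iff [simp]: "tvar i j = tvar i' j' \<longleftrightarrow> i = i' \<and> j = j'"
proof
  assume "tvar i j = tvar i' j'"
  then have "Poly_Mapping.single (Poly_Mapping.single (i, j) 1) (1 :: complex)
      = Poly_Mapping.single (Poly_Mapping.single (i', j') (1 :: nat)) 1"
    by (simp add: tvar_def eq_fract)
  then have "Poly_Mapping.single (i, j) (1 :: nat) = Poly_Mapping.single (i', j') 1"
    by (metis lookup_single_eq lookup_single_not_eq zero_neq_one)
  then show "i = i' \<and> j = j'"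
    by (metis lookup_single_eq lookup_single_not_eq zero_neq_one prod.inject)
qed simp

lemma tvar_neq_0 [simp]: "tvar i j \<noteq> 0"
proof
  assume "tvar i j = 0"
  then have "Poly_Mapping.single (Poly_Mapping.single (i, j) (1 :: nat)) (1 :: complex) = 0"
    by (simp add: tvar_def Zero_fract_def eq_fract)
  then show False by (metis lookup_single_eq lookup_zero zero_neq_one)
qed

section \<open>The fractions of the paths\<close>

lemma path_fraction_Nil [simp]: "path_fraction [] = 1"
  by (simp add: path_fraction_def)

lemma last_var_Nil [simp]: "last_var [] = 0"
  by (simp add: last_var_def)

lemma last_var_snoc [simp]: "last_var (v @ [a]) = tvar a (Suc (count_list v a))"
  by (simp add: last_var_def)

lemma path_fraction_snoc:
  "path_fraction (v @ [a]) = path_fraction v / (tvar a (Suc (count_list v a)) - last_var v)"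
proof -
  have "(\<Prod>u=1..length v. 1 / (last_var (take u (v @ [a])) - last_var (take (u - 1) (v @ [a]))))
      = path_fraction v"
    unfolding path_fraction_def by (rule prod.cong) auto
  then show ?thesis by (simp add: path_fraction_def[of "v @ [a]"])
qed

text \<open>\<open>d u\<close> is the lower index that the letter \<open>u\<close> receives: it
  counts the occurrences in \<open>v\<close> plus the one in the ascending run.\<close>

lemma path_fraction_ascend:
  assumes "a \<le> b" "\<forall>u\<in>{a..b}. d u = Suc (count_list v u)"
  shows "path_fraction (v @ [a..<b + 1]) =
      path_fraction v / ((tvar a (d a) - last_var v) * (\<Prod>u=a+1..b. tvar u (d u) - tvar (u - 1) (d (u - 1))))
    \<and> last_var (v @ [a..<b + 1]) = tvar b (d b)"
  using assms
proof (induction b rule: dec_induct)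
  case base
  then show ?case by (simp add: path_fraction_snoc)
next
  case (step b)
  have snoc: "v @ [a..<Suc b + 1] = (v @ [a..<b + 1]) @ [Suc b]"
    using step by simp
  have count: "Suc (count_list (v @ [a..<b + 1]) (Suc b)) = d (Suc b)"
    using step by (simp add: count_list_0_iff)
  have IH: "path_fraction (v @ [a..<b + 1]) =
      path_fraction v / ((tvar a (d a) - last_var v) * (\<Prod>u=a+1..b. tvar u (d u) - tvar (u - 1) (d (u - 1))))"
    "last_var (v @ [a..<b + 1]) = tvar b (d b)"
    using step by auto
  have "(\<Prod>u=a+1..Suc b. tvar u (d u) - tvar (u - 1) (d (u - 1)))
      = (\<Prod>u=a+1..b. tvar u (d u) - tvar (u - 1) (d (u - 1))) * (tvar (Suc b) (d (Suc b)) - tvar b (d b))"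
    using step by (simp add: prod.nat_ivl_Suc' mult.commute)
  then show ?case
    unfolding snoc path_fraction_snoc last_var_snoc count IH by (simp add: mult.assoc)
qed

lemma path_fraction_descend:
  assumes "m \<le> i"
  shows "path_fraction (rev [m..<i + 1]) = 1 / (tvar i 1 * (\<Prod>u=m..<i. tvar u 1 - tvar (u + 1) 1))
    \<and> last_var (rev [m..<i + 1]) = tvar m 1"
  using assms
proof (induction m rule: inc_induct)
  case base
  show ?case using path_fraction_snoc[of "[]" i] last_var_snoc[of "[]" i] by simp
next
  case (step m)
  have snoc: "rev [m..<i + 1] = rev [Suc m..<i + 1] @ [m]"
    using step by (intro rev_upt_rec) simp
  have count: "Suc (count_list (rev [Suc m..<i + 1]) m) = 1"
    by (simp add: count_list_0_iff)
  have IH: "path_fraction (rev [Suc m..<i + 1]) = 1 / (tvar i 1 * (\<Prod>u=Suc m..<i. tvar u 1 - tvar (u + 1) 1))"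
    "last_var (rev [Suc m..<i + 1]) = tvar (Suc m) 1"
    using step by auto
  have "(\<Prod>u=m..<i. tvar u 1 - tvar (u + 1) 1)
      = (tvar m 1 - tvar (m + 1) 1) * (\<Prod>u=Suc m..<i. tvar u 1 - tvar (u + 1) 1)"
    using step by (simp add: prod.atLeast_Suc_lessThan)
  then show ?case
    unfolding snoc path_fraction_snoc last_var_snoc count IH by (simp add: ac_simps)
qed

lemma path_fraction_turn:
  assumes "3 \<le> j" "x \<noteq> y" "x < 3" "y < 3" "x \<notin> set v" "y \<notin> set v"
    and "\<forall>u\<in>{3..j}. d u = Suc (count_list v u)"
  shows "path_fraction (v @ [x, y] @ [3..<j + 1]) =
    path_fraction v / ((tvar x 1 - last_var v) * (tvar y 1 - tvar x 1) * (tvar 3 (d 3) - tvar y 1)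
      * (\<Prod>u=4..j. tvar u (d u) - tvar (u - 1) (d (u - 1))))"
proof -
  have v1: "path_fraction (v @ [x]) = path_fraction v / (tvar x 1 - last_var v)" "last_var (v @ [x]) = tvar x 1"
    using assms(5) by (simp_all add: path_fraction_snoc count_list_0_iff)
  have "(v @ [x]) @ [y] = v @ [x, y]" by simp
  then have v2: "path_fraction (v @ [x, y]) = path_fraction v / (tvar x 1 - last_var v) / (tvar y 1 - tvar x 1)"
    "last_var (v @ [x, y]) = tvar y 1"
    using path_fraction_snoc[of "v @ [x]" y] last_var_snoc[of "v @ [x]" y] v1 assms(2,6)
    by (simp_all add: count_list_0_iff)
  have "\<forall>u\<in>{3..j}. d u = Suc (count_list (v @ [x, y]) u)"
    using assms(3,4,7) by auto
  from path_fraction_ascend[OF assms(1) this] show ?thesis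
    by (simp add: v2 ac_simps)
qed

text \<open>Over the common denominator the numerator is (b - c)(d - a) - (a - c)(d - b) = (b - a)(d
  - c), which cancels the pole at a = b. In the application \<open>a\<close> and \<open>b\<close>
  are the variables of the letters 1 and 2, \<open>c\<close> is the variable just before the turn
  and \<open>d\<close> the one just after it.\<close>

lemma two_paths_identity:
  fixes a b c d :: "'a::field"
  assumes "a \<noteq> b" "a \<noteq> c" "b \<noteq> c" "d \<noteq> a" "d \<noteq> b"
  shows "1 / ((a - c) * (b - a) * (d - b)) + 1 / ((b - c) * (a - b) * (d - a))
    = (d - c) / ((a - c) * (b - c) * (d - a) * (d - b))"
proof -
  have "a - b \<noteq> 0" "b - a \<noteq> 0" "a - c \<noteq> 0" "b - c \<noteq> 0" "d - a \<noteq> 0" "d - b \<noteq> 0"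
    using assms by auto
  then show ?thesis
    by (simp add: divide_simps) (simp add: algebra_simps)
qed

section \<open>The coefficients at the root vectors\<close>

lemma eta_minus:
  assumes "1 \<le> i" "i < j" "j \<le> r"
  shows "eta r (EpsMinus j i) = 1 / (tvar (i + 1) 1 * (\<Prod>u=i+2..j. tvar u 1 - tvar (u - 1) 1))"
proof -
  have root: "path_root j (int i) = EpsMinus j i" by (simp add: path_root_def)
  have letters: "rev (root_letters (EpsMinus j i)) = [] @ [i + 1..<j + 1]" by (simp add: root_letters.simps)
  have "eta r (path_root j (int i)) = Sym r (root_content (EpsMinus j i)) (path_fraction ([] @ [i + 1..<j + 1]))"
    unfolding root letters[symmetric]
  proof (rule eta_single_path[where t = "int i" and j = j, unfolded root])
    show "ws = root_letters (EpsMinus j i)" if "run (int j) ws = int i" for ws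
      using run_pos_pos[OF that] assms by (simp add: root_letters.simps)
  qed (use assms in auto)
  also have "\<dots> = path_fraction ([] @ [i + 1..<j + 1])"
    by (rule Sym_trivial) simp
  also have "\<dots> = 1 / (tvar (i + 1) 1 * (\<Prod>u=i+2..j. tvar u 1 - tvar (u - 1) 1))"
    using path_fraction_ascend[of "i + 1" j "\<lambda>_. 1" "[]"] assms by simp
  finally show ?thesis unfolding root .
qed

lemma eta_plus_one:
  assumes "2 \<le> j" "j \<le> r"
  shows "eta r (EpsPlus j 1) = path_fraction (1 # [3..<j + 1])"
proof -
  have root: "path_root j (- int 1) = EpsPlus j 1" by (simp add: path_root_def)
  have letters: "rev (root_letters (EpsPlus j 1)) = 1 # [3..<j + 1]" by (simp add: root_letters.simps)
  have "eta r (path_root j (- int 1)) = Sym r (root_content (EpsPlus j 1)) (path_fraction (1 # [3..<j + 1]))"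
    unfolding root letters[symmetric]
  proof (rule eta_single_path[where t = "- int 1" and j = j, unfolded root])
    show "ws = root_letters (EpsPlus j 1)" if "run (int j) ws = - int 1" for ws
      using run_pos_neg[OF that] assms by (simp add: root_letters.simps)
  qed (use assms in auto)
  also have "\<dots> = path_fraction (1 # [3..<j + 1])"
    by (rule Sym_trivial) simp
  finally show ?thesis unfolding root .
qed

lemma path_fraction_plus_one:
  assumes "3 \<le> j"
  shows "path_fraction (1 # [3..<j + 1])
    = 1 / (tvar 1 1 * (tvar 3 1 - tvar 1 1) * (\<Prod>u=4..j. tvar u 1 - tvar (u - 1) 1))"
proof -
  have one: "path_fraction [1] = 1 / tvar 1 1" "last_var [1] = tvar 1 1"
    using path_fraction_snoc[of "[]" 1] last_var_snoc[of "[]" 1] by simp_all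
  have "path_fraction ([1] @ [3..<j + 1]) = path_fraction [1] / ((tvar 3 1 - last_var [1]) * (\<Prod>u=3+1..j. tvar u 1 - tvar (u - 1) 1))"
    using path_fraction_ascend[of 3 j "\<lambda>_. 1" "[1]"] assms by simp
  then show ?thesis unfolding one by (simp add: mult.assoc)
qed

lemma eta_plus_two:
  assumes "2 < j" "j \<le> r"
  shows "eta r (EpsPlus j 2) = tvar 3 1 / (tvar 1 1 * tvar 2 1 * (tvar 3 1 - tvar 1 1) * (tvar 3 1 - tvar 2 1)
    * (\<Prod>u=4..j. tvar u 1 - tvar (u - 1) 1))"
proof -
  let ?R = "\<Prod>u=4..j. tvar u 1 - tvar (u - 1) 1"
  let ?a = "tvar 1 1" and ?b = "tvar 2 1" and ?d = "tvar 3 1"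
  \<comment> \<open>Nothing precedes the turn here, so the variable before it is
    \<open>last_var [] = 0\<close>. The subtraction of 0 is kept to match
    \<open>two_paths_identity\<close> with \<open>c = 0\<close>.\<close>
  have turn: "path_fraction ([] @ [x, y] @ [3..<j + 1])
      = 1 / ((tvar x 1 - 0) * (tvar y 1 - tvar x 1) * (?d - tvar y 1)) * (1 / ?R)"
    if "x \<noteq> y" "x < 3" "y < 3" for x y
    using path_fraction_turn[of j x y "[]" "\<lambda>_. 1"] that assms by simp
  have trivial: "Sym r (root_content (EpsPlus j 2)) x = x" for x
    by (rule Sym_trivial) simp
  have "eta r (EpsPlus j 2) = path_fraction ([] @ [1, 2] @ [3..<j + 1]) + path_fraction ([] @ [2, 1] @ [3..<j + 1])"
    using eta_two_paths[OF order.refl assms refl, unfolded trivial] by simp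
  also have "\<dots> = (1 / ((?a - 0) * (?b - ?a) * (?d - ?b)) + 1 / ((?b - 0) * (?a - ?b) * (?d - ?a))) * (1 / ?R)"
    unfolding distrib_right by (intro arg_cong2[where f = "(+)"] turn) simp_all
  also have "\<dots> = (?d - 0) / ((?a - 0) * (?b - 0) * (?d - ?a) * (?d - ?b)) * (1 / ?R)"
    by (subst two_paths_identity) simp_all
  finally show ?thesis by simp
qed

text \<open>Exchanging the two copies of the variables with upper indices \<open>3, \<dots>, i\<close> turns the numbering
  along the path, in which the copies used before the turn come first, into that of the theorem.\<close>

lemma eta_plus:
  assumes "3 \<le> i" "i < j" "j \<le> r"
  shows "eta r (EpsPlus j i) = Sym r (content_vec (i - 2) (j - i) (r - j))
    ((tvar 3 1 - tvar 3 2) /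
      (tvar i 2 * (tvar 1 1 - tvar 3 2) * (tvar 2 1 - tvar 3 2) * (tvar 3 1 - tvar 1 1) * (tvar 3 1 - tvar 2 1)
        * (\<Prod>u=3..i-1. tvar u 2 - tvar (u + 1) 2) * (\<Prod>u=4..j. tvar u 1 - tvar (u - 1) 1)))"
proof -
  \<comment> \<open>For \<open>u >= 3\<close> this is the lower index after the turn: the letters up
    to \<open>i\<close> have already used their first variable before it.\<close>
  define d where "d u = (if u \<le> i then 2 else 1 :: nat)" for u
  let ?k = "root_content (EpsPlus j i)"
  let ?R = "\<Prod>u=4..j. tvar u (d u) - tvar (u - 1) (d (u - 1))"
  let ?Q = "\<Prod>u=3..i-1. tvar u 1 - tvar (u + 1) 1"
  let ?a = "tvar 1 1" and ?b = "tvar 2 1" and ?c = "tvar 3 1" and ?d = "tvar 3 2"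
  let ?v = "rev [3..<i + 1]"
  let ?F = "(?d - ?c) / ((?a - ?c) * (?b - ?c) * (?d - ?a) * (?d - ?b)) * (1 / (tvar i 1 * ?Q * ?R))"
  have "{3..<i} = {3..i - 1}" using assms by auto
  then have descend: "path_fraction ?v = 1 / (tvar i 1 * ?Q)" "last_var ?v = ?c"
    using path_fraction_descend[of 3 i] assms by simp_all
  have count: "\<forall>u\<in>{3..j}. d u = Suc (count_list ?v u)"
  proof
    fix u assume "u \<in> {3..j}"
    have "count (mset ?v) u = (if 3 \<le> u \<and> u \<le> i then 1 else 0)" by auto
    then show "d u = Suc (count_list ?v u)" using \<open>u \<in> {3..j}\<close> by (simp add: d_def count_mset)
  qed
  have turn: "path_fraction (?v @ [x, y] @ [3..<j + 1])
      = 1 / ((tvar x 1 - ?c) * (tvar y 1 - tvar x 1) * (?d - tvar y 1)) * (1 / (tvar i 1 * ?Q * ?R))"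
    if "x \<noteq> y" "x < 3" "y < 3" for x y
    using path_fraction_turn[of j x y ?v d] that assms count unfolding descend by (simp add: d_def[of 3] mult.assoc)
  have "path_fraction (?v @ [1, 2] @ [3..<j + 1]) + path_fraction (?v @ [2, 1] @ [3..<j + 1])
      = (1 / ((?a - ?c) * (?b - ?a) * (?d - ?b)) + 1 / ((?b - ?c) * (?a - ?b) * (?d - ?a))) * (1 / (tvar i 1 * ?Q * ?R))"
    unfolding distrib_right by (intro arg_cong2[where f = "(+)"] turn) simp_all
  also have "\<dots> = ?F"
    by (subst two_paths_identity) simp_all
  \<comment> \<open>Both words lie in the same multidegree, so the two symmetrizations are over the
    same group and merge before the fractions are added.\<close>
  finally have "eta r (EpsPlus j i) = Sym r ?k ?F"
    using eta_two_paths[of i j r ?k] assms unfolding Sym_add[symmetric] by simp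
  also have "\<dots> = Sym r ?k (rename (swap_var i) ?F)"
    using assms by (intro Sym_rename[symmetric] swap_var_perm_group) auto
  also have "rename (swap_var i) ?F = (tvar 3 1 - tvar 3 2) /
      (tvar i 2 * (tvar 1 1 - tvar 3 2) * (tvar 2 1 - tvar 3 2) * (tvar 3 1 - tvar 1 1) * (tvar 3 1 - tvar 2 1)
        * (\<Prod>u=3..i-1. tvar u 2 - tvar (u + 1) 2) * (\<Prod>u=4..j. tvar u 1 - tvar (u - 1) 1))"
  proof -
    have swap: "rename (swap_var i) (tvar u 1) = tvar u (if u \<in> {3..i} then 2 else 1)"
      "rename (swap_var i) (tvar u (d u)) = tvar u (if u < 3 then d u else 1)" for u
      by (auto simp: rename_tvar inj_swap_var swap_var_def d_def)
    have d: "rename (swap_var i) ?d = tvar 3 1"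
      using swap(2)[of 3] assms by (simp add: d_def)
    have Q: "rename (swap_var i) ?Q = (\<Prod>u=3..i-1. tvar u 2 - tvar (u + 1) 2)"
      unfolding rename_prod[OF inj_swap_var] rename_diff[OF inj_swap_var] swap
      by (rule prod.cong) auto
    have R: "rename (swap_var i) ?R = (\<Prod>u=4..j. tvar u 1 - tvar (u - 1) 1)"
      unfolding rename_prod[OF inj_swap_var] rename_diff[OF inj_swap_var] swap
      by (rule prod.cong) auto
    have one: "rename (swap_var i) 1 = 1" by (rule rename_one[OF inj_swap_var])
    show ?thesis
      unfolding rename_mult[OF inj_swap_var] rename_divide[OF inj_swap_var] Q R d rename_diff[OF inj_swap_var] one swap
      using assms by (simp add: ac_simps)
  qed
  finally show ?thesis
    using root_content_eq_content_vec[of i j r] assms by simp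
qed

theorem theorem6p8:
  fixes r :: nat
  assumes "r \<ge> 3"
  shows
    "(\<forall>i j. 1 \<le> i \<and> i < j \<and> j \<le> r \<longrightarrow>
        eta r (EpsMinus j i) =
          1 / (tvar (i + 1) 1 * (\<Prod>u=i+2..j. tvar u 1 - tvar (u - 1) 1)))
   \<and> (\<forall>j. 3 \<le> j \<and> j \<le> r \<longrightarrow>
        eta r (EpsPlus j 1) =
          1 / (tvar 1 1 * (tvar 3 1 - tvar 1 1) * (\<Prod>u=4..j. tvar u 1 - tvar (u - 1) 1)))
   \<and> eta r (EpsPlus 2 1) = 1 / tvar 1 1
   \<and> (\<forall>i j. 3 \<le> i \<and> i < j \<and> j \<le> r \<longrightarrow>
        eta r (EpsPlus j i) =
          Sym r (content_vec (i - 2) (j - i) (r - j))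
            ((tvar 3 1 - tvar 3 2) /
             (tvar i 2 * (tvar 1 1 - tvar 3 2) * (tvar 2 1 - tvar 3 2)
                * (tvar 3 1 - tvar 1 1) * (tvar 3 1 - tvar 2 1)
                * (\<Prod>u=3..i-1. tvar u 2 - tvar (u + 1) 2)
                * (\<Prod>u=4..j. tvar u 1 - tvar (u - 1) 1))))
   \<and> (\<forall>j. 2 < j \<and> j \<le> r \<longrightarrow>
        eta r (EpsPlus j 2) =
          tvar 3 1 /
             (tvar 1 1 * tvar 2 1 * (tvar 3 1 - tvar 1 1) * (tvar 3 1 - tvar 2 1)
                * (\<Prod>u=4..j. tvar u 1 - tvar (u - 1) 1)))"
proof (intro conjI allI impI)
  have "path_fraction (1 # [3..<2 + 1]) = 1 / tvar 1 1"
    using path_fraction_snoc[of "[]" 1] by simp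
  then show "eta r (EpsPlus 2 1) = 1 / tvar 1 1"
    using eta_plus_one[of 2 r] assms by simp
qed (use eta_minus eta_plus eta_plus_two eta_plus_one path_fraction_plus_one in \<open>simp_all del: One_nat_def\<close>)

end
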